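(* Let $(E,\mathcal F,\mu)$ be a nice measure space and let $(P_t)_{t\ge 0}$ be a symmetric Markov semigroup on $E$ with generator $L$, symmetric in $\mathcal L^2(\mu)$, and Dirichlet form $\mathcal E_\mu$. Assume that: (1) there exists a Lyapunov function $V\in \mathcal L^2(\mu)$ with Lyapunov constant $c\ge 0$; (2) for some $M\ge 0$, the Dirichlet form $\mathcal E_\mu$ satisfies a weighted Nash inequality with weight $V$ and rate function $\phi$ on $(M,+\infty)$, where $\displaystyle\int^{\infty}\frac{1}{\phi(x)}\,dx<\infty$. Let $U$ be the decreasing function on $(M,+\infty)$ defined by $U(x)=\int_x^\infty \frac{du}{\phi(u)}$, let $U(M)=\lim_{x\downarrow M}U(x)\in(0,+\infty]$, and define $$K(x)=\begin{cases}\sqrt{U^{-1}(x)} & \text{if } 0<x<U(M),\\ \sqrt{M} & \text{if } x\ge U(M)\end{cases}$$ (if $U(M)=+\infty$, only the first line is used). Then for every $t>0$ the operator $P_t$ has a density $p_t$ with respect to $\mu$, and $$p_{2t}(x,y)\le K(2t)^2\,e^{2ct}\,V(x)V(y)$$ for all $t>0$ and $\mu\otimes\mu$-almost every $(x,y)\in E\times E$. Moreover, for all $t>0$, $P_t$ is Hilbert-Schmidt on $\mathcal L^2(\mu)$, and therefore has a discrete spectrum $(\mu_n(t))_{n}$ (eigenvalues counted with multiplicity), which satisfies $$\sum_n \mu_n(t)^2\le K(2t)^2e^{2ct}\int_E V^2\,d\mu .$$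
   Context: Norms $\|\cdot\|_p$ are the norms of $\mathcal L^p(\mu)$; $\mu$ is a ($\sigma$-finite) measure that may have finite or infinite mass. Nice measure space: $(E,\mathcal F,\mu)$ is called nice if every bounded operator from $\mathcal L^1(\mu)$ to $\mathcal L^\infty(\mu)$ with norm $C$ can be represented by a kernel density with respect to $\mu$ which is bounded in absolute value by $C$, $\mu\otimes\mu$-almost everywhere (this holds for instance if $\mathcal F$ is generated, up to null sets, by a countable family; Polish spaces are included). Symmetric Markov semigroup: a family $(P_t)_{t\ge 0}$ of positivity preserving linear operators on bounded measurable functions, with $P_t1=1$, $P_t\circ P_s=P_{t+s}$, symmetric in $\mathcal L^2(\mu)$ (hence contractions on every $\mathcal L^p(\mu)$, $1\le p\le\infty$), with $P_tf\to f$ in $\mathcal L^2(\mu)$ as $t\to0$ for every $f\in\mathcal L^2(\mu)$; each $P_t$ is assumed to be given by a (probability) kernel. Its generator $L$ is the self-adjoint operator on $\mathcal L^2(\mu)$ with $P_t=\exp(tL)$. The Dirichlet form is $\mathcal E_\mu(f,f)=-\int f\,Lf\,d\mu$, extended to its natural domain (the form domain of $-L$). $P_t$ has a density $p_t$ with respect to $\mu$ if there is a nonnegative symmetric measurable function $p_t$ on $E\times E$ with $P_tf(x)=\int_E f(y)p_t(x,y)\,d\mu(y)$ for $\mu$-almost every $x$, for $f\in\mathcal L^2(\mu)$. Weighted Nash inequality: let $V$ be a positive function on $E$, $M\ge0$, and $\phi$ a positive function on $(M,\infty)$ such that $\phi(x)/x$ is non-decreasing. $\mathcal E_\mu$ satisfies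 a weighted Nash inequality with weight $V$ and rate function $\phi$ if $$\phi\left(\frac{\|f\|_2^2}{\|fV\|_1^2}\right)\le\frac{\mathcal E_\mu(f,f)}{\|fV\|_1^2}$$ for all $f$ in the domain of the Dirichlet form such that $\|f\|_2^2>M\|fV\|_1^2$. Lyapunov function: a positive function $V$ on $E$, in the domain of $L$, such that $LV\le cV$ for a real constant $c$, called the Lyapunov constant. *)

theory Defs
  imports "HOL-Probability.Probability"
begin

section \<open>The spaces \<open>L\<^sup>1\<close> and \<open>L\<^sup>2\<close>\<close>

text \<open>Elements of \<open>L\<^sup>p(\<mu>)\<close> are represented by real-valued measurable functions; identities between
  them are \<open>\<mu>\<close>-almost everywhere identities, and operators act on representatives.\<close>

definition L1_space :: "'a measure \<Rightarrow> ('a \<Rightarrow> real) set" where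
  "L1_space \<mu> = {f. integrable \<mu> f}"

definition L1_norm :: "'a measure \<Rightarrow> ('a \<Rightarrow> real) \<Rightarrow> real" where
  "L1_norm \<mu> f = (\<integral>x. \<bar>f x\<bar> \<partial>\<mu>)"

definition L2_space :: "'a measure \<Rightarrow> ('a \<Rightarrow> real) set" where
  "L2_space \<mu> = {f \<in> borel_measurable \<mu>. integrable \<mu> (\<lambda>x. (f x)\<^sup>2)}"

definition L2_inner :: "'a measure \<Rightarrow> ('a \<Rightarrow> real) \<Rightarrow> ('a \<Rightarrow> real) \<Rightarrow> real" where
  "L2_inner \<mu> f g = (\<integral>x. f x * g x \<partial>\<mu>)"

definition L2_norm :: "'a measure \<Rightarrow> ('a \<Rightarrow> real) \<Rightarrow> real" where
  "L2_norm \<mu> f = sqrt (\<integral>x. (f x)\<^sup>2 \<partial>\<mu>)"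

definition AE_linear_on ::
  "'a measure \<Rightarrow> ('a \<Rightarrow> real) set \<Rightarrow> (('a \<Rightarrow> real) \<Rightarrow> 'a \<Rightarrow> real) \<Rightarrow> bool" where
  "AE_linear_on \<mu> S T \<longleftrightarrow>
     (\<forall>f\<in>S. \<forall>g\<in>S. \<forall>a b. AE x in \<mu>. T (\<lambda>y. a * f y + b * g y) x = a * T f x + b * T g x)"

section \<open>Nice measure spaces\<close>

text \<open>\<open>C\<close> bounds \<open>T\<close> when \<open>\<parallel>T f\<parallel>\<^sub>\<infinity> \<le> C \<parallel>f\<parallel>\<^sub>1\<close> for all \<open>f\<close>. Together with linearity,
  such a bound makes \<open>T\<close> respect almost everywhere equality.\<close>

definition L1_Linf_bounds ::
  "'a measure \<Rightarrow> (('a \<Rightarrow> real) \<Rightarrow> 'a \<Rightarrow> real) \<Rightarrow> real set" where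
  "L1_Linf_bounds \<mu> T =
     {C. 0 \<le> C \<and> (\<forall>f\<in>L1_space \<mu>. AE x in \<mu>. \<bar>T f x\<bar> \<le> C * L1_norm \<mu> f)}"

definition L1_Linf_bounded_operator ::
  "'a measure \<Rightarrow> (('a \<Rightarrow> real) \<Rightarrow> 'a \<Rightarrow> real) \<Rightarrow> bool" where
  "L1_Linf_bounded_operator \<mu> T \<longleftrightarrow>
     (\<forall>f\<in>L1_space \<mu>. T f \<in> borel_measurable \<mu>) \<and>
     AE_linear_on \<mu> (L1_space \<mu>) T \<and>
     L1_Linf_bounds \<mu> T \<noteq> {}"

definition L1_Linf_opnorm ::
  "'a measure \<Rightarrow> (('a \<Rightarrow> real) \<Rightarrow> 'a \<Rightarrow> real) \<Rightarrow> real" where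
  "L1_Linf_opnorm \<mu> T = Inf (L1_Linf_bounds \<mu> T)"

definition nice_measure_space :: "'a measure \<Rightarrow> bool" where
  "nice_measure_space \<mu> \<longleftrightarrow>
     (\<forall>T. L1_Linf_bounded_operator \<mu> T \<longrightarrow>
        (\<exists>k. (\<lambda>(x, y). k x y) \<in> borel_measurable (\<mu> \<Otimes>\<^sub>M \<mu>) \<and>
             (AE (x, y) in \<mu> \<Otimes>\<^sub>M \<mu>. \<bar>k x y\<bar> \<le> L1_Linf_opnorm \<mu> T) \<and>
             (\<forall>f\<in>L1_space \<mu>. AE x in \<mu>. T f x = (\<integral>y. f y * k x y \<partial>\<mu>))))"

section \<open>Symmetric Markov semigroups\<close>

definition kernel_op :: "('a \<Rightarrow> 'a measure) \<Rightarrow> ('a \<Rightarrow> real) \<Rightarrow> 'a \<Rightarrow> real" where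
  "kernel_op k f x = (\<integral>y. f y \<partial>k x)"

text \<open>The semigroup is given by its probability kernels, \<open>P\<^sub>t = kernel_op (\<kappa> t)\<close>; linearity,
  preservation of positivity and \<open>P\<^sub>t 1 = 1\<close> are then automatic. By symmetry \<open>\<mu>\<close> is invariant, so for
  \<open>f\<close> in \<open>L\<^sup>2(\<mu>)\<close> the integral defining \<open>P\<^sub>t f x\<close> converges for almost every \<open>x\<close>, and the same
  formula gives the extension of \<open>P\<^sub>t\<close> to \<open>L\<^sup>2(\<mu>)\<close>.\<close>

locale symmetric_markov_semigroup = sigma_finite_measure \<mu>
  for \<mu> :: "'a measure" and \<kappa> :: "real \<Rightarrow> 'a \<Rightarrow> 'a measure" +
  assumes kernel: "\<And>t. 0 \<le> t \<Longrightarrow> \<kappa> t \<in> \<mu> \<rightarrow>\<^sub>M prob_algebra \<mu>"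
    and semigroup: "\<And>s t f. 0 \<le> s \<Longrightarrow> 0 \<le> t \<Longrightarrow> f \<in> borel_measurable \<mu> \<Longrightarrow> bounded (f ` space \<mu>) \<Longrightarrow>
          AE x in \<mu>. kernel_op (\<kappa> t) (kernel_op (\<kappa> s) f) x = kernel_op (\<kappa> (t + s)) f x"
    and symmetric: "\<And>t f g. 0 \<le> t \<Longrightarrow> f \<in> L2_space \<mu> \<Longrightarrow> g \<in> L2_space \<mu> \<Longrightarrow>
          L2_inner \<mu> f (kernel_op (\<kappa> t) g) = L2_inner \<mu> (kernel_op (\<kappa> t) f) g"
    and continuous: "\<And>f. f \<in> L2_space \<mu> \<Longrightarrow>
          ((\<lambda>t. L2_norm \<mu> (\<lambda>x. kernel_op (\<kappa> t) f x - f x)) \<longlongrightarrow> 0) (at_right 0)"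

section \<open>Generator and Dirichlet form\<close>

text \<open>The self-adjoint \<open>L\<close> with \<open>P\<^sub>t = exp (t L)\<close> is the infinitesimal generator:
  \<open>L f = g\<close> when \<open>(P\<^sub>t f - f) / t\<close> converges to \<open>g\<close> in \<open>L\<^sup>2(\<mu>)\<close> as \<open>t\<close> decreases to \<open>0\<close>.\<close>

definition is_generator_image ::
  "'a measure \<Rightarrow> (real \<Rightarrow> 'a \<Rightarrow> 'a measure) \<Rightarrow> ('a \<Rightarrow> real) \<Rightarrow> ('a \<Rightarrow> real) \<Rightarrow> bool" where
  "is_generator_image \<mu> \<kappa> f g \<longleftrightarrow>
     f \<in> L2_space \<mu> \<and> g \<in> L2_space \<mu> \<and>
     ((\<lambda>t. L2_norm \<mu> (\<lambda>x. (kernel_op (\<kappa> t) f x - f x) / t - g x)) \<longlongrightarrow> 0) (at_right 0)"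

definition generator_domain ::
  "'a measure \<Rightarrow> (real \<Rightarrow> 'a \<Rightarrow> 'a measure) \<Rightarrow> ('a \<Rightarrow> real) set" where
  "generator_domain \<mu> \<kappa> = {f. \<exists>g. is_generator_image \<mu> \<kappa> f g}"

text \<open>Only determined up to null sets, hence the arbitrary choice of a representative.\<close>

definition generator ::
  "'a measure \<Rightarrow> (real \<Rightarrow> 'a \<Rightarrow> 'a measure) \<Rightarrow> ('a \<Rightarrow> real) \<Rightarrow> 'a \<Rightarrow> real" where
  "generator \<mu> \<kappa> f = (SOME g. is_generator_image \<mu> \<kappa> f g)"

definition pre_dirichlet ::
  "'a measure \<Rightarrow> (real \<Rightarrow> 'a \<Rightarrow> 'a measure) \<Rightarrow> ('a \<Rightarrow> real) \<Rightarrow> real" where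
  "pre_dirichlet \<mu> \<kappa> f = - (\<integral>x. f x * generator \<mu> \<kappa> f x \<partial>\<mu>)"

text \<open>The Dirichlet form is the closure of \<open>f \<mapsto> - \<integral> f L f d\<mu>\<close>, defined on the domain of \<open>L\<close>;
  the domain of the closure is the form domain of \<open>- L\<close>. As the form is closable,
  the value does not depend on the approximating sequence.\<close>

definition dirichlet_approx ::
  "'a measure \<Rightarrow> (real \<Rightarrow> 'a \<Rightarrow> 'a measure) \<Rightarrow> ('a \<Rightarrow> real) \<Rightarrow> (nat \<Rightarrow> 'a \<Rightarrow> real) \<Rightarrow> bool" where
  "dirichlet_approx \<mu> \<kappa> f u \<longleftrightarrow>
     (\<forall>n. u n \<in> generator_domain \<mu> \<kappa>) \<and>
     (\<lambda>n. L2_norm \<mu> (\<lambda>x. u n x - f x)) \<longlonglongrightarrow> 0 \<and>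
     (\<forall>\<epsilon>>0. \<exists>N. \<forall>m\<ge>N. \<forall>n\<ge>N. pre_dirichlet \<mu> \<kappa> (\<lambda>x. u m x - u n x) < \<epsilon>)"

definition dirichlet_domain ::
  "'a measure \<Rightarrow> (real \<Rightarrow> 'a \<Rightarrow> 'a measure) \<Rightarrow> ('a \<Rightarrow> real) set" where
  "dirichlet_domain \<mu> \<kappa> = {f \<in> L2_space \<mu>. \<exists>u. dirichlet_approx \<mu> \<kappa> f u}"

definition dirichlet_form ::
  "'a measure \<Rightarrow> (real \<Rightarrow> 'a \<Rightarrow> 'a measure) \<Rightarrow> ('a \<Rightarrow> real) \<Rightarrow> real" where
  "dirichlet_form \<mu> \<kappa> f =
     (THE e. \<exists>u. dirichlet_approx \<mu> \<kappa> f u \<and> (\<lambda>n. pre_dirichlet \<mu> \<kappa> (u n)) \<longlonglongrightarrow> e)"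

section \<open>Lyapunov functions and weighted Nash inequalities\<close>

definition lyapunov_function ::
  "'a measure \<Rightarrow> (real \<Rightarrow> 'a \<Rightarrow> 'a measure) \<Rightarrow> ('a \<Rightarrow> real) \<Rightarrow> real \<Rightarrow> bool" where
  "lyapunov_function \<mu> \<kappa> V c \<longleftrightarrow>
     (\<forall>x\<in>space \<mu>. 0 < V x) \<and> V \<in> generator_domain \<mu> \<kappa> \<and>
     (AE x in \<mu>. generator \<mu> \<kappa> V x \<le> c * V x)"

text \<open>The integrability condition only excludes functions with \<open>\<parallel>f V\<parallel>\<^sub>1 = \<infinity>\<close>;
  it always holds when \<open>V\<close> is in \<open>L\<^sup>2(\<mu>)\<close>.\<close>

definition weighted_nash ::
  "'a measure \<Rightarrow> (real \<Rightarrow> 'a \<Rightarrow> 'a measure) \<Rightarrow> ('a \<Rightarrow> real) \<Rightarrow> real \<Rightarrow> (real \<Rightarrow> real) \<Rightarrow> bool" where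
  "weighted_nash \<mu> \<kappa> V M \<phi> \<longleftrightarrow>
     V \<in> borel_measurable \<mu> \<and> (\<forall>x\<in>space \<mu>. 0 < V x) \<and> 0 \<le> M \<and>
     (\<forall>x>M. 0 < \<phi> x) \<and> mono_on {M<..} (\<lambda>x. \<phi> x / x) \<and>
     (\<forall>f\<in>dirichlet_domain \<mu> \<kappa>.
        integrable \<mu> (\<lambda>x. f x * V x) \<longrightarrow>
        (L2_norm \<mu> f)\<^sup>2 > M * (L1_norm \<mu> (\<lambda>x. f x * V x))\<^sup>2 \<longrightarrow>
        \<phi> ((L2_norm \<mu> f)\<^sup>2 / (L1_norm \<mu> (\<lambda>x. f x * V x))\<^sup>2)
          \<le> dirichlet_form \<mu> \<kappa> f / (L1_norm \<mu> (\<lambda>x. f x * V x))\<^sup>2)"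

definition nash_U :: "(real \<Rightarrow> real) \<Rightarrow> real \<Rightarrow> real" where
  "nash_U \<phi> x = (LINT u:{x<..}|lborel. 1 / \<phi> u)"

definition nash_U_lim :: "real \<Rightarrow> (real \<Rightarrow> real) \<Rightarrow> ereal" where
  "nash_U_lim M \<phi> = Lim (at_right M) (\<lambda>x. ereal (nash_U \<phi> x))"

definition nash_K :: "real \<Rightarrow> (real \<Rightarrow> real) \<Rightarrow> real \<Rightarrow> real" where
  "nash_K M \<phi> x =
     (if ereal x < nash_U_lim M \<phi> then sqrt (the_inv_into {M<..} (nash_U \<phi>) x) else sqrt M)"

section \<open>Densities, Hilbert-Schmidt operators and discrete spectrum\<close>

definition has_kernel_density ::
  "'a measure \<Rightarrow> (('a \<Rightarrow> real) \<Rightarrow> 'a \<Rightarrow> real) \<Rightarrow> ('a \<Rightarrow> 'a \<Rightarrow> real) \<Rightarrow> bool" where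
  "has_kernel_density \<mu> T p \<longleftrightarrow>
     (\<lambda>(x, y). p x y) \<in> borel_measurable (\<mu> \<Otimes>\<^sub>M \<mu>) \<and>
     (\<forall>x\<in>space \<mu>. \<forall>y\<in>space \<mu>. 0 \<le> p x y \<and> p x y = p y x) \<and>
     (\<forall>f\<in>L2_space \<mu>. AE x in \<mu>.
        integrable \<mu> (\<lambda>y. f y * p x y) \<and> T f x = (\<integral>y. f y * p x y \<partial>\<mu>))"

definition L2_bounded_operator ::
  "'a measure \<Rightarrow> (('a \<Rightarrow> real) \<Rightarrow> 'a \<Rightarrow> real) \<Rightarrow> bool" where
  "L2_bounded_operator \<mu> T \<longleftrightarrow>
     (\<forall>f\<in>L2_space \<mu>. T f \<in> L2_space \<mu>) \<and> AE_linear_on \<mu> (L2_space \<mu>) T \<and>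
     (\<exists>C. \<forall>f\<in>L2_space \<mu>. L2_norm \<mu> (T f) \<le> C * L2_norm \<mu> f)"

text \<open>A maximal orthonormal family. The index type is arbitrary because \<open>L\<^sup>2(\<mu>)\<close> is not assumed to
  be separable.\<close>

definition L2_orthonormal_basis ::
  "'a measure \<Rightarrow> 'i set \<Rightarrow> ('i \<Rightarrow> 'a \<Rightarrow> real) \<Rightarrow> bool" where
  "L2_orthonormal_basis \<mu> I e \<longleftrightarrow>
     (\<forall>i\<in>I. e i \<in> L2_space \<mu>) \<and>
     (\<forall>i\<in>I. \<forall>j\<in>I. L2_inner \<mu> (e i) (e j) = (if i = j then 1 else 0)) \<and>
     (\<forall>f\<in>L2_space \<mu>. (\<forall>i\<in>I. L2_inner \<mu> f (e i) = 0) \<longrightarrow> (AE x in \<mu>. f x = 0))"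

definition hilbert_schmidt ::
  "'a measure \<Rightarrow> (('a \<Rightarrow> real) \<Rightarrow> 'a \<Rightarrow> real) \<Rightarrow> bool" where
  "hilbert_schmidt \<mu> T \<longleftrightarrow>
     L2_bounded_operator \<mu> T \<and>
     (\<exists>B. L2_orthonormal_basis \<mu> B (\<lambda>e. e) \<and> (\<lambda>e. (L2_norm \<mu> (T e))\<^sup>2) summable_on B)"

text \<open>\<open>r\<close> is outside the spectrum when \<open>T - r\<close> is a bijection of \<open>L\<^sup>2(\<mu>)\<close> with bounded inverse.
  Only self-adjoint operators are considered, so real \<open>r\<close> suffice.\<close>

definition L2_spectrum ::
  "'a measure \<Rightarrow> (('a \<Rightarrow> real) \<Rightarrow> 'a \<Rightarrow> real) \<Rightarrow> real set" where
  "L2_spectrum \<mu> T =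
     {r. \<not> ((\<forall>g\<in>L2_space \<mu>. \<exists>f\<in>L2_space \<mu>. AE x in \<mu>. T f x - r * f x = g x) \<and>
            (\<exists>C. \<forall>f\<in>L2_space \<mu>. L2_norm \<mu> f \<le> C * L2_norm \<mu> (\<lambda>x. T f x - r * f x)))}"

text \<open>The family \<open>(lam n)\<close>, \<open>n \<in> I\<close>, is finite or infinite and lists the eigenvalues with
  multiplicity: it comes from an orthonormal basis of eigenfunctions. The point \<open>0\<close> is special,
  as for any compact operator: it may be in the spectrum as an accumulation point only.\<close>

definition has_discrete_spectrum ::
  "'a measure \<Rightarrow> (('a \<Rightarrow> real) \<Rightarrow> 'a \<Rightarrow> real) \<Rightarrow> nat set \<Rightarrow> (nat \<Rightarrow> real) \<Rightarrow> bool" where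
  "has_discrete_spectrum \<mu> T I lam \<longleftrightarrow>
     (\<exists>e. L2_orthonormal_basis \<mu> I e \<and> (\<forall>n\<in>I. AE x in \<mu>. T (e n) x = lam n * e n x)) \<and>
     L2_spectrum \<mu> T - {0} = lam ` I - {0} \<and>
     (\<forall>\<epsilon>>0. finite {n \<in> I. \<epsilon> \<le> \<bar>lam n\<bar>})"

end

theory Submission
  imports Defs "HOL-Library.Function_Algebras"
begin

text \<open>Along the semigroup, \<open>h(t) = e\<^sup>-\<^sup>2\<^sup>c\<^sup>t \<parallel>P\<^sub>t f\<parallel>\<^sub>2\<^sup>2 / \<parallel>f V\<parallel>\<^sub>1\<^sup>2\<close> satisfies \<open>h' \<le> - 2 \<phi>(h)\<close> while \<open>h > M\<close>: the Lyapunov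
  condition gives \<open>\<parallel>V P\<^sub>t f\<parallel>\<^sub>1 \<le> e\<^sup>c\<^sup>t \<parallel>f V\<parallel>\<^sub>1\<close>, and the Nash inequality applies to \<open>P\<^sub>t f\<close>. As \<open>U' = - 1 / \<phi>\<close>, this
  yields \<open>U(h(t)) \<ge> 2 t\<close>, that is \<open>\<parallel>P\<^sub>t f\<parallel>\<^sub>2 \<le> K(2t) e\<^sup>c\<^sup>t \<parallel>f V\<parallel>\<^sub>1\<close>. By duality \<open>|P\<^sub>t f| \<le> K(2t) e\<^sup>c\<^sup>t \<parallel>f\<parallel>\<^sub>2 V\<close>. Applied
  to the combinations of an orthonormal family \<open>e\<^sub>1, \<dots>, e\<^sub>n\<close>, the last bound gives
  \<open>\<Sum> (P\<^sub>t e\<^sub>i)\<^sup>2 \<le> K(2t)\<^sup>2 e\<^sup>2\<^sup>c\<^sup>t V\<^sup>2\<close> pointwise, hence the Hilbert-Schmidt bound without any use of a density. As \<open>P\<^sub>t\<close>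
  is injective, its eigenbasis is countable. Composing both bounds, \<open>f \<mapsto> V\<^sup>-\<^sup>1 P\<^sub>2\<^sub>t (V\<^sup>-\<^sup>1 f)\<close> maps \<open>L\<^sup>1\<close> to
  \<open>L\<^sup>\<infinity>\<close> with norm at most \<open>K(2t)\<^sup>2 e\<^sup>2\<^sup>c\<^sup>t\<close>, which gives the density.\<close>

section \<open>Semi-inner product spaces\<close>

text \<open>Little regularity is available, and this decides the form of many steps. The rate
  \<open>\<phi>\<close> is only monotone, so \<open>U\<close> need not be differentiable: secant
  bounds replace its derivative, and the differential inequality is integrated from right
  derivatives. That \<open>\<phi> x / x\<close> is non-decreasing allows the weighted norm of
  \<open>P t f\<close> to be replaced by its Lyapunov bound in the Nash inequality: for fixed
  \<open>w > 0\<close>, \<open>n * \<phi> (w / n)\<close> does not increase with \<open>n\<close>.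
  The inequality is derived on the domain of the generator and extended by density, as
  \<open>V\<close> in L2 makes the weighted norm continuous on L2. L2 need not be separable, hence
  Zorn's lemma and sums over arbitrary sets. The density needs more than the L2 bounds. For
  \<open>f\<close> in L1, \<open>f / V\<close> need not lie in L2, so the bounds are extended,
  through the probability kernels, to functions of finite weighted norm. The kernel provided by a
  nice space is not known to be symmetric or nonnegative; and as the sigma-algebra need not be
  countably generated, nonnegativity cannot be read off from countably many test sets.\<close>

instantiation "fun" :: (type, real_vector) real_vector
begin

definition scaleR_fun_def: "r *\<^sub>R f = (\<lambda>x. r *\<^sub>R f x)"

instance
  by standard (auto simp: scaleR_fun_def fun_eq_iff scaleR_add_right scaleR_add_left)

end

text \<open>Vectors at distance \<open>0\<close> are not identified, so that functions can be used instead of their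
  classes modulo null sets.\<close>

locale semi_hilbert =
  fixes H :: "'v::real_vector set" and ip :: "'v \<Rightarrow> 'v \<Rightarrow> real"
  assumes subspace_H: "subspace H"
    and ip_commute: "x \<in> H \<Longrightarrow> y \<in> H \<Longrightarrow> ip x y = ip y x"
    and ip_add: "x \<in> H \<Longrightarrow> y \<in> H \<Longrightarrow> z \<in> H \<Longrightarrow> ip (x + y) z = ip x z + ip y z"
    and ip_scale: "x \<in> H \<Longrightarrow> y \<in> H \<Longrightarrow> ip (a *\<^sub>R x) y = a * ip x y"
    and ip_nonneg: "x \<in> H \<Longrightarrow> 0 \<le> ip x x"
    and complete: "(\<And>n. X n \<in> H) \<Longrightarrow>
          (\<And>e. 0 < e \<Longrightarrow> \<exists>N. \<forall>m\<ge>N. \<forall>n\<ge>N. ip (X m - X n) (X m - X n) < e) \<Longrightarrow>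
          \<exists>x\<in>H. (\<lambda>n. ip (X n - x) (X n - x)) \<longlonglongrightarrow> 0"
begin

definition nrm :: "'v \<Rightarrow> real" where "nrm x = sqrt (ip x x)"

definition symmetric_op :: "('v \<Rightarrow> 'v) \<Rightarrow> bool" where
  "symmetric_op T \<longleftrightarrow> (\<forall>x\<in>H. T x \<in> H) \<and> (\<forall>x\<in>H. \<forall>y\<in>H. ip (T x) y = ip x (T y))"

text \<open>The equality test is literal equality of vectors. Two vectors of \<open>F\<close> at
  distance 0 would have inner product 1, so an orthonormal set contains at most one representative
  of each class.\<close>

definition orthonormal :: "'v set \<Rightarrow> bool" where
  "orthonormal F \<longleftrightarrow> F \<subseteq> H \<and> (\<forall>e\<in>F. \<forall>e'\<in>F. ip e e' = (if e = e' then 1 else 0))"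

section \<open>Elementary geometry of the semi-norm\<close>

lemma H_closed [simp, intro]:
  "0 \<in> H" "x \<in> H \<Longrightarrow> y \<in> H \<Longrightarrow> x + y \<in> H" "x \<in> H \<Longrightarrow> a *\<^sub>R x \<in> H"
  "x \<in> H \<Longrightarrow> y \<in> H \<Longrightarrow> x - y \<in> H" "x \<in> H \<Longrightarrow> - x \<in> H"
  using subspace_H by (auto simp: subspace_0 subspace_add subspace_scale subspace_diff subspace_neg)

lemma H_sum [simp, intro]: "(\<And>i. i \<in> A \<Longrightarrow> f i \<in> H) \<Longrightarrow> sum f A \<in> H"
  using subspace_H by (rule subspace_sum)

lemma ip_add_right: "x \<in> H \<Longrightarrow> y \<in> H \<Longrightarrow> z \<in> H \<Longrightarrow> ip z (x + y) = ip z x + ip z y"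
  using ip_add[of x y z] by (simp add: ip_commute[of z])

lemma ip_scale_right: "x \<in> H \<Longrightarrow> y \<in> H \<Longrightarrow> ip y (a *\<^sub>R x) = a * ip y x"
  using ip_scale[of x y a] by (simp add: ip_commute[of y])

lemma ip_minus: "x \<in> H \<Longrightarrow> z \<in> H \<Longrightarrow> ip (- x) z = - ip x z"
  using ip_scale[of x z "-1"] by simp

lemma ip_minus_right: "x \<in> H \<Longrightarrow> z \<in> H \<Longrightarrow> ip z (- x) = - ip z x"
  using ip_scale_right[of x z "-1"] by simp

lemma ip_diff: "x \<in> H \<Longrightarrow> y \<in> H \<Longrightarrow> z \<in> H \<Longrightarrow> ip (x - y) z = ip x z - ip y z"
  using ip_add[of x "- y" z] by (simp add: ip_minus)

lemma ip_diff_right: "x \<in> H \<Longrightarrow> y \<in> H \<Longrightarrow> z \<in> H \<Longrightarrow> ip z (x - y) = ip z x - ip z y"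
  using ip_add_right[of x "- y" z] by (simp add: ip_minus_right)

lemma ip_zero [simp]: "x \<in> H \<Longrightarrow> ip 0 x = 0" "x \<in> H \<Longrightarrow> ip x 0 = 0"
  using ip_scale[of 0 x 0] ip_scale_right[of 0 x 0] by simp_all

lemmas ip_simps = ip_add ip_add_right ip_scale ip_scale_right ip_diff ip_diff_right
  ip_minus ip_minus_right

lemma ip_sum: "(\<And>i. i \<in> A \<Longrightarrow> f i \<in> H) \<Longrightarrow> z \<in> H \<Longrightarrow> ip (sum f A) z = (\<Sum>i\<in>A. ip (f i) z)"
  by (induction A rule: infinite_finite_induct) (auto simp: ip_add)

lemma nrm_nonneg [simp]: "x \<in> H \<Longrightarrow> 0 \<le> nrm x"
  by (simp add: nrm_def ip_nonneg)

lemma nrm_sq: "x \<in> H \<Longrightarrow> (nrm x)\<^sup>2 = ip x x"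
  by (simp add: nrm_def ip_nonneg)

lemma nrm_zero [simp]: "nrm 0 = 0"
  by (simp add: nrm_def)

lemma nrm_scale: "x \<in> H \<Longrightarrow> nrm (a *\<^sub>R x) = \<bar>a\<bar> * nrm x"
  by (simp add: nrm_def ip_simps real_sqrt_mult flip: mult.assoc)

lemma nrm_minus [simp]: "x \<in> H \<Longrightarrow> nrm (- x) = nrm x"
  using nrm_scale[of x "-1"] by simp

lemma nrm_commute: "x \<in> H \<Longrightarrow> y \<in> H \<Longrightarrow> nrm (x - y) = nrm (y - x)"
  using nrm_minus[of "x - y"] by simp

lemma nrm_diff_sq: "x \<in> H \<Longrightarrow> y \<in> H \<Longrightarrow> (nrm (x - y))\<^sup>2 = (nrm x)\<^sup>2 + (nrm y)\<^sup>2 - 2 * ip x y"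
  by (simp add: nrm_sq ip_simps ip_commute[of y x])

lemma Cauchy_Schwarz:
  assumes x: "x \<in> H" and y: "y \<in> H"
  shows "\<bar>ip x y\<bar> \<le> nrm x * nrm y"
proof -
  have q: "0 \<le> ip x x - 2 * s * ip x y + s\<^sup>2 * ip y y" for s
    using ip_nonneg[of "x - s *\<^sub>R y"] x y
    by (simp add: ip_simps ip_commute[of y x] power2_eq_square algebra_simps)
  have "(ip x y)\<^sup>2 \<le> ip x x * ip y y"
  proof (cases "ip y y = 0")
    case True
    have "ip x y = 0"
    proof (rule ccontr)
      assume "ip x y \<noteq> 0"
      then show False
        using q[of "(ip x x + 1) / (2 * ip x y)"] True by simp
    qed
    then show ?thesis by (simp add: True)
  next
    case False
    then have "0 < ip y y" using ip_nonneg[OF y] by simp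
    then show ?thesis
      using q[of "ip x y / ip y y"] by (simp add: field_simps power2_eq_square)
  qed
  then have "sqrt ((ip x y)\<^sup>2) \<le> sqrt (ip x x * ip y y)" by (rule real_sqrt_le_mono)
  then show ?thesis by (simp add: nrm_def real_sqrt_mult)
qed

lemma ip_le_nrm: "x \<in> H \<Longrightarrow> y \<in> H \<Longrightarrow> ip x y \<le> nrm x * nrm y"
  using Cauchy_Schwarz[of x y] by simp

lemma nrm_triangle:
  assumes x: "x \<in> H" and y: "y \<in> H"
  shows "nrm (x + y) \<le> nrm x + nrm y"
proof (rule power2_le_imp_le)
  show "(nrm (x + y))\<^sup>2 \<le> (nrm x + nrm y)\<^sup>2"
    using ip_le_nrm[OF x y] x y
    by (simp add: nrm_sq power2_sum ip_simps ip_commute[of y x])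
qed (use x y in simp)

lemma nrm_triangle_sub: "x \<in> H \<Longrightarrow> y \<in> H \<Longrightarrow> nrm x \<le> nrm y + nrm (x - y)"
  using nrm_triangle[of y "x - y"] by simp

lemma nrm_triangle3: 
  "x \<in> H \<Longrightarrow> y \<in> H \<Longrightarrow> z \<in> H \<Longrightarrow> nrm (x - z) \<le> nrm (x - y) + nrm (y - z)"
  using nrm_triangle[of "x - y" "y - z"] by simp

section \<open>Null vectors, the substitute for equality\<close>

lemma null_ip:
  assumes "nrm z = 0" "z \<in> H" "w \<in> H" shows "ip z w = 0" "ip w z = 0"
  using Cauchy_Schwarz[of z w] Cauchy_Schwarz[of w z] assms by auto

lemma null_diff_ip:
  assumes "nrm (x - y) = 0" "x \<in> H" "y \<in> H" "w \<in> H" shows "ip x w = ip y w" "ip w x = ip w y"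
  using null_ip[of "x - y" w] assms by (auto simp: ip_simps)

lemma null_diff_nrm:
  assumes "nrm (x - y) = 0" "x \<in> H" "y \<in> H" shows "nrm x = nrm y"
  using nrm_triangle_sub[of x y] nrm_triangle_sub[of y x] assms nrm_commute[of x y] by simp

text \<open>The test vector \<open>w = x - y\<close> suffices. Identities that follow from symmetry
  or from a weak definition are obtained in this way, with \<open>nrm (x - y) = 0\<close> in the
  role of equality.\<close>

lemma null_diffI:
  assumes "x \<in> H" "y \<in> H" "\<And>w. w \<in> H \<Longrightarrow> ip x w = ip y w"
  shows "nrm (x - y) = 0"
  using assms by (simp add: nrm_def ip_diff)

text \<open>Testing with \<open>w = x\<close> gives the bound. Vectors produced by the Riesz theorem
  are known only through their inner products, and this turns weak estimates into norm
  estimates.\<close>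

lemma nrm_le_weak:
  assumes "x \<in> H" "0 \<le> C" "\<And>w. w \<in> H \<Longrightarrow> ip x w \<le> C * nrm w"
  shows "nrm x \<le> C"
proof (cases "nrm x = 0")
  case False
  then have "0 < nrm x" using nrm_nonneg[OF assms(1)] by linarith
  moreover have "nrm x * nrm x \<le> C * nrm x"
    using assms(3)[OF assms(1)] nrm_sq[OF assms(1)] by (simp add: power2_eq_square)
  ultimately show ?thesis by simp
qed (use assms in simp)

lemma ip_tendsto:
  assumes "((\<lambda>n. nrm (X n - x)) \<longlongrightarrow> 0) F" "\<And>n. X n \<in> H" "x \<in> H" "w \<in> H"
  shows "((\<lambda>n. ip (X n) w) \<longlongrightarrow> ip x w) F"
proof -
  have "((\<lambda>n. ip (X n) w - ip x w) \<longlongrightarrow> 0) F"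
  proof (rule Lim_null_comparison)
    show "eventually (\<lambda>n. norm (ip (X n) w - ip x w) \<le> nrm (X n - x) * nrm w) F"
      using Cauchy_Schwarz[of "X _ - x" w] assms by (intro always_eventually allI) (simp add: ip_diff)
    show "((\<lambda>n. nrm (X n - x) * nrm w) \<longlongrightarrow> 0) F"
      using tendsto_mult_right[OF assms(1), of "nrm w"] by simp
  qed
  then show ?thesis by (simp add: Lim_null[symmetric])
qed

lemma nrm_tendsto:
  assumes "((\<lambda>n. nrm (X n - x)) \<longlongrightarrow> 0) F" "\<And>n. X n \<in> H" "x \<in> H"
  shows "((\<lambda>n. nrm (X n)) \<longlongrightarrow> nrm x) F"
proof -
  have "((\<lambda>n. nrm (X n) - nrm x) \<longlongrightarrow> 0) F"
  proof (rule Lim_null_comparison[OF always_eventually assms(1)], rule allI)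
    fix n
    show "norm (nrm (X n) - nrm x) \<le> nrm (X n - x)"
      using nrm_triangle_sub[of "X n" x] nrm_triangle_sub[of x "X n"] nrm_commute[of x "X n"] assms
      by simp
  qed
  then show ?thesis by (simp add: Lim_null[symmetric])
qed

lemma complete_nrm:
  assumes X: "\<And>n. X n \<in> H"
    and Cauchy: "\<And>e. 0 < e \<Longrightarrow> \<exists>N. \<forall>m\<ge>N. \<forall>n\<ge>N. (nrm (X m - X n))\<^sup>2 < e"
  obtains x where "x \<in> H" "(\<lambda>n. nrm (X n - x)) \<longlonglongrightarrow> 0"
proof -
  obtain x where x: "x \<in> H" "(\<lambda>n. ip (X n - x) (X n - x)) \<longlonglongrightarrow> 0"
    using complete[of X] X Cauchy by (auto simp: nrm_sq)
  then have "(\<lambda>n. sqrt (ip (X n - x) (X n - x))) \<longlonglongrightarrow> sqrt 0" by (intro tendsto_intros)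
  with x(1) show thesis by (intro that) (auto simp: nrm_def)
qed

subsection \<open>The Riesz representation theorem\<close>

text \<open>The functional \<open>J\<close> differs from the squared distance to the representing
  vector by a constant, so that vector is found by minimising \<open>J\<close>. Minimising sequences
  are Cauchy by the parallelogram law, and the vanishing of the first variation at the minimum is
  the claim.\<close>

lemma Riesz:
  fixes l :: "'v \<Rightarrow> real"
  assumes add: "\<And>x y. x \<in> H \<Longrightarrow> y \<in> H \<Longrightarrow> l (x + y) = l x + l y"
    and scale: "\<And>a x. x \<in> H \<Longrightarrow> l (a *\<^sub>R x) = a * l x"
    and bound: "\<And>x. x \<in> H \<Longrightarrow> \<bar>l x\<bar> \<le> C * nrm x"
  obtains f where "f \<in> H" "\<And>x. x \<in> H \<Longrightarrow> ip f x = l x"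
proof -
  define J where "J x = (nrm x)\<^sup>2 - 2 * l x" for x
  have J_low: "- C\<^sup>2 \<le> J x" if "x \<in> H" for x
  proof -
    have "2 * l x \<le> 2 * (C * nrm x)" using bound[OF that] by simp
    moreover have "0 \<le> (nrm x - C)\<^sup>2" by simp
    ultimately show ?thesis by (simp add: J_def power2_diff algebra_simps)
  qed
  define m where "m = Inf (J ` H)"
  have bdd: "bdd_below (J ` H)" using J_low by (intro bdd_belowI[of _ "- C\<^sup>2"]) auto
  have m_le: "m \<le> J x" if "x \<in> H" for x
    unfolding m_def by (rule cInf_lower) (use that bdd in auto)
  have "\<exists>x\<in>H. J x < m + 1 / Suc n" for n
  proof -
    have "Inf (J ` H) < m + 1 / Suc n" by (simp add: m_def)
    moreover have "J ` H \<noteq> {}" using H_closed(1) by blast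
    ultimately show ?thesis using cInf_lessD[of "J ` H" "m + 1 / Suc n"] by blast
  qed
  then obtain X where X: "\<And>n. X n \<in> H" "\<And>n. J (X n) < m + 1 / Suc n" by metis
  \<comment> \<open>Parallelogram law: the left-hand side equals
    \<open>2 * J x + 2 * J y - 4 * J ?z\<close> for the midpoint \<open>?z\<close>, and
    \<open>J ?z\<close> is at least \<open>m\<close>.\<close>
  have par: "(nrm (x - y))\<^sup>2 \<le> 2 * (J x - m) + 2 * (J y - m)" if "x \<in> H" "y \<in> H" for x y
  proof -
    let ?z = "(1/2) *\<^sub>R (x + y)"
    have "l ?z = (l x + l y) / 2" using that by (subst scale) (auto simp: add)
    moreover have "(nrm ?z)\<^sup>2 = ((nrm x)\<^sup>2 + (nrm y)\<^sup>2 + 2 * ip x y) / 4"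
      using that by (simp add: nrm_sq ip_simps ip_commute[of y x] field_simps)
    moreover have "m \<le> J ?z" using that by (intro m_le) auto
    ultimately show ?thesis using nrm_diff_sq[OF that] by (simp add: J_def)
  qed
  obtain f where f: "f \<in> H" "(\<lambda>n. nrm (X n - f)) \<longlonglongrightarrow> 0"
  proof (rule complete_nrm[OF X(1)])
    fix e :: real assume "0 < e"
    then obtain N where N: "1 / Suc N < e / 4"
      using nat_approx_posE[of "e / 4"] by auto
    have "(nrm (X i - X j))\<^sup>2 < e" if "i \<ge> N" "j \<ge> N" for i j
    proof -
      have "1 / Suc i \<le> 1 / Suc N" "1 / Suc j \<le> 1 / Suc N"
        using that by (auto intro!: divide_left_mono)
      then have "J (X i) < m + e / 4" "J (X j) < m + e / 4"
        using X(2)[of i] X(2)[of j] N by linarith+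
      then show ?thesis using par[OF X(1) X(1), of i j] by argo
    qed
    then show "\<exists>N. \<forall>m\<ge>N. \<forall>n\<ge>N. (nrm (X m - X n))\<^sup>2 < e" by blast
  qed auto
  have l_lim: "(\<lambda>n. l (X n)) \<longlonglongrightarrow> l f"
  proof -
    have "(\<lambda>n. l (X n) - l f) \<longlonglongrightarrow> 0"
    proof (rule Lim_null_comparison)
      have "l (X n - f) = l (X n) - l f" for n
        using add[of "X n - f" f] X(1) f(1) by simp
      then show "eventually (\<lambda>n. norm (l (X n) - l f) \<le> C * nrm (X n - f)) sequentially"
        using bound[of "X _ - f"] X(1) f(1) by (intro always_eventually allI) (metis H_closed(4) real_norm_def)
      show "(\<lambda>n. C * nrm (X n - f)) \<longlonglongrightarrow> 0" using tendsto_mult_left[OF f(2), of C] by simp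
    qed
    then show ?thesis by (simp add: Lim_null[symmetric])
  qed
  have "(\<lambda>n. J (X n)) \<longlonglongrightarrow> J f"
    unfolding J_def by (intro tendsto_intros l_lim nrm_tendsto[OF f(2) X(1) f(1)])
  moreover have "(\<lambda>n. m + 1 / Suc n) \<longlonglongrightarrow> m + 0"
    by (intro tendsto_intros LIMSEQ_inverse_real_of_nat[unfolded inverse_eq_divide])
  ultimately have "J f \<le> m + 0"
    by (rule LIMSEQ_le) (use X(2) less_imp_le in blast)
  have "ip f h = l h" if h: "h \<in> H" for h
  proof (rule ccontr)
    assume ne: "ip f h \<noteq> l h"
    define d where "d = ip f h - l h"
    have q: "0 \<le> 2 * s * d + s\<^sup>2 * ip h h" for s
    proof -
      have "m \<le> J (f + s *\<^sub>R h)" using h f by (intro m_le) auto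
      also have "\<dots> = J f + (2 * s * d + s\<^sup>2 * ip h h)"
        using h f
        by (simp add: J_def d_def nrm_sq ip_simps add scale ip_commute[of h f])
          (simp add: power2_eq_square algebra_simps)
      finally show ?thesis using \<open>J f \<le> m + 0\<close> by simp
    qed
    \<comment> \<open>The summand 1 keeps \<open>a\<close> positive when \<open>ip h h\<close>
      vanishes. At \<open>s = - d / a\<close> the quadratic of \<open>q\<close> is a square times
      \<open>ip h h - 2 * a\<close>, which is negative.\<close>
    define a where "a = ip h h + 1"
    have a: "0 < a" "ip h h < a" using ip_nonneg[OF h] by (auto simp: a_def)
    have "0 \<le> 2 * (- d / a) * d + (- d / a)\<^sup>2 * ip h h" by (rule q)
    also have "\<dots> = (d / a)\<^sup>2 * (ip h h - 2 * a)"
      using a by (simp add: power2_eq_square field_simps)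
    also have "\<dots> < 0"
      using a ne by (intro mult_pos_neg) (auto simp: d_def)
    finally show False by simp
  qed
  then show thesis using that f(1) by blast
qed

subsection \<open>Orthonormal families\<close>

lemma orthonormalD:
  assumes "orthonormal F"
  shows "e \<in> F \<Longrightarrow> e \<in> H" "e \<in> F \<Longrightarrow> e' \<in> F \<Longrightarrow> ip e e' = (if e = e' then 1 else 0)"
    "e \<in> F \<Longrightarrow> nrm e = 1"
  using assms by (auto simp: orthonormal_def nrm_def)

lemma orthonormal_subset: "orthonormal F \<Longrightarrow> G \<subseteq> F \<Longrightarrow> orthonormal G"
  unfolding orthonormal_def by (meson subsetD order_trans)

lemma orthonormal_singleton: "x \<in> H \<Longrightarrow> nrm x = 1 \<Longrightarrow> orthonormal {x}"
  by (auto simp: orthonormal_def nrm_sq[symmetric])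

lemma orthonormal_insert:
  assumes "orthonormal F" "x \<in> H" "nrm x = 1" "\<And>e. e \<in> F \<Longrightarrow> ip x e = 0"
  shows "orthonormal (insert x F)"
proof -
  have x: "ip x x = 1" using assms(2,3) nrm_sq[of x] by simp
  moreover have "ip e x = 0" if "e \<in> F" for e
    using assms that ip_commute[of e x] by (auto simp: orthonormal_def)
  ultimately show ?thesis using assms by (auto simp: orthonormal_def)
qed

lemma nrm_normalize: "x \<in> H \<Longrightarrow> nrm x \<noteq> 0 \<Longrightarrow> nrm ((1 / nrm x) *\<^sub>R x) = 1"
  by (simp add: nrm_scale)

definition proj :: "'v set \<Rightarrow> 'v \<Rightarrow> 'v" where
  "proj F f = (\<Sum>e\<in>F. ip f e *\<^sub>R e)"

lemma proj_in: "orthonormal F \<Longrightarrow> proj F f \<in> H"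
  unfolding proj_def by (auto dest: orthonormalD)

lemma ip_proj:
  assumes F: "orthonormal F" "finite F" and f: "f \<in> H" "w \<in> H"
  shows "ip (proj F f) w = (\<Sum>e\<in>F. ip f e * ip e w)"
  unfolding proj_def using orthonormalD(1)[OF F(1)] f by (subst ip_sum) (auto simp: ip_scale)

lemma proj_orth:
  assumes F: "orthonormal F" "finite F" and f: "f \<in> H" "e \<in> F"
  shows "ip (f - proj F f) e = 0"
proof -
  have "ip (proj F f) e = (\<Sum>e'\<in>F. ip f e' * ip e' e)"
    using f orthonormalD(1)[OF F(1)] by (intro ip_proj F) auto
  also have "\<dots> = (\<Sum>e'\<in>F. if e' = e then ip f e' else 0)"
    using f orthonormalD(2)[OF F(1)] by (intro sum.cong) auto
  also have "\<dots> = ip f e" using F(2) f by (simp add: sum.delta)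
  finally show ?thesis using f orthonormalD(1)[OF F(1)] proj_in[OF F(1)] by (simp add: ip_diff)
qed

lemma Bessel_diff:
  assumes F: "orthonormal F" "finite F" and f: "f \<in> H"
  shows "(nrm (f - proj F f))\<^sup>2 = (nrm f)\<^sup>2 - (\<Sum>e\<in>F. (ip f e)\<^sup>2)"
proof -
  have "ip (f - proj F f) (proj F f) = 0"
  proof -
    let ?d = "f - proj F f"
    have d: "?d \<in> H" using f proj_in[OF F(1)] by auto
    have "ip e ?d = 0" if "e \<in> F" for e
      using proj_orth[OF F f that] ip_commute[OF d, of e] orthonormalD(1)[OF F(1) that] by simp
    then have "ip (proj F f) ?d = 0" by (simp add: ip_proj F f d)
    then show ?thesis using ip_commute[OF d, of "proj F f"] proj_in[OF F(1)] by simp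
  qed
  then have "(nrm (f - proj F f))\<^sup>2 = ip (f - proj F f) f"
    using f proj_in[OF F(1), of f] by (simp add: nrm_sq ip_diff_right)
  also have "\<dots> = ip f f - (\<Sum>e\<in>F. ip f e * ip e f)"
    using f proj_in[OF F(1), of f] by (simp add: ip_diff ip_proj F)
  also have "(\<Sum>e\<in>F. ip f e * ip e f) = (\<Sum>e\<in>F. (ip f e)\<^sup>2)"
    using f orthonormalD(1)[OF F(1)] by (intro sum.cong) (auto simp: power2_eq_square ip_commute[of _ f])
  finally show ?thesis using f by (simp add: nrm_sq)
qed

lemma Bessel:
  assumes F: "orthonormal F" "finite F" and f: "f \<in> H"
  shows "(\<Sum>e\<in>F. (ip f e)\<^sup>2) \<le> (nrm f)\<^sup>2"
  using Bessel_diff[OF assms] zero_le_power2[of "nrm (f - proj F f)"] by linarith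

lemma nrm_proj_complement_le:
  assumes F: "orthonormal F" "finite F" and f: "f \<in> H"
  shows "nrm (f - proj F f) \<le> nrm f"
proof (rule power2_le_imp_le)
  have "0 \<le> (\<Sum>e\<in>F. (ip f e)\<^sup>2)" by (intro sum_nonneg) auto
  then show "(nrm (f - proj F f))\<^sup>2 \<le> (nrm f)\<^sup>2"
    using Bessel_diff[OF F f] by linarith
qed (use f in simp)

subsection \<open>Symmetric operators\<close>

lemma symmetric_opD:
  assumes "symmetric_op T"
  shows "x \<in> H \<Longrightarrow> T x \<in> H" "x \<in> H \<Longrightarrow> y \<in> H \<Longrightarrow> ip (T x) y = ip x (T y)"
  using assms by (auto simp: symmetric_op_def)

lemma symmetric_op_funpow:
  assumes "symmetric_op T" shows "symmetric_op (T ^^ n)"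
proof (induction n)
  case (Suc n)
  then have D: "\<And>x. x \<in> H \<Longrightarrow> (T ^^ n) x \<in> H" by (rule symmetric_opD)
  show ?case
    unfolding symmetric_op_def
  proof (intro conjI ballI)
    fix x y assume "x \<in> H" "y \<in> H"
    then have "ip ((T ^^ Suc n) x) y = ip ((T ^^ n) x) (T y)"
      using D by (simp add: symmetric_opD[OF assms])
    also have "\<dots> = ip x ((T ^^ n) (T y))"
      using \<open>x \<in> H\<close> \<open>y \<in> H\<close> by (simp add: symmetric_opD[OF assms] symmetric_opD[OF Suc])
    finally show "ip ((T ^^ Suc n) x) y = ip x ((T ^^ Suc n) y)"
      by (simp add: funpow_swap1)
  qed (simp add: D symmetric_opD[OF assms])
qed (simp add: symmetric_op_def)

text \<open>Linearity is a consequence of symmetry: in \<open>ip (T z) w = ip z (T w)\<close> the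
  right-hand side is linear in \<open>z\<close>. It therefore holds up to null vectors, which is all
  that later arguments use.\<close>

lemma symmetric_op_linear:
  assumes T: "symmetric_op T" and x: "x \<in> H" "y \<in> H"
  shows "nrm (T (a *\<^sub>R x + b *\<^sub>R y) - (a *\<^sub>R T x + b *\<^sub>R T y)) = 0"
  using x symmetric_opD[OF T] by (intro null_diffI) (auto simp: ip_simps)

lemma symmetric_op_diff:
  assumes T: "symmetric_op T" and x: "x \<in> H" "y \<in> H"
  shows "nrm (T (x - y) - (T x - T y)) = 0"
  using symmetric_op_linear[OF assms, of 1 "-1"] by simp

lemma symmetric_op_scale:
  assumes T: "symmetric_op T" and x: "x \<in> H"
  shows "nrm (T (a *\<^sub>R x) - a *\<^sub>R T x) = 0"
  using symmetric_op_linear[OF assms assms(2), of a 0] by simp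

lemma symmetric_op_null:
  assumes T: "symmetric_op T" and x: "x \<in> H" "nrm x = 0"
  shows "nrm (T x) = 0"
  using null_diffI[of "T x" 0] x symmetric_opD[OF T] by (simp add: null_ip)

lemma symmetric_op_nrm_diff:
  assumes T: "symmetric_op T" and x: "x \<in> H" "y \<in> H"
  shows "nrm (T x - T y) = nrm (T (x - y))"
  using null_diff_nrm[OF symmetric_op_diff[OF assms]] symmetric_opD[OF T] x by simp

lemma nrm_symmetric_op_scale:
  assumes T: "symmetric_op T" and x: "x \<in> H"
  shows "nrm (T (a *\<^sub>R x)) = \<bar>a\<bar> * nrm (T x)"
  using null_diff_nrm[OF symmetric_op_scale[OF assms, of a]] symmetric_opD[OF T] x
  by (simp add: nrm_scale)

lemma symmetric_op_bound:
  assumes T: "symmetric_op T" and b: "\<And>x. x \<in> H \<Longrightarrow> nrm x = 1 \<Longrightarrow> nrm (T x) \<le> C" and x: "x \<in> H"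
  shows "nrm (T x) \<le> C * nrm x"
proof (cases "nrm x = 0")
  case True
  then show ?thesis using symmetric_op_null[OF T x] by simp
next
  case False
  have "nrm (T ((1 / nrm x) *\<^sub>R x)) \<le> C"
    using nrm_normalize[OF x False] x by (intro b) auto
  then have "nrm (T x) / nrm x \<le> C"
    using x by (simp add: nrm_symmetric_op_scale[OF T])
  then show ?thesis
    using False nrm_nonneg[OF x] by (simp add: pos_divide_le_eq)
qed

text \<open>The powers of \<open>T\<close> applied to a vector, normalised by \<open>\<parallel>T\<parallel>\<close>, converge along even exponents:
  their inner products only depend on the sum of the exponents and their norms decrease. It remains
  to find a vector for which the limit does not vanish. If there were none, \<open>\<parallel>T\<^sup>n\<parallel>\<close> would be too small
  for large \<open>n\<close>, because \<open>T\<close> is small on the complement of a finite family.\<close>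

lemma symmetric_op_eigenvector:
  assumes T: "symmetric_op T"
    and HS: "\<And>F. orthonormal F \<Longrightarrow> finite F \<Longrightarrow> (\<Sum>e\<in>F. (nrm (T e))\<^sup>2) \<le> S"
    and x0: "x0 \<in> H" "nrm (T x0) \<noteq> 0"
  obtains g l where "g \<in> H" "nrm g = 1" "l \<noteq> 0" "nrm (T g - l *\<^sub>R g) = 0"
proof -
  note TD = symmetric_opD[OF T] and TnD = symmetric_opD[OF symmetric_op_funpow[OF T]]
  define U where "U = {x \<in> H. nrm x = 1}"
  have ne: "nrm x0 \<noteq> 0" using symmetric_op_null[OF T x0(1)] x0(2) by auto
  define u0 where "u0 = (1 / nrm x0) *\<^sub>R x0"
  have u0: "u0 \<in> U" "nrm (T u0) > 0"
    using ne x0 nrm_nonneg[OF x0(1)] nrm_nonneg[OF TD(1)[OF x0(1)]] order_le_neq_trans[of 0 "nrm x0"]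
    by (auto simp: U_def u0_def nrm_normalize nrm_symmetric_op_scale[OF T] intro!: divide_pos_pos)
  have le_S: "nrm (T x) \<le> sqrt S" if "x \<in> U" for x
    using HS[of "{x}"] that by (auto simp: U_def orthonormal_singleton intro: real_le_rsqrt)
  define l where "l = Sup ((\<lambda>x. nrm (T x)) ` U)"
  have bdd: "bdd_above ((\<lambda>x. nrm (T x)) ` U)" using le_S by (intro bdd_aboveI[of _ "sqrt S"]) auto
  have le_l: "nrm (T x) \<le> l" if "x \<in> U" for x
    unfolding l_def using that bdd by (intro cSup_upper) auto
  have l_pos: "0 < l" using le_l[OF u0(1)] u0(2) by linarith
  have T_le: "nrm (T x) \<le> l * nrm x" if "x \<in> H" for x
    using le_l that by (intro symmetric_op_bound[OF T]) (auto simp: U_def)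
  have Tn_le: "nrm ((T ^^ n) x) \<le> l ^ n * nrm x" if "x \<in> H" for n x
  proof (induction n)
    case (Suc n)
    have "nrm ((T ^^ Suc n) x) \<le> l * nrm ((T ^^ n) x)"
      using T_le[OF TnD(1)[OF that]] by simp
    also have "\<dots> \<le> l * (l ^ n * nrm x)" using Suc l_pos by (intro mult_left_mono) auto
    finally show ?case by (simp add: mult.assoc)
  qed simp
  have ip_pow: "ip ((T ^^ i) x) ((T ^^ j) y) = ip ((T ^^ (i + j)) x) y" if "x \<in> H" "y \<in> H" for i j x y
  proof -
    have "ip ((T ^^ i) x) ((T ^^ j) y) = ip ((T ^^ j) ((T ^^ i) x)) y"
      using that TnD(1) by (intro TnD(2)[symmetric]) auto
    then show ?thesis by (simp add: funpow_add add.commute[of i])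
  qed
  have nrm_pow: "(nrm ((T ^^ i) x))\<^sup>2 = ip ((T ^^ (2 * i)) x) x" if "x \<in> H" for i x
    using that TnD(1) ip_pow[OF that that, of i i] by (simp add: nrm_sq mult_2)
  \<comment> \<open>For a unit vector, the square of \<open>nrm ((T ^^ m) x)\<close> is
    \<open>ip ((T ^^ (2 * m)) x) x\<close>, hence at most \<open>nrm ((T ^^ (2 * m)) x)\<close>.
    Iterated along powers of 2, this bounds the norms of iterates from below.\<close>
  have doubling: "nrm (T x) ^ (2 ^ k) \<le> nrm ((T ^^ (2 ^ k)) x)" if x: "x \<in> U" for x k
  proof (induction k)
    case (Suc k)
    have "nrm (T x) ^ (2 ^ Suc k) = (nrm (T x) ^ (2 ^ k))\<^sup>2" by (simp add: mult.commute flip: power_mult)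
    also have "\<dots> \<le> (nrm ((T ^^ (2 ^ k)) x))\<^sup>2"
      using Suc x TD(1) by (intro power_mono) (auto simp: U_def)
    also have "\<dots> = ip ((T ^^ (2 ^ Suc k)) x) x" using x by (simp add: U_def nrm_pow)
    also have "\<dots> \<le> nrm ((T ^^ (2 ^ Suc k)) x)"
      using ip_le_nrm[of "(T ^^ (2 ^ Suc k)) x" x] x TnD(1)[of x "2 ^ Suc k"] by (simp add: U_def)
    finally show ?case .
  qed simp
  define b where "b f n = nrm ((T ^^ n) f) / l ^ n" for f n
  have "\<exists>f\<in>H. \<not> (b f \<longlonglongrightarrow> 0)"
  proof (rule ccontr)
    assume "\<not> (\<exists>f\<in>H. \<not> (b f \<longlonglongrightarrow> 0))"
    then have b0: "b f \<longlonglongrightarrow> 0" if "f \<in> H" for f using that by blast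
    define Fs where "Fs = {F. orthonormal F \<and> finite F}"
    define hs where "hs F = (\<Sum>e\<in>F. (nrm (T e))\<^sup>2)" for F
    have hs_bdd: "bdd_above (hs ` Fs)"
      using HS by (intro bdd_aboveI[of _ S]) (auto simp: hs_def Fs_def)
    have "{} \<in> Fs" by (simp add: Fs_def orthonormal_def)
    have "Sup (hs ` Fs) - (l / 4)\<^sup>2 < Sup (hs ` Fs)" using l_pos by simp
    \<comment> \<open>\<open>F\<close> exhausts the supremum of the Hilbert-Schmidt sums up to
      \<open>(l / 4)^2\<close>. A unit vector orthogonal to \<open>F\<close> can be added to it, so
      its image has norm at most \<open>l / 4\<close>.\<close>
    then obtain F where F: "F \<in> Fs" "Sup (hs ` Fs) - (l / 4)\<^sup>2 < hs F"
      using less_cSupD[of "hs ` Fs"] \<open>{} \<in> Fs\<close> by blast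
    then have F': "orthonormal F" "finite F" by (auto simp: Fs_def)
    have small1: "nrm (T f) \<le> l / 4" if f: "f \<in> H" "nrm f = 1" "\<And>e. e \<in> F \<Longrightarrow> ip f e = 0" for f
    proof -
      have "f \<notin> F" using f(3)[of f] f(1,2) nrm_sq[OF f(1)] by auto
      have "insert f F \<in> Fs" using F' f by (auto simp: Fs_def intro: orthonormal_insert)
      then have "hs (insert f F) \<le> Sup (hs ` Fs)" by (intro cSup_upper hs_bdd imageI)
      moreover have "hs (insert f F) = (nrm (T f))\<^sup>2 + hs F"
        using \<open>f \<notin> F\<close> F' by (simp add: hs_def)
      ultimately have "(nrm (T f))\<^sup>2 \<le> (l / 4)\<^sup>2" using F(2) by linarith
      then show ?thesis by (rule power2_le_imp_le) (use l_pos in simp)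
    qed
    have small: "nrm (T f) \<le> l / 4 * nrm f" if f: "f \<in> H" "\<And>e. e \<in> F \<Longrightarrow> ip f e = 0" for f
    proof (cases "nrm f = 0")
      case True
      then show ?thesis using symmetric_op_null[OF T f(1)] by simp
    next
      case False
      have "nrm (T ((1 / nrm f) *\<^sub>R f)) \<le> l / 4"
        using f nrm_normalize[OF f(1) False] orthonormalD(1)[OF F'(1)]
        by (intro small1) (auto simp: ip_scale)
      then show ?thesis
        using False nrm_nonneg[OF f(1)] f(1)
        by (simp add: nrm_symmetric_op_scale[OF T] field_simps)
    qed
    have "(\<lambda>n. \<Sum>e\<in>F. b e n) \<longlonglongrightarrow> (\<Sum>e\<in>F. 0)"
      using orthonormalD(1)[OF F'(1)] by (intro tendsto_sum b0)
    then have "eventually (\<lambda>n. (\<Sum>e\<in>F. b e n) < 1 / 4) sequentially"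
      by (intro order_tendstoD(2)) auto
    then obtain N where N: "\<And>n. n \<ge> N \<Longrightarrow> (\<Sum>e\<in>F. b e n) < 1 / 4"
      by (auto simp: eventually_sequentially)
    define n where "n = (2::nat) ^ N"
    have n: "N \<le> n" "0 < n" by (auto simp: n_def less_imp_le[OF less_exp])
    \<comment> \<open>The constants are balanced: a unit vector with
      \<open>nrm (T f) > l * c\<close> has an \<open>n\<close>-th iterate of norm above
      \<open>l ^ n / 2\<close>, while its components in the span of \<open>F\<close> and orthogonal
      to it contribute at most \<open>l ^ n / 4\<close> each. The exponent \<open>n\<close> is a
      power of 2 so that \<open>doubling\<close> applies.\<close>
    define c where "c = root n (1 / 2)"
    have c: "0 < c" "c < 1" "c ^ n = 1 / 2" using n(2) by (auto simp: c_def)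
    have "l * c < l" using c l_pos by simp
    then obtain f where f: "f \<in> U" "l * c < nrm (T f)"
      using less_cSupD[of "(\<lambda>x. nrm (T x)) ` U" "l * c"] u0(1) unfolding l_def by blast
    have fH: "f \<in> H" "nrm f = 1" using f(1) by (auto simp: U_def)
    have "(l * c) ^ n < nrm (T f) ^ n"
      using f(2) n(2) l_pos c(1) by (intro power_strict_mono) auto
    also have "\<dots> \<le> nrm ((T ^^ n) f)" using doubling[OF f(1)] by (simp add: n_def)
    finally have big: "l ^ n / 2 < nrm ((T ^^ n) f)" by (simp add: power_mult_distrib c(3))
    define p where "p = proj F f"
    have p: "p \<in> H" by (simp add: p_def proj_in F')
    have co: "\<bar>ip f e\<bar> \<le> 1" if "e \<in> F" for e
      using Cauchy_Schwarz[OF fH(1), of e] orthonormalD(1,3)[OF F'(1) that] fH(2) by simp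
    have "nrm ((T ^^ n) p) \<le> (\<Sum>e\<in>F. nrm ((T ^^ n) e))"
    proof (rule nrm_le_weak)
      fix w assume w: "w \<in> H"
      have "ip ((T ^^ n) p) w = ip p ((T ^^ n) w)" using p w TnD by simp
      also have "\<dots> = (\<Sum>e\<in>F. ip f e * ip e ((T ^^ n) w))"
        unfolding p_def using w TnD fH by (intro ip_proj F') auto
      also have "\<dots> \<le> (\<Sum>e\<in>F. nrm ((T ^^ n) e) * nrm w)"
      proof (rule sum_mono)
        fix e assume e: "e \<in> F"
        then have eH: "e \<in> H" using orthonormalD(1)[OF F'(1)] by auto
        have "ip f e * ip e ((T ^^ n) w) = ip f e * ip ((T ^^ n) e) w"
          using eH w TnD by simp
        also have "\<dots> \<le> \<bar>ip f e\<bar> * \<bar>ip ((T ^^ n) e) w\<bar>"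
          by (metis abs_ge_self abs_mult)
        also have "\<dots> \<le> 1 * (nrm ((T ^^ n) e) * nrm w)"
          using co[OF e] Cauchy_Schwarz[OF TnD(1)[OF eH] w] by (intro mult_mono) auto
        finally show "ip f e * ip e ((T ^^ n) w) \<le> nrm ((T ^^ n) e) * nrm w" by simp
      qed
      finally show "ip ((T ^^ n) p) w \<le> (\<Sum>e\<in>F. nrm ((T ^^ n) e)) * nrm w"
        by (simp add: sum_distrib_right)
    qed (use p TnD orthonormalD(1)[OF F'(1)] in \<open>auto intro!: sum_nonneg\<close>)
    also have "\<dots> = l ^ n * (\<Sum>e\<in>F. b e n)"
      using l_pos by (simp add: b_def sum_distrib_left)
    also have "\<dots> \<le> l ^ n * (1 / 4)" using N[OF n(1)] l_pos by (intro mult_left_mono) auto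
    finally have part1: "nrm ((T ^^ n) p) \<le> l ^ n / 4" by simp
    obtain m where m: "n = Suc m" using n(2) by (cases n) auto
    have "nrm ((T ^^ n) (f - p)) = nrm ((T ^^ m) (T (f - p)))"
      by (simp add: m funpow_swap1)
    also have "\<dots> \<le> l ^ m * nrm (T (f - p))" using fH p TD by (intro Tn_le) auto
    also have "\<dots> \<le> l ^ m * (l / 4 * nrm (f - p))"
      using small[of "f - p"] proj_orth[OF F' fH(1)] fH p l_pos
      by (intro mult_left_mono) (auto simp: p_def)
    also have "\<dots> \<le> l ^ m * (l / 4 * 1)"
      using nrm_proj_complement_le[OF F' fH(1)] fH l_pos
      by (intro mult_left_mono) (auto simp: p_def)
    finally have part2: "nrm ((T ^^ n) (f - p)) \<le> l ^ n / 4" by (simp add: m mult.commute)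
    have "nrm ((T ^^ n) f) \<le> nrm ((T ^^ n) p) + nrm ((T ^^ n) f - (T ^^ n) p)"
      using fH p TnD by (intro nrm_triangle_sub) auto
    also have "nrm ((T ^^ n) f - (T ^^ n) p) = nrm ((T ^^ n) (f - p))"
      using fH p by (intro symmetric_op_nrm_diff symmetric_op_funpow T)
    finally show False using part1 part2 big by simp
  qed
  then obtain f where f: "f \<in> H" "\<not> (b f \<longlonglongrightarrow> 0)" by blast
  have b_nonneg: "0 \<le> b f n" for n using f TnD(1) l_pos by (simp add: b_def)
  have "decseq (b f)"
  proof (rule decseq_SucI)
    fix n show "b f (Suc n) \<le> b f n"
      using T_le[OF TnD(1)[OF f(1), of n]] l_pos by (simp add: b_def field_simps)
  qed
  then obtain d where d: "b f \<longlonglongrightarrow> d" using decseq_convergent[of "b f" 0] b_nonneg by blast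
  with f(2) have "d \<noteq> 0" by auto
  define G where "G n = (1 / l ^ (2 * n)) *\<^sub>R (T ^^ (2 * n)) f" for n
  have G: "G n \<in> H" for n using f TnD by (simp add: G_def)
  have nrm_G: "nrm (G n) = b f (2 * n)" for n
    using f TnD l_pos by (simp add: G_def b_def nrm_scale)
  have ip_G: "ip (G i) (G j) = (b f (i + j))\<^sup>2" for i j
  proof -
    have "ip (G i) (G j) = ip ((T ^^ (2 * i)) f) ((T ^^ (2 * j)) f) / (l ^ (2 * i) * l ^ (2 * j))"
      using f TnD by (simp add: G_def ip_simps)
    also have "\<dots> = ip ((T ^^ (2 * (i + j))) f) f / l ^ (2 * (i + j))"
      using f by (simp add: ip_pow power_add distrib_left)
    also have "\<dots> = (b f (i + j))\<^sup>2"
      using f by (simp add: b_def power_divide nrm_pow flip: power_mult) (simp add: mult.commute)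
    finally show ?thesis .
  qed
  have d2: "(\<lambda>n. (b f n)\<^sup>2) \<longlonglongrightarrow> d\<^sup>2" by (intro tendsto_intros d)
  obtain g where g: "g \<in> H" "(\<lambda>n. nrm (G n - g)) \<longlonglongrightarrow> 0"
  proof (rule complete_nrm[OF G])
    fix e :: real assume "0 < e"
    then obtain N where N: "\<And>n. n \<ge> N \<Longrightarrow> \<bar>(b f n)\<^sup>2 - d\<^sup>2\<bar> < e / 4"
      using LIMSEQ_D[OF d2, of "e / 4"] by auto
    have "(nrm (G i - G j))\<^sup>2 < e" if "i \<ge> N" "j \<ge> N" for i j
    proof -
      have "(nrm (G i - G j))\<^sup>2 = (b f (2 * i))\<^sup>2 + (b f (2 * j))\<^sup>2 - 2 * (b f (i + j))\<^sup>2"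
        using G by (simp add: nrm_diff_sq nrm_G ip_G)
      moreover have "2 * i \<ge> N" "2 * j \<ge> N" "i + j \<ge> N" using that by auto
      ultimately show ?thesis using N[of "2 * i"] N[of "2 * j"] N[of "i + j"] by arith
    qed
    then show "\<exists>N. \<forall>m\<ge>N. \<forall>n\<ge>N. (nrm (G m - G n))\<^sup>2 < e" by blast
  qed auto
  have "(\<lambda>n. nrm (G n)) \<longlonglongrightarrow> nrm g" by (rule nrm_tendsto[OF g(2) G g(1)])
  moreover have "(\<lambda>n. nrm (G n)) \<longlonglongrightarrow> d"
    unfolding nrm_G by (rule LIMSEQ_subseq_LIMSEQ[OF d, unfolded o_def]) (auto simp: strict_mono_def)
  ultimately have g_ne: "nrm g \<noteq> 0" using \<open>d \<noteq> 0\<close> LIMSEQ_unique by blast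
  \<comment> \<open>\<open>T\<close> is moved to the test vector before the limit is taken; two
    applications of \<open>T\<close> send \<open>G n\<close> to \<open>l^2\<close> times
    \<open>G (Suc n)\<close>, weakly.\<close>
  have TT: "ip (T (T g)) w = l\<^sup>2 * ip g w" if w: "w \<in> H" for w
  proof -
    have "(\<lambda>n. ip (G n) (T (T w))) \<longlonglongrightarrow> ip g (T (T w))"
      using w TD by (intro ip_tendsto[OF g(2) G g(1)]) auto
    moreover have "ip (G n) (T (T w)) = l\<^sup>2 * ip (G (Suc n)) w" for n
    proof -
      have "ip (G n) (T (T w)) = ip ((T ^^ (2 * n)) f) (T (T w)) / l ^ (2 * n)"
        using f w TnD TD by (simp add: G_def ip_simps)
      also have "ip ((T ^^ (2 * n)) f) (T (T w)) = ip ((T ^^ (2 * Suc n)) f) w"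
        using f w TnD TD by simp
      finally show ?thesis
        using f w TnD(1)[of f "2 * Suc n"] l_pos by (simp add: G_def ip_simps power2_eq_square)
    qed
    moreover have "(\<lambda>n. ip (G (Suc n)) w) \<longlonglongrightarrow> ip g w"
      using w by (intro LIMSEQ_Suc ip_tendsto[OF g(2) G g(1)])
    then have "(\<lambda>n. l\<^sup>2 * ip (G (Suc n)) w) \<longlonglongrightarrow> l\<^sup>2 * ip g w" by (intro tendsto_intros)
    ultimately have "ip g (T (T w)) = l\<^sup>2 * ip g w" using LIMSEQ_unique by simp
    then show ?thesis using g w TD by simp
  qed
  have finish: thesis
    if h: "h \<in> H" "nrm h \<noteq> 0" "k \<noteq> 0" "\<And>w. w \<in> H \<Longrightarrow> ip (T h) w = k * ip h w" for h k
  proof -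
    have "nrm (T ((1 / nrm h) *\<^sub>R h) - k *\<^sub>R (1 / nrm h) *\<^sub>R h) = 0"
      using h TD
      by (intro null_diffI) (auto simp: ip_simps null_diff_ip(1)[OF symmetric_op_scale[OF T h(1)]])
    then show thesis
      using h nrm_normalize by (intro \<open>\<And>g l. g \<in> H \<Longrightarrow> nrm g = 1 \<Longrightarrow> l \<noteq> 0 \<Longrightarrow> nrm (T g - l *\<^sub>R g) = 0 \<Longrightarrow> thesis\<close>[of "(1 / nrm h) *\<^sub>R h" k]) auto
  qed
  \<comment> \<open>The identity \<open>TT\<close> factors as \<open>(T - l) (T + l) g = 0\<close>.
    If \<open>h\<close> is null, \<open>g\<close> is an eigenvector for \<open>- l\<close>;
    otherwise \<open>h\<close> is one for \<open>l\<close>.\<close>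
  define h where "h = T g + l *\<^sub>R g"
  have h: "h \<in> H" using g TD by (simp add: h_def)
  show thesis
  proof (cases "nrm h = 0")
    case True
    have "ip (T g) w = (- l) * ip g w" if "w \<in> H" for w
      using null_ip(1)[OF True h that] g TD that by (simp add: h_def ip_simps)
    then show thesis using l_pos by (intro finish[OF g(1) g_ne, of "- l"]) auto
  next
    case False
    have "ip (T h) w = l * ip h w" if w: "w \<in> H" for w
    proof -
      have "ip (T h) w = ip (T g) (T w) + l * ip g (T w)"
        using g h TD w by (simp add: h_def ip_simps)
      also have "\<dots> = l\<^sup>2 * ip g w + l * ip (T g) w" using TT[OF w] g TD w by simp
      finally show ?thesis using g TD w by (simp add: h_def ip_simps power2_eq_square algebra_simps)
    qed
    then show thesis using l_pos by (intro finish[OF h False, of l]) auto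
  qed
qed

text \<open>An orthogonal complement is closed, hence again complete. This lets the eigenvector
  argument be repeated on the complement of the eigenvectors already found.\<close>

lemma semi_hilbert_complement:
  assumes B: "B \<subseteq> H"
  shows "semi_hilbert {f \<in> H. \<forall>e\<in>B. ip f e = 0} ip"
proof
  show "subspace {f \<in> H. \<forall>e\<in>B. ip f e = 0}"
    using B by (auto simp: subspace_def ip_simps subset_iff)
  fix X assume X: "\<And>n::nat. X n \<in> {f \<in> H. \<forall>e\<in>B. ip f e = 0}"
    and Cauchy: "\<And>e. 0 < e \<Longrightarrow> \<exists>N. \<forall>m\<ge>N. \<forall>n\<ge>N. ip (X m - X n) (X m - X n) < e"
  have XH: "\<And>n. X n \<in> H" using X by auto
  obtain x where x: "x \<in> H" "(\<lambda>n. nrm (X n - x)) \<longlonglongrightarrow> 0"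
    by (rule complete_nrm[OF XH]) (use XH Cauchy in \<open>auto simp: nrm_sq\<close>)
  have "ip x e = 0" if "e \<in> B" for e
  proof -
    have "(\<lambda>n. ip (X n) e) \<longlonglongrightarrow> ip x e" using that B by (intro ip_tendsto[OF x(2) XH x(1)]) auto
    moreover have "(\<lambda>n. ip (X n) e) \<longlonglongrightarrow> 0" using X that by simp
    ultimately show ?thesis using LIMSEQ_unique by blast
  qed
  moreover have "(\<lambda>n. (nrm (X n - x))\<^sup>2) \<longlonglongrightarrow> 0\<^sup>2" by (intro tendsto_intros x)
  then have "(\<lambda>n. ip (X n - x) (X n - x)) \<longlonglongrightarrow> 0" using XH x(1) by (simp add: nrm_sq)
  ultimately show "\<exists>x\<in>{f \<in> H. \<forall>e\<in>B. ip f e = 0}. (\<lambda>n. ip (X n - x) (X n - x)) \<longlonglongrightarrow> 0"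
    using x(1) by blast
qed (auto simp: ip_simps ip_nonneg ip_commute)

text \<open>Zorn's lemma gives a maximal orthonormal set of eigenvectors with nonzero eigenvalues.
  Its complement is invariant under \<open>T\<close> by symmetry. On a vector of positive norm
  there, injectivity keeps \<open>T\<close> from being null, so the complement would contain one
  more eigenvector, against maximality.\<close>

lemma spectral_theorem:
  assumes T: "symmetric_op T"
    and HS: "\<And>F. orthonormal F \<Longrightarrow> finite F \<Longrightarrow> (\<Sum>e\<in>F. (nrm (T e))\<^sup>2) \<le> S"
    and inj: "\<And>x. x \<in> H \<Longrightarrow> nrm (T x) = 0 \<Longrightarrow> nrm x = 0"
  obtains B lam where "orthonormal B" "\<And>e. e \<in> B \<Longrightarrow> lam e \<noteq> 0"
    "\<And>e. e \<in> B \<Longrightarrow> nrm (T e - lam e *\<^sub>R e) = 0"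
    "\<And>f. f \<in> H \<Longrightarrow> (\<And>e. e \<in> B \<Longrightarrow> ip f e = 0) \<Longrightarrow> nrm f = 0"
proof -
  note TD = symmetric_opD[OF T]
  define \<A> where "\<A> = {B. orthonormal B \<and> (\<forall>e\<in>B. \<exists>l. l \<noteq> 0 \<and> nrm (T e - l *\<^sub>R e) = 0)}"
  have "\<exists>B\<in>\<A>. \<forall>X\<in>\<A>. B \<subseteq> X \<longrightarrow> X = B"
  proof (rule subset_Zorn')
    fix C assume C: "subset.chain \<A> C"
    have "orthonormal (\<Union>C)"
      unfolding orthonormal_def
    proof (intro conjI ballI)
      show "\<Union>C \<subseteq> H" using C by (auto simp: subset.chain_def \<A>_def orthonormal_def)
      fix e e' assume "e \<in> \<Union>C" "e' \<in> \<Union>C"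
      then obtain X where "X \<in> C" "e \<in> X" "e' \<in> X"
        using C unfolding subset_chain_def by (metis UnionE subsetD)
      then show "ip e e' = (if e = e' then 1 else 0)"
        using C by (auto simp: subset.chain_def \<A>_def orthonormal_def)
    qed
    then show "\<Union>C \<in> \<A>" using C by (auto simp: subset.chain_def \<A>_def)
  qed
  then obtain B where B: "B \<in> \<A>" and max: "\<And>X. X \<in> \<A> \<Longrightarrow> B \<subseteq> X \<Longrightarrow> X = B" by blast
  have ortho: "orthonormal B" using B by (simp add: \<A>_def)
  obtain lam where lam: "\<And>e. e \<in> B \<Longrightarrow> lam e \<noteq> 0 \<and> nrm (T e - lam e *\<^sub>R e) = 0"
    using B unfolding \<A>_def by (auto dest!: bchoice)
  define H0 where "H0 = {f \<in> H. \<forall>e\<in>B. ip f e = 0}"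
  interpret c: semi_hilbert H0 ip
    unfolding H0_def using ortho by (intro semi_hilbert_complement) (auto simp: orthonormal_def)
  have "nrm f = 0" if f: "f \<in> H" "\<And>e. e \<in> B \<Longrightarrow> ip f e = 0" for f
  proof (rule ccontr)
    assume ne: "nrm f \<noteq> 0"
    have inv: "T x \<in> H0" if "x \<in> H0" for x
    proof -
      have x: "x \<in> H" "\<And>e. e \<in> B \<Longrightarrow> ip x e = 0" using that by (auto simp: H0_def)
      have "ip (T x) e = 0" if e: "e \<in> B" for e
      proof -
        have eH: "e \<in> H" using ortho e by (auto simp: orthonormal_def)
        have "ip (T x) e = ip x (T e)" using x eH TD by simp
        also have "\<dots> = ip x (lam e *\<^sub>R e)"
          using lam[OF e] eH TD x by (intro null_diff_ip(2)) auto
        also have "\<dots> = 0" using x eH e by (simp add: ip_simps)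
        finally show ?thesis .
      qed
      then show ?thesis using x TD by (simp add: H0_def)
    qed
    have H0_H: "H0 \<subseteq> H" by (auto simp: H0_def)
    have c_T: "c.symmetric_op T"
      unfolding c.symmetric_op_def using inv TD(2) subsetD[OF H0_H] by (intro conjI ballI) auto
    have c_HS: "(\<Sum>e\<in>F. (c.nrm (T e))\<^sup>2) \<le> S" if "c.orthonormal F" "finite F" for F
    proof -
      have "orthonormal F"
        unfolding orthonormal_def
        using that(1)[unfolded c.orthonormal_def] H0_H by (intro conjI order_trans[of F H0 H]) simp_all
      then show ?thesis using HS that(2) by simp
    qed
    have f0: "f \<in> H0" using f by (simp add: H0_def)
    have Tf: "nrm (T f) \<noteq> 0" using inj[OF f(1)] ne by auto
    obtain g l where g: "g \<in> H0" "nrm g = 1" "l \<noteq> 0" "nrm (T g - l *\<^sub>R g) = 0"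
      by (rule c.symmetric_op_eigenvector[OF c_T c_HS f0 Tf])
    have gH: "g \<in> H" "\<And>e. e \<in> B \<Longrightarrow> ip g e = 0" using g by (auto simp: H0_def)
    have "insert g B \<in> \<A>"
      using B g gH by (auto simp: \<A>_def intro: orthonormal_insert)
    then have "g \<in> B" using max[of "insert g B"] by auto
    then show False using gH g(2) nrm_sq[of g] by auto
  qed
  then show thesis using that ortho lam by blast
qed

subsection \<open>Resolvents of diagonal operators\<close>

text \<open>The vector is the formal sum of \<open>d e * ip g e\<close> times \<open>e\<close> over
  \<open>B\<close>. It is defined weakly: the corresponding functional converges absolutely by
  Bessel's inequality, also for uncountable \<open>B\<close>, and the Riesz theorem represents
  it.\<close>

lemma orthonormal_multiplier:
  assumes B: "orthonormal B" and d: "\<And>e. e \<in> B \<Longrightarrow> \<bar>d e\<bar> \<le> D" "0 \<le> D" and g: "g \<in> H"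
  obtains f where "f \<in> H" "nrm f \<le> D * nrm g" "\<And>e. e \<in> B \<Longrightarrow> ip f e = d e * ip g e"
proof -
  note BH = orthonormalD(1)[OF B]
  define a where "a h e = d e * ip g e * ip h e" for h e
  have fin: "(\<Sum>e\<in>F. \<bar>a h e\<bar>) \<le> D * nrm g * nrm h" if F: "finite F" "F \<subseteq> B" and h: "h \<in> H" for F h
  proof -
    have oF: "orthonormal F" using B F by (blast intro: orthonormal_subset)
    have "(\<Sum>e\<in>F. \<bar>a h e\<bar>) \<le> (\<Sum>e\<in>F. D * (\<bar>ip g e\<bar> * \<bar>ip h e\<bar>))"
      using d F by (intro sum_mono) (auto simp: a_def abs_mult mult.assoc intro!: mult_right_mono)
    also have "\<dots> = D * (\<Sum>e\<in>F. \<bar>ip g e\<bar> * \<bar>ip h e\<bar>)" by (simp add: sum_distrib_left)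
    also have "\<dots> \<le> D * (L2_set (ip g) F * L2_set (ip h) F)"
      using d(2) by (intro mult_left_mono L2_set_mult_ineq)
    also have "\<dots> \<le> D * (nrm g * nrm h)"
      using Bessel[OF oF F(1) g] Bessel[OF oF F(1) h] g h d(2)
      by (intro mult_left_mono mult_mono) (auto simp: L2_set_def intro!: real_le_lsqrt sum_nonneg)
    finally show ?thesis by (simp add: mult.assoc)
  qed
  have abs_summ: "(\<lambda>e. norm (a h e)) summable_on B" if h: "h \<in> H" for h
  proof (rule nonneg_bdd_above_summable_on)
    show "bdd_above (sum (\<lambda>e. norm (a h e)) ` {F. F \<subseteq> B \<and> finite F})"
      using fin[OF _ _ h] by (intro bdd_aboveI[of _ "D * nrm g * nrm h"]) auto
  qed simp
  have summ: "a h summable_on B" if h: "h \<in> H" for h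
    by (rule abs_summable_summable[OF abs_summ[OF h]])
  define l where "l h = (\<Sum>\<^sub>\<infinity>e\<in>B. a h e)" for h
  have bound: "\<bar>l h\<bar> \<le> D * nrm g * nrm h" if h: "h \<in> H" for h
  proof -
    have "\<bar>l h\<bar> \<le> (\<Sum>\<^sub>\<infinity>e\<in>B. norm (a h e))"
      unfolding l_def using norm_infsum_bound[OF abs_summ[OF h]] by simp
    also have "\<dots> \<le> D * nrm g * nrm h"
      using fin h by (intro infsum_le_finite_sums abs_summ) auto
    finally show ?thesis .
  qed
  obtain f where f: "f \<in> H" "\<And>h. h \<in> H \<Longrightarrow> ip f h = l h"
  proof (rule Riesz)
    fix x y assume xy: "x \<in> H" "y \<in> H"
    then have "l (x + y) = (\<Sum>\<^sub>\<infinity>e\<in>B. a x e + a y e)"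
      unfolding l_def using BH by (intro infsum_cong) (auto simp: a_def ip_simps algebra_simps)
    also have "\<dots> = l x + l y" unfolding l_def using xy by (intro infsum_add summ)
    finally show "l (x + y) = l x + l y" .
  next
    fix c x assume x: "x \<in> H"
    then have "l (c *\<^sub>R x) = (\<Sum>\<^sub>\<infinity>e\<in>B. c * a x e)"
      unfolding l_def using BH by (intro infsum_cong) (auto simp: a_def ip_simps)
    then show "l (c *\<^sub>R x) = c * l x" by (simp add: infsum_cmult_right' l_def)
  qed (use bound in auto)
  show thesis
  proof (rule that[OF f(1)])
    show "nrm f \<le> D * nrm g"
      using f g d(2) bound by (intro nrm_le_weak) (auto simp: abs_le_iff)
    fix e assume e: "e \<in> B"
    have "ip f e = (\<Sum>\<^sub>\<infinity>e'\<in>B. a e e')" using f(2)[OF BH[OF e]] by (simp add: l_def)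
    also have "\<dots> = (\<Sum>\<^sub>\<infinity>e'\<in>{e}. a e e')"
      using e orthonormalD(2)[OF B] by (intro infsum_cong_neutral) (auto simp: a_def)
    also have "\<dots> = d e * ip g e" using e orthonormalD(2)[OF B e e] by (simp add: a_def)
    finally show "ip f e = d e * ip g e" .
  qed
qed

text \<open>\<open>T - r\<close> is inverted by the multiplier \<open>1 / (lam e - r)\<close>. The
  lower bound for \<open>T - r\<close> then follows by duality: to test \<open>f\<close> against
  \<open>h\<close>, one writes \<open>h\<close> as \<open>(T - r) k\<close> and moves
  \<open>T - r\<close> back to \<open>f\<close>.\<close>

lemma diagonal_resolvent:
  assumes T: "symmetric_op T" and B: "orthonormal B"
    and eig: "\<And>e. e \<in> B \<Longrightarrow> nrm (T e - lam e *\<^sub>R e) = 0"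
    and total: "\<And>f. f \<in> H \<Longrightarrow> (\<And>e. e \<in> B \<Longrightarrow> ip f e = 0) \<Longrightarrow> nrm f = 0"
    and \<delta>: "0 < \<delta>" "\<And>e. e \<in> B \<Longrightarrow> \<delta> \<le> \<bar>lam e - r\<bar>"
  shows "\<And>g. g \<in> H \<Longrightarrow> \<exists>f\<in>H. nrm (T f - r *\<^sub>R f - g) = 0"
    and "\<And>f. f \<in> H \<Longrightarrow> nrm f \<le> 1 / \<delta> * nrm (T f - r *\<^sub>R f)"
proof -
  note BH = orthonormalD(1)[OF B] and TD = symmetric_opD[OF T]
  have solve: "\<exists>f\<in>H. nrm f \<le> 1 / \<delta> * nrm g \<and> nrm (T f - r *\<^sub>R f - g) = 0" if g: "g \<in> H" for g
  proof -
    have "\<bar>1 / (lam e - r)\<bar> \<le> 1 / \<delta>" if "e \<in> B" for e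
      using \<delta>(1) \<delta>(2)[OF that] by (simp add: frac_le)
    then obtain f where f: "f \<in> H" "nrm f \<le> 1 / \<delta> * nrm g"
        "\<And>e. e \<in> B \<Longrightarrow> ip f e = 1 / (lam e - r) * ip g e"
      using orthonormal_multiplier[OF B, of "\<lambda>e. 1 / (lam e - r)" "1 / \<delta>" g] g \<delta>(1) by auto
    have "nrm (T f - r *\<^sub>R f - g) = 0"
    proof (rule total)
      fix e assume e: "e \<in> B"
      have "ip (T f) e = ip f (T e)" using f BH[OF e] TD by simp
      also have "\<dots> = ip f (lam e *\<^sub>R e)"
        using eig[OF e] BH[OF e] TD f by (intro null_diff_ip) auto
      finally have "ip (T f) e = lam e * ip f e" using f BH[OF e] by (simp add: ip_simps)
      then have "ip (T f - r *\<^sub>R f - g) e = (lam e - r) * ip f e - ip g e"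
        using f g BH[OF e] TD by (simp add: ip_simps algebra_simps)
      also have "\<dots> = 0" using f(3)[OF e] \<delta>(1) \<delta>(2)[OF e] by simp
      finally show "ip (T f - r *\<^sub>R f - g) e = 0" .
    qed (use f g TD in auto)
    with f show ?thesis by blast
  qed
  show "\<exists>f\<in>H. nrm (T f - r *\<^sub>R f - g) = 0" if "g \<in> H" for g using solve[OF that] by blast
  show "nrm f \<le> 1 / \<delta> * nrm (T f - r *\<^sub>R f)" if f: "f \<in> H" for f
  proof (rule nrm_le_weak[OF f])
    fix h assume h: "h \<in> H"
    obtain k where k: "k \<in> H" "nrm k \<le> 1 / \<delta> * nrm h" "nrm (T k - r *\<^sub>R k - h) = 0"
      using solve[OF h] by blast
    have "ip f h = ip f (T k - r *\<^sub>R k)"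
      using k f h TD by (intro null_diff_ip(2)[symmetric]) auto
    also have "\<dots> = ip (T f - r *\<^sub>R f) k" using f k TD by (simp add: ip_simps)
    also have "\<dots> \<le> nrm (T f - r *\<^sub>R f) * nrm k" using f k TD by (intro ip_le_nrm) auto
    also have "\<dots> \<le> nrm (T f - r *\<^sub>R f) * (1 / \<delta> * nrm h)"
      using k f TD by (intro mult_left_mono) auto
    finally show "ip f h \<le> 1 / \<delta> * nrm (T f - r *\<^sub>R f) * nrm h" by (simp add: mult_ac)
  qed (use f TD \<delta> in auto)
qed

text \<open>Nothing is known about \<open>P t\<close> for negative \<open>t\<close>, so along
  \<open>at_right 0\<close> membership in \<open>H\<close> holds only eventually.\<close>

lemma ip_tendsto_eventually:
  assumes lim: "((\<lambda>n. nrm (X n - x)) \<longlongrightarrow> 0) F" and X: "eventually (\<lambda>n. X n \<in> H) F" and x: "x \<in> H" "w \<in> H"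
  shows "((\<lambda>n. ip (X n) w) \<longlongrightarrow> ip x w) F"
proof -
  define Y where "Y n = (if X n \<in> H then X n else x)" for n
  have YX: "eventually (\<lambda>n. X n = Y n) F" using X by eventually_elim (simp add: Y_def)
  have "((\<lambda>n. nrm (Y n - x)) \<longlongrightarrow> 0) F"
    using YX by (intro Lim_transform_eventually[OF lim]) (auto elim!: eventually_mono)
  then have "((\<lambda>n. ip (Y n) w) \<longlongrightarrow> ip x w) F"
    using x by (intro ip_tendsto) (auto simp: Y_def)
  then show ?thesis
    by (rule Lim_transform_eventually) (use YX in \<open>auto elim!: eventually_mono\<close>)
qed

end

section \<open>Symmetric contraction semigroups\<close>

locale contraction_semigroup = semi_hilbert +
  fixes P :: "real \<Rightarrow> 'a \<Rightarrow> 'a"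
  assumes P_sym: "0 \<le> t \<Longrightarrow> symmetric_op (P t)"
    and P_contr: "0 \<le> t \<Longrightarrow> x \<in> H \<Longrightarrow> nrm (P t x) \<le> nrm x"
    and P_add: "0 \<le> s \<Longrightarrow> 0 \<le> t \<Longrightarrow> x \<in> H \<Longrightarrow> nrm (P t (P s x) - P (t + s) x) = 0"
    and P_cont: "x \<in> H \<Longrightarrow> ((\<lambda>t. nrm (P t x - x)) \<longlongrightarrow> 0) (at_right 0)"
begin

lemma P_in [simp]: "0 \<le> t \<Longrightarrow> x \<in> H \<Longrightarrow> P t x \<in> H"
  using symmetric_opD[OF P_sym] by simp

lemma ip_P: "0 \<le> t \<Longrightarrow> x \<in> H \<Longrightarrow> y \<in> H \<Longrightarrow> ip (P t x) y = ip x (P t y)"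
  using symmetric_opD[OF P_sym] by simp

lemma ip_P_P:
  "0 \<le> s \<Longrightarrow> 0 \<le> t \<Longrightarrow> x \<in> H \<Longrightarrow> y \<in> H \<Longrightarrow> ip (P t (P s x)) y = ip (P (t + s) x) y"
  by (rule null_diff_ip(1)[OF P_add]) auto

lemma eventually_P_in: "x \<in> H \<Longrightarrow> eventually (\<lambda>t. P t x \<in> H) (at_right 0)"
  using eventually_at_right_less[of 0] by eventually_elim simp

text \<open>Strong continuity identifies \<open>P 0\<close>: for small \<open>t\<close>,
  \<open>P 0 x\<close> is close to \<open>P t (P 0 x)\<close>, which equals \<open>P t x\<close> up
  to a null vector, and \<open>P t x\<close> is close to \<open>x\<close>.\<close>

lemma P_zero:
  assumes x: "x \<in> H" shows "nrm (P 0 x - x) = 0"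
proof -
  have "((\<lambda>t. nrm (P t (P 0 x) - P 0 x) + nrm (P t x - x)) \<longlongrightarrow> 0 + 0) (at_right 0)"
    using x by (intro tendsto_intros P_cont) auto
  moreover have "eventually (\<lambda>t. nrm (P 0 x - x) \<le> nrm (P t (P 0 x) - P 0 x) + nrm (P t x - x)) (at_right 0)"
    using eventually_at_right_less[of 0]
  proof eventually_elim
    case (elim t)
    then have "nrm (P t (P 0 x) - P t x) = 0" using P_add[of 0 t x] x by simp
    then have "nrm (P t (P 0 x) - x) \<le> nrm (P t x - x)"
      using nrm_triangle3[of "P t (P 0 x)" "P t x" x] elim x by simp
    then show ?case
      using nrm_triangle3[of "P 0 x" "P t (P 0 x)" x] nrm_commute[of "P 0 x" "P t (P 0 x)"] elim x
      by simp
  qed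
  ultimately have "nrm (P 0 x - x) \<le> 0 + 0" by (rule tendsto_lowerbound) simp
  then show ?thesis using nrm_nonneg[of "P 0 x - x"] x by (simp del: nrm_nonneg)
qed

lemma P_cont_at_0:
  assumes x: "x \<in> H" and e: "0 < e"
  obtains d where "0 < d" "\<And>h. 0 \<le> h \<Longrightarrow> h < d \<Longrightarrow> nrm (P h x - x) < e"
proof -
  have "eventually (\<lambda>h. nrm (P h x - x) < e) (at_right 0)"
    using P_cont[OF x] e by (rule order_tendstoD)
  then obtain d where d: "0 < d" "\<And>h. 0 < h \<Longrightarrow> h < d \<Longrightarrow> nrm (P h x - x) < e"
    by (auto simp: eventually_at_right_field)
  show thesis
  proof (rule that[OF d(1)])
    fix h :: real assume "0 \<le> h" "h < d"
    then show "nrm (P h x - x) < e"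
      using d(2)[of h] P_zero[OF x] e by (cases "h = 0") auto
  qed
qed

text \<open>Factoring out the contraction \<open>P s\<close> transfers the modulus of continuity at
  time 0 to all later times.\<close>

lemma P_diff:
  assumes x: "x \<in> H" and st: "0 \<le> s" "s \<le> t"
  shows "nrm (P t x - P s x) \<le> nrm (P (t - s) x - x)"
proof -
  have "nrm (P s (P (t - s) x) - P t x) = 0" using P_add[of "t - s" s x] x st by simp
  then have "nrm (P t x - P s x) \<le> nrm (P s (P (t - s) x) - P s x)"
    using nrm_triangle3[of "P t x" "P s (P (t - s) x)" "P s x"] x st
      nrm_commute[of "P t x" "P s (P (t - s) x)"] by simp
  also have "\<dots> = nrm (P s (P (t - s) x - x))"
    using x st by (intro symmetric_op_nrm_diff P_sym) auto
  also have "\<dots> \<le> nrm (P (t - s) x - x)" using x st by (intro P_contr) auto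
  finally show ?thesis .
qed

lemma continuous_on_ip_P:
  assumes x: "x \<in> H" and y: "y \<in> H"
  shows "continuous_on {0..} (\<lambda>t. ip (P t x) y)"
  unfolding continuous_on_iff
proof (intro ballI allI impI)
  fix t e :: real assume t: "t \<in> {0..}" and e: "0 < e"
  define e' where "e' = e / (nrm y + 1)"
  have y0: "0 \<le> nrm y" using y by simp
  have e': "0 < e'" using e y0 by (simp add: e'_def)
  obtain d where d: "0 < d" "\<And>h. 0 \<le> h \<Longrightarrow> h < d \<Longrightarrow> nrm (P h x - x) < e'"
    using P_cont_at_0[OF x e'] by blast
  have "dist (ip (P s x) y) (ip (P t x) y) < e" if s: "s \<in> {0..}" "dist s t < d" for s
  proof -
    have "nrm (P s x - P t x) < e'"
    proof (cases "s \<le> t")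
      case True
      then show ?thesis
        using P_diff[OF x, of s t] d(2)[of "t - s"] s nrm_commute[of "P s x" "P t x"] x t
        by (auto simp: dist_real_def)
    next
      case False
      then show ?thesis
        using P_diff[OF x, of t s] d(2)[of "s - t"] s x t by (auto simp: dist_real_def)
    qed
    then have "nrm (P s x - P t x) * nrm y \<le> e' * nrm y" using y0 by (intro mult_right_mono) auto
    moreover have "dist (ip (P s x) y) (ip (P t x) y) \<le> nrm (P s x - P t x) * nrm y"
      using Cauchy_Schwarz[of "P s x - P t x" y] x y s t by (simp add: dist_real_def ip_diff)
    moreover have "e' * nrm y < e" using e y0 by (simp add: e'_def field_simps)
    ultimately show ?thesis by linarith
  qed
  with d(1) show "\<exists>d>0. \<forall>s\<in>{0..}. dist s t < d \<longrightarrow> dist (ip (P s x) y) (ip (P t x) y) < e"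
    by blast
qed

lemma nrm_P_sq: "0 \<le> t \<Longrightarrow> x \<in> H \<Longrightarrow> (nrm (P t x))\<^sup>2 = ip (P (2 * t) x) x"
  using ip_P[of t "P t x" x] ip_P_P[of t t x x] by (simp add: nrm_sq)

text \<open>The square of \<open>nrm (P (t / 2) x)\<close> is \<open>ip (P t x) x\<close>, so
  nullity at time \<open>t\<close> passes to time \<open>t / 2\<close>. By repeated halving it
  reaches times close to 0, where \<open>P\<close> is close to the identity.\<close>

lemma P_injective:
  assumes x: "x \<in> H" and t: "0 < t" "nrm (P t x) = 0"
  shows "nrm x = 0"
proof -
  have half: "nrm (P (t / 2 ^ n) x) = 0" for n
  proof (induction n)
    case (Suc n)
    have "(nrm (P (t / 2 ^ Suc n) x))\<^sup>2 = ip (P (t / 2 ^ n) x) x"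
      using nrm_P_sq[of "t / 2 ^ Suc n" x] x t by simp
    also have "\<dots> = 0" using Suc x t by (intro null_ip) auto
    finally show ?case by simp
  qed (use t in simp)
  have "(\<lambda>n. (1 / 2) ^ n :: real) \<longlonglongrightarrow> 0" by (rule LIMSEQ_power_zero) simp
  then have "(\<lambda>n. t * (1 / 2) ^ n) \<longlonglongrightarrow> 0" by (rule tendsto_mult_right_zero)
  moreover have "t * (1 / 2) ^ n = t / 2 ^ n" for n by (simp add: power_one_over)
  ultimately have "(\<lambda>n. t / 2 ^ n) \<longlonglongrightarrow> 0" by simp
  then have "filterlim (\<lambda>n. t / 2 ^ n) (at_right 0) sequentially"
    using t by (simp add: filterlim_at)
  then have "(\<lambda>n. nrm (P (t / 2 ^ n) x - x)) \<longlonglongrightarrow> 0"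
    by (rule filterlim_compose[OF P_cont[OF x]])
  moreover have "nrm (P (t / 2 ^ n) x - x) = nrm x" for n
  proof -
    have "nrm (x - (x - P (t / 2 ^ n) x)) = 0" using half[of n] x t by simp
    then have "nrm x = nrm (x - P (t / 2 ^ n) x)" by (rule null_diff_nrm) (use x t in auto)
    then show ?thesis using nrm_commute[of x "P (t / 2 ^ n) x"] x t by simp
  qed
  ultimately show ?thesis by (simp add: LIMSEQ_const_iff)
qed

subsection \<open>The generator\<close>

text \<open>A relation, because the image under the generator is determined only up to null
  vectors.\<close>

definition gen :: "'a \<Rightarrow> 'a \<Rightarrow> bool" where
  "gen x g \<longleftrightarrow> x \<in> H \<and> g \<in> H \<and> ((\<lambda>t. nrm ((1 / t) *\<^sub>R (P t x - x) - g)) \<longlongrightarrow> 0) (at_right 0)"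

lemma genD:
  assumes "gen x g"
  shows "x \<in> H" "g \<in> H" "((\<lambda>t. nrm ((1 / t) *\<^sub>R (P t x - x) - g)) \<longlongrightarrow> 0) (at_right 0)"
  using assms by (auto simp: gen_def)

lemma gen_ip_tendsto:
  assumes g: "gen x g" and y: "y \<in> H"
  shows "((\<lambda>t. ip (P t x - x) y / t) \<longlongrightarrow> ip g y) (at_right 0)"
proof -
  note D = genD[OF g]
  have "((\<lambda>t. ip ((1 / t) *\<^sub>R (P t x - x)) y) \<longlongrightarrow> ip g y) (at_right 0)"
    using D y eventually_P_in[OF D(1)]
    by (intro ip_tendsto_eventually) (auto elim!: eventually_mono)
  moreover have "eventually (\<lambda>t. ip ((1 / t) *\<^sub>R (P t x - x)) y = ip (P t x - x) y / t) (at_right 0)"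
    using eventually_P_in[OF D(1)] by eventually_elim (use D y in \<open>simp add: ip_scale\<close>)
  ultimately show ?thesis by (rule Lim_transform_eventually)
qed

lemma gen_linear:
  assumes x: "gen x g" and y: "gen y h"
  shows "gen (a *\<^sub>R x + b *\<^sub>R y) (a *\<^sub>R g + b *\<^sub>R h)"
proof -
  note X = genD[OF x] and Y = genD[OF y]
  let ?q = "\<lambda>t x. (1 / t) *\<^sub>R (P t x - x)"
  have "((\<lambda>t. \<bar>a\<bar> * nrm (?q t x - g) + \<bar>b\<bar> * nrm (?q t y - h)) \<longlongrightarrow> \<bar>a\<bar> * 0 + \<bar>b\<bar> * 0) (at_right 0)"
    by (intro tendsto_intros X Y)
  then have lim: "((\<lambda>t. \<bar>a\<bar> * nrm (?q t x - g) + \<bar>b\<bar> * nrm (?q t y - h)) \<longlongrightarrow> 0) (at_right 0)"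
    by simp
  have "eventually (\<lambda>t. norm (nrm (?q t (a *\<^sub>R x + b *\<^sub>R y) - (a *\<^sub>R g + b *\<^sub>R h)))
      \<le> \<bar>a\<bar> * nrm (?q t x - g) + \<bar>b\<bar> * nrm (?q t y - h)) (at_right 0)"
    using eventually_at_right_less[of 0]
  proof eventually_elim
    case (elim t)
    let ?z = "a *\<^sub>R x + b *\<^sub>R y"
    have in_H: "?z \<in> H" "P t ?z \<in> H" "P t x \<in> H" "P t y \<in> H" using X Y elim by auto
    have "nrm (?q t ?z - (a *\<^sub>R g + b *\<^sub>R h) - (a *\<^sub>R (?q t x - g) + b *\<^sub>R (?q t y - h))) = 0"
    proof (rule null_diffI)
      fix w assume w: "w \<in> H"
      have "ip (P t ?z) w = a * ip (P t x) w + b * ip (P t y) w"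
        using null_diff_ip(1)[OF symmetric_op_linear[OF P_sym, of t x y a b]] X Y w elim in_H
        by (simp add: ip_simps)
      then show "ip (?q t ?z - (a *\<^sub>R g + b *\<^sub>R h)) w
          = ip (a *\<^sub>R (?q t x - g) + b *\<^sub>R (?q t y - h)) w"
        using X Y w in_H elim by (simp add: ip_simps field_simps)
    qed (use X Y in_H in auto)
    then have "nrm (?q t ?z - (a *\<^sub>R g + b *\<^sub>R h)) = nrm (a *\<^sub>R (?q t x - g) + b *\<^sub>R (?q t y - h))"
      using X Y in_H by (intro null_diff_nrm) auto
    also have "\<dots> \<le> \<bar>a\<bar> * nrm (?q t x - g) + \<bar>b\<bar> * nrm (?q t y - h)"
      using nrm_triangle[of "a *\<^sub>R (?q t x - g)" "b *\<^sub>R (?q t y - h)"] X Y in_H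
      by (simp add: nrm_scale)
    finally show ?case using X Y in_H by simp
  qed
  then have "((\<lambda>t. nrm (?q t (a *\<^sub>R x + b *\<^sub>R y) - (a *\<^sub>R g + b *\<^sub>R h))) \<longlongrightarrow> 0) (at_right 0)"
    by (rule Lim_null_comparison[OF _ lim])
  then show ?thesis using X Y by (simp add: gen_def)
qed

lemma gen_diff: "gen x g \<Longrightarrow> gen y h \<Longrightarrow> gen (x - y) (g - h)"
  using gen_linear[of x g y h 1 "-1"] by simp

lemma gen_sym:
  assumes "gen x g" "gen y h" shows "ip g y = ip x h"
proof -
  note X = genD[OF assms(1)] and Y = genD[OF assms(2)]
  have "((\<lambda>t. ip (P t y - y) x / t) \<longlongrightarrow> ip h x) (at_right 0)"
    by (rule gen_ip_tendsto[OF assms(2) X(1)])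
  moreover have "eventually (\<lambda>t. ip (P t y - y) x / t = ip (P t x - x) y / t) (at_right 0)"
    using eventually_at_right_less[of 0]
  proof eventually_elim
    case (elim t)
    then show ?case
      using X Y ip_commute[of "P t y" x] by (simp add: ip_diff ip_P ip_commute[of y x])
  qed
  ultimately have "((\<lambda>t. ip (P t x - x) y / t) \<longlongrightarrow> ip h x) (at_right 0)"
    by (rule Lim_transform_eventually)
  with gen_ip_tendsto[OF assms(1) Y(1)] have "ip g y = ip h x"
    by (rule tendsto_unique[rotated]) simp
  then show ?thesis using X Y by (simp add: ip_commute)
qed

lemma gen_unique:
  assumes "gen x g" "gen x h" shows "nrm (g - h) = 0"
proof (rule null_diffI)
  fix w assume "w \<in> H"
  then show "ip g w = ip h w"
    by (intro tendsto_unique[OF _ gen_ip_tendsto[OF assms(1)] gen_ip_tendsto[OF assms(2)]]) auto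
qed (use assms in \<open>auto dest: genD\<close>)

lemma gen_nonpos:
  assumes "gen x g" shows "ip x g \<le> 0"
proof -
  note X = genD[OF assms]
  have "ip g x \<le> 0"
  proof (rule tendsto_upperbound[OF gen_ip_tendsto[OF assms X(1)]])
    show "eventually (\<lambda>t. ip (P t x - x) x / t \<le> 0) (at_right 0)"
      using eventually_at_right_less[of 0]
    proof eventually_elim
      case (elim t)
      have "ip (P t x) x \<le> nrm (P t x) * nrm x" using X elim by (intro ip_le_nrm) auto
      also have "\<dots> \<le> nrm x * nrm x" using X elim P_contr[of t x] by (intro mult_right_mono) auto
      finally have "ip (P t x - x) x \<le> 0"
        using X elim nrm_sq[of x] by (simp add: ip_diff power2_eq_square)
      then show ?case using elim by (simp add: divide_nonpos_pos)
    qed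
  qed simp
  then show ?thesis using X by (simp add: ip_commute)
qed

text \<open>Up to null vectors, \<open>P s\<close> commutes with the difference quotients, and being
  a contraction it does not enlarge their distance to the limit.\<close>

lemma gen_P:
  assumes g: "gen x g" and s: "0 \<le> s"
  shows "gen (P s x) (P s g)"
proof -
  note X = genD[OF g]
  have "eventually (\<lambda>t. norm (nrm ((1 / t) *\<^sub>R (P t (P s x) - P s x) - P s g))
      \<le> nrm ((1 / t) *\<^sub>R (P t x - x) - g)) (at_right 0)"
    using eventually_at_right_less[of 0]
  proof eventually_elim
    case (elim t)
    let ?u = "(1 / t) *\<^sub>R (P t (P s x) - P s x) - P s g" and ?v = "(1 / t) *\<^sub>R (P t x - x) - g"
    have uv: "?u \<in> H" "?v \<in> H" "P t x \<in> H" "P s x \<in> H" using X s elim by auto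
    have "nrm (?u - P s ?v) = 0"
    proof (rule null_diffI)
      fix w assume w: "w \<in> H"
      have "ip (P t (P s x)) w = ip (P s (P t x)) w"
        using ip_P_P[of s t x w] ip_P_P[of t s x w] X w s elim by (simp add: add.commute)
      then have "ip ?u w = (ip (P t x) (P s w) - ip x (P s w)) / t - ip g (P s w)"
        using X w s elim uv by (simp add: ip_simps ip_P[of s])
      also have "\<dots> = ip (P s ?v) w"
        using X w s elim uv by (simp add: ip_simps ip_P[of s])
      finally show "ip ?u w = ip (P s ?v) w" .
    qed (use uv s in auto)
    then have "nrm ?u = nrm (P s ?v)" using uv s by (intro null_diff_nrm) auto
    also have "\<dots> \<le> nrm ?v" using uv s by (intro P_contr)
    finally show ?case using uv by simp
  qed
  then have "((\<lambda>t. nrm ((1 / t) *\<^sub>R (P t (P s x) - P s x) - P s g)) \<longlongrightarrow> 0) (at_right 0)"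
    by (rule Lim_null_comparison[OF _ X(3)])
  then show ?thesis using X s by (simp add: gen_def)
qed

lemma gen_right_derivative:
  assumes g: "gen x g" and y: "y \<in> H" and s: "0 \<le> s"
  shows "((\<lambda>t. ip (P t x) y) has_real_derivative ip (P s g) y) (at_right s)"
proof -
  note X = genD[OF g]
  have "((\<lambda>h. (ip (P (h + s) x) y - ip (P s x) y) / h) \<longlongrightarrow> ip (P s g) y) (at_right 0)"
  proof (rule Lim_transform_eventually)
    show "((\<lambda>t. ip (P t (P s x) - P s x) y / t) \<longlongrightarrow> ip (P s g) y) (at_right 0)"
      by (rule gen_ip_tendsto[OF gen_P[OF g s] y])
    show "eventually (\<lambda>h. ip (P h (P s x) - P s x) y / h = (ip (P (h + s) x) y - ip (P s x) y) / h) (at_right 0)"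
      using eventually_at_right_less[of 0]
      by eventually_elim (use X s y in \<open>simp add: ip_diff ip_P_P\<close>)
  qed
  then show ?thesis
    unfolding has_field_derivative_iff by (subst filterlim_at_right_to_0) simp
qed

text \<open>The average \<open>F = \<integral>\<^sub>0\<^sup>s P\<^sub>r x dr\<close> is defined weakly; it satisfies \<open>L F = P\<^sub>s x - x\<close>.\<close>

lemma gen_dense:
  assumes x: "x \<in> H" and e: "0 < e"
  obtains y g where "gen y g" "nrm (y - x) \<le> e"
proof -
  obtain s0 where s0: "0 < s0" "\<And>h. 0 \<le> h \<Longrightarrow> h < s0 \<Longrightarrow> nrm (P h x - x) < e"
    using P_cont_at_0[OF x e] by blast
  define s where "s = s0 / 2"
  have s: "0 < s" "s < s0" using s0 by (auto simp: s_def)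
  define q where "q y r = ip (P r x) y" for y r
  define \<Phi> where "\<Phi> y u = integral {0..u} (q y)" for y u
  have q_cont: "continuous_on {a..b} (q y)" if "0 \<le> a" "y \<in> H" for y a b
    unfolding q_def using continuous_on_ip_P[OF x that(2)] by (rule continuous_on_subset) (use that in auto)
  have \<Phi>_deriv: "(\<Phi> y has_real_derivative q y u) (at u within {0..b})" if "u \<in> {0..b}" "y \<in> H" for y u b
    unfolding \<Phi>_def using that by (intro integral_has_real_derivative q_cont) auto
  \<comment> \<open>Integrals are estimated only through intermediate values \<open>q y z\<close>.
    The point \<open>z\<close> depends on \<open>y\<close>, but the resulting bounds are fixed
    multiples of \<open>nrm y\<close>, so \<open>nrm_le_weak\<close> applies.\<close>
  have mvt: "\<exists>z\<in>{a..b}. \<Phi> y b - \<Phi> y a = q y z * (b - a)" if ab: "0 \<le> a" "a \<le> b" and y: "y \<in> H" for a b y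
  proof (rule mvt_very_simple[OF ab(2)])
    fix u assume u: "a \<le> u" "u \<le> b"
    have "(\<Phi> y has_real_derivative q y u) (at u within {a..b})"
      using u ab by (intro DERIV_subset[OF \<Phi>_deriv[of u b y]] y) auto
    then show "(\<Phi> y has_derivative (*) (q y u)) (at u within {a..b})"
      by (simp add: has_field_derivative_def)
  qed
  have \<Phi>0: "\<Phi> y 0 = 0" for y by (simp add: \<Phi>_def)
  obtain F where F: "F \<in> H" "\<And>y. y \<in> H \<Longrightarrow> ip F y = \<Phi> y s"
  proof (rule Riesz)
    fix y z assume yz: "y \<in> H" "z \<in> H"
    have "\<Phi> (y + z) s = integral {0..s} (\<lambda>r. q y r + q z r)"
      unfolding \<Phi>_def using x yz by (intro Henstock_Kurzweil_Integration.integral_cong) (auto simp: q_def ip_simps)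
    also have "\<dots> = \<Phi> y s + \<Phi> z s"
      unfolding \<Phi>_def using yz
      by (intro Henstock_Kurzweil_Integration.integral_add integrable_continuous_real q_cont) auto
    finally show "\<Phi> (y + z) s = \<Phi> y s + \<Phi> z s" .
  next
    fix a y assume y: "y \<in> H"
    have "\<Phi> (a *\<^sub>R y) s = integral {0..s} (\<lambda>r. a * q y r)"
      unfolding \<Phi>_def using x y by (intro Henstock_Kurzweil_Integration.integral_cong) (auto simp: q_def ip_simps)
    then show "\<Phi> (a *\<^sub>R y) s = a * \<Phi> y s" by (simp add: \<Phi>_def)
  next
    fix y assume y: "y \<in> H"
    obtain z where z: "z \<in> {0..s}" "\<Phi> y s = q y z * s"
      using mvt[of 0 s y] y s by (auto simp: \<Phi>0)
    have "\<bar>q y z\<bar> \<le> nrm (P z x) * nrm y" unfolding q_def using x y z by (intro Cauchy_Schwarz) auto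
    also have "\<dots> \<le> nrm x * nrm y" using x y z P_contr[of z x] by (intro mult_right_mono) auto
    finally show "\<bar>\<Phi> y s\<bar> \<le> s * nrm x * nrm y" using s by (simp add: z abs_mult mult.commute)
  qed auto
  \<comment> \<open>Applying \<open>P h\<close> shifts the interval of integration by
    \<open>h\<close>; in \<open>P h F - F\<close> only two boundary pieces of length
    \<open>h\<close> survive.\<close>
  have PF: "ip (P h F) y = \<Phi> y (s + h) - \<Phi> y h" if h: "0 \<le> h" and y: "y \<in> H" for h y
  proof -
    have "ip (P h F) y = \<Phi> (P h y) s" using F h y by (simp add: ip_P)
    also have "\<dots> = integral {0..s} (\<lambda>r. q y (r + h))"
      unfolding \<Phi>_def q_def using x y h
      by (intro Henstock_Kurzweil_Integration.integral_cong) (auto simp: add.commute[of _ h] simp flip: ip_P ip_P_P)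
    also have "\<dots> = \<Phi> y (s + h) - \<Phi> y (0 + h)"
    proof (rule integral_unique, rule fundamental_theorem_of_calculus)
      fix u assume u: "u \<in> {0..s}"
      have "(\<Phi> y has_real_derivative q y (u + h)) (at (u + h) within (\<lambda>r. r + h) ` {0..s})"
        using u h y by (intro DERIV_subset[OF \<Phi>_deriv[of "u + h" "s + h" y]]) auto
      then have "((\<Phi> y \<circ> (\<lambda>r. r + h)) has_real_derivative q y (u + h) * 1) (at u within {0..s})"
        by (rule DERIV_image_chain) (auto intro!: derivative_eq_intros)
      then show "((\<lambda>r. \<Phi> y (r + h)) has_vector_derivative q y (u + h)) (at u within {0..s})"
        by (simp add: has_real_derivative_iff_has_vector_derivative o_def)
    qed (use s in simp)
    finally show ?thesis by simp
  qed
  have q_diff: "\<bar>q y z - q y a\<bar> \<le> b * nrm y"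
    if z: "0 \<le> a" "a \<le> z" and b: "nrm (P (z - a) x - x) < b" and y: "y \<in> H" for a z b y
  proof -
    have "\<bar>q y z - q y a\<bar> = \<bar>ip (P z x - P a x) y\<bar>" using x y z by (simp add: q_def ip_diff)
    also have "\<dots> \<le> nrm (P z x - P a x) * nrm y" using x y z by (intro Cauchy_Schwarz) auto
    also have "\<dots> \<le> b * nrm y" using P_diff[OF x z] b y by (intro mult_right_mono) auto
    finally show ?thesis .
  qed
  have "((\<lambda>h. nrm ((1 / h) *\<^sub>R (P h F - F) - (P s x - x))) \<longlongrightarrow> 0) (at_right 0)"
    unfolding tendsto_iff
  proof (intro allI impI)
    fix b :: real assume b: "0 < b"
    then have "0 < b / 4" by simp
    then obtain d where d: "0 < d" "\<And>h. 0 \<le> h \<Longrightarrow> h < d \<Longrightarrow> nrm (P h x - x) < b / 4"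
      using P_cont_at_0[OF x] by blast
    have "nrm ((1 / h) *\<^sub>R (P h F - F) - (P s x - x)) < b" if h: "0 < h" "h < d" for h
    proof -
      have "nrm ((1 / h) *\<^sub>R (P h F - F) - (P s x - x)) \<le> b / 2"
      proof (rule nrm_le_weak)
        fix y assume y: "y \<in> H"
        obtain z where z: "z \<in> {s..s + h}" "\<Phi> y (s + h) - \<Phi> y s = q y z * h"
          using mvt[of s "s + h" y] s h y by auto
        obtain z' where z': "z' \<in> {0..h}" "\<Phi> y h = q y z' * h"
          using mvt[of 0 h y] h y by (auto simp: \<Phi>0)
        have "ip (P h F - F) y = (q y z - q y z') * h"
          using PF[of h y] F h y z z' by (simp add: ip_diff algebra_simps)
        then have "ip ((1 / h) *\<^sub>R (P h F - F)) y = q y z - q y z'"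
          using F h y by (simp add: ip_scale)
        then have "ip ((1 / h) *\<^sub>R (P h F - F) - (P s x - x)) y = (q y z - q y s) - (q y z' - ip x y)"
          using F h y x s by (simp add: ip_diff q_def)
        also have "ip x y = q y 0"
          unfolding q_def using null_diff_ip(1)[OF P_zero[OF x]] x y by simp
        also have "(q y z - q y s) - (q y z' - q y 0) \<le> b / 4 * nrm y + b / 4 * nrm y"
        proof -
          have "\<bar>q y z - q y s\<bar> \<le> b / 4 * nrm y" "\<bar>q y z' - q y 0\<bar> \<le> b / 4 * nrm y"
            using q_diff[of s z "b / 4" y] q_diff[of 0 z' "b / 4" y]
              d(2)[of "z - s"] d(2)[of z'] z(1) z'(1) s h y by simp_all
          then show ?thesis by linarith
        qed
        finally show "ip ((1 / h) *\<^sub>R (P h F - F) - (P s x - x)) y \<le> b / 2 * nrm y"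
          by simp
      qed (use F x s h b in auto)
      then show ?thesis using b by simp
    qed
    then have "eventually (\<lambda>h. nrm ((1 / h) *\<^sub>R (P h F - F) - (P s x - x)) < b) (at_right 0)"
      using d(1) by (auto simp: eventually_at_right_field)
    moreover have "eventually (\<lambda>h. 0 \<le> nrm ((1 / h) *\<^sub>R (P h F - F) - (P s x - x))) (at_right 0)"
      using eventually_at_right_less[of 0] by eventually_elim (use F x s in auto)
    ultimately show "eventually (\<lambda>h. dist (nrm ((1 / h) *\<^sub>R (P h F - F) - (P s x - x))) 0 < b) (at_right 0)"
      by eventually_elim simp
  qed
  then have gF: "gen F (P s x - x)" using F x s by (simp add: gen_def)
  have "gen ((1 / s) *\<^sub>R F) ((1 / s) *\<^sub>R (P s x - x))"
    using gen_linear[OF gF gF, of "1 / s" 0] by simp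
  moreover have "nrm ((1 / s) *\<^sub>R F - x) \<le> e"
  proof (rule nrm_le_weak)
    fix y assume y: "y \<in> H"
    obtain z where z: "z \<in> {0..s}" "\<Phi> y s = q y z * s"
      using mvt[of 0 s y] s y by (auto simp: \<Phi>0)
    have "ip ((1 / s) *\<^sub>R F - x) y = q y z - ip x y" using F x y s z by (simp add: ip_simps)
    also have "ip x y = q y 0"
      unfolding q_def using null_diff_ip(1)[OF P_zero[OF x]] x y by simp
    also have "q y z - q y 0 \<le> e * nrm y"
      using q_diff[of 0 z e y] s0(2)[of z] z s y by (auto simp: abs_le_iff)
    finally show "ip ((1 / s) *\<^sub>R F - x) y \<le> e * nrm y" .
  qed (use F x e in auto)
  ultimately show thesis by (rule that)
qed

text \<open>With \<open>w n = u n - f\<close> and the energy written E, symmetry and positivity give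
  \<open>E(w n) \<le> E(w n - w m) + 2 * E(w m, w n)\<close>. The first term is small by the Cauchy
  property, and the second tends to 0 for fixed \<open>n\<close> as \<open>m\<close> grows, since it
  is an inner product of \<open>w m\<close> with a fixed vector. Expanding the energy of
  \<open>u n = w n + f\<close> concludes.\<close>

lemma form_closable:
  assumes f: "gen f g" and u: "\<And>n. gen (u n) (v n)"
    and lim: "(\<lambda>n. nrm (u n - f)) \<longlonglongrightarrow> 0"
    and Cauchy: "\<And>e. 0 < e \<Longrightarrow> \<exists>N. \<forall>m\<ge>N. \<forall>n\<ge>N. - ip (u m - u n) (v m - v n) < e"
  shows "(\<lambda>n. - ip (u n) (v n)) \<longlonglongrightarrow> - ip f g"
proof -
  note fD = genD[OF f] and uD = genD[OF u]
  define w where "w n = u n - f" for n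
  define z where "z n = v n - g" for n
  have wz: "gen (w n) (z n)" for n unfolding w_def z_def by (intro gen_diff u f)
  note wzD = genD[OF wz]
  have w0: "(\<lambda>n. ip (w n) y) \<longlonglongrightarrow> 0" if "y \<in> H" for y
    using ip_tendsto[of w 0 sequentially y] lim that wzD by (simp add: w_def)
  have small: "(\<lambda>n. - ip (w n) (z n)) \<longlonglongrightarrow> 0"
    unfolding tendsto_iff
  proof (intro allI impI)
    fix e :: real assume e: "0 < e"
    then obtain N where N: "\<And>m n. m \<ge> N \<Longrightarrow> n \<ge> N \<Longrightarrow> - ip (u m - u n) (v m - v n) < e / 2"
      using Cauchy[of "e / 2"] by auto
    have "- ip (w n) (z n) \<le> e / 2" if n: "n \<ge> N" for n
    proof (rule tendsto_lowerbound)
      show "(\<lambda>m. e / 2 + (- 2 * ip (w m) (z n))) \<longlonglongrightarrow> e / 2"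
        using tendsto_add[OF tendsto_const tendsto_mult_left[OF w0[OF wzD(2)[of n]], of "- 2"], of "e / 2"]
        by simp
      show "eventually (\<lambda>m. - ip (w n) (z n) \<le> e / 2 + (- 2 * ip (w m) (z n))) sequentially"
        using eventually_ge_at_top[of N]
      proof eventually_elim
        case (elim m)
        have "- ip (w n - w m) (z n - z m) < e / 2"
          using N[OF n elim] by (simp add: w_def z_def)
        moreover have "ip (w n) (z m) = ip (w m) (z n)"
          using gen_sym[OF wz wz, of n m] ip_commute[of "z n" "w m"] wzD by simp
        moreover have "ip (w m) (z m) \<le> 0" by (rule gen_nonpos[OF wz])
        ultimately show ?case using wzD by (simp add: ip_simps)
      qed
    qed simp
    then have "eventually (\<lambda>n. - ip (w n) (z n) \<le> e / 2) sequentially"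
      using eventually_sequentially by blast
    then show "eventually (\<lambda>n. dist (- ip (w n) (z n)) 0 < e) sequentially"
    proof eventually_elim
      case (elim n)
      then show ?case using gen_nonpos[OF wz, of n] e by (simp add: dist_real_def)
    qed
  qed
  have "(\<lambda>n. - ip (w n) (z n) + (- 2 * ip (w n) g + (- ip f g))) \<longlonglongrightarrow> 0 + (- 2 * 0 + (- ip f g))"
    by (intro tendsto_intros small w0 fD)
  moreover have "- ip (w n) (z n) + (- 2 * ip (w n) g + (- ip f g)) = - ip (u n) (v n)" for n
  proof -
    have "ip f (v n) = ip g (u n)" using gen_sym[OF f u] by simp
    then show ?thesis
      unfolding w_def z_def using fD uD by (simp add: ip_simps ip_commute[of g])
  qed
  ultimately show ?thesis by simp
qed

end

section \<open>The space of square integrable functions\<close>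

lemma L2_spaceD:
  assumes "f \<in> L2_space \<mu>"
  shows "f \<in> borel_measurable \<mu>" "integrable \<mu> (\<lambda>x. (f x)\<^sup>2)"
  using assms by (auto simp: L2_space_def)

lemma L2_space_bound:
  assumes f: "f \<in> L2_space \<mu>" and g: "g \<in> borel_measurable \<mu>" "AE x in \<mu>. \<bar>g x\<bar> \<le> \<bar>f x\<bar>"
  shows "g \<in> L2_space \<mu>"
proof -
  have "integrable \<mu> (\<lambda>x. (g x)\<^sup>2)"
    by (rule Bochner_Integration.integrable_bound[OF L2_spaceD(2)[OF f]])
      (use g in \<open>auto intro: power_mono simp: abs_le_square_iff\<close>)
  then show ?thesis using g by (simp add: L2_space_def)
qed

lemma L2_space_abs: "f \<in> L2_space \<mu> \<Longrightarrow> (\<lambda>x. \<bar>f x\<bar>) \<in> L2_space \<mu>"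
  by (rule L2_space_bound) (auto dest: L2_spaceD)

lemma L2_space_mult_integrable:
  assumes "f \<in> L2_space \<mu>" "g \<in> L2_space \<mu>"
  shows "integrable \<mu> (\<lambda>x. f x * g x)"
proof (rule Bochner_Integration.integrable_bound)
  show "integrable \<mu> (\<lambda>x. (f x)\<^sup>2 + (g x)\<^sup>2)" using assms by (auto dest: L2_spaceD)
  have "\<bar>f x * g x\<bar> \<le> (f x)\<^sup>2 + (g x)\<^sup>2" for x
  proof -
    have "0 \<le> (\<bar>f x\<bar> - \<bar>g x\<bar>)\<^sup>2" by simp
    then have "2 * \<bar>f x * g x\<bar> \<le> (f x)\<^sup>2 + (g x)\<^sup>2" by (simp add: power2_diff abs_mult)
    then show ?thesis using zero_le_power2[of "f x"] zero_le_power2[of "g x"] by linarith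
  qed
  then show "AE x in \<mu>. norm (f x * g x) \<le> norm ((f x)\<^sup>2 + (g x)\<^sup>2)" by simp
qed (use L2_spaceD(1)[OF assms(1)] L2_spaceD(1)[OF assms(2)] in measurable)

lemma L2_space_add:
  assumes f: "f \<in> L2_space \<mu>" and g: "g \<in> L2_space \<mu>"
  shows "f + g \<in> L2_space \<mu>"
  using L2_spaceD[OF f] L2_spaceD[OF g] L2_space_mult_integrable[OF f g]
  by (auto simp: L2_space_def plus_fun_def power2_sum mult.assoc)

lemma L2_space_scale: "f \<in> L2_space \<mu> \<Longrightarrow> a *\<^sub>R f \<in> L2_space \<mu>"
  by (auto simp: L2_space_def scaleR_fun_def power_mult_distrib)

lemma L2_subspace: "subspace (L2_space \<mu>)"
  by (auto simp: subspace_def L2_space_add L2_space_scale) (simp add: L2_space_def zero_fun_def)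

lemma L2_indicator:
  assumes "A \<in> sets \<mu>" "emeasure \<mu> A \<noteq> \<infinity>"
  shows "(indicator A :: _ \<Rightarrow> real) \<in> L2_space \<mu>"
proof -
  have "(\<lambda>x. (indicator A x :: real)\<^sup>2) = indicator A" by (auto simp: indicator_def)
  then show ?thesis using assms by (auto simp: L2_space_def less_top)
qed

text \<open>The Riesz-Fischer theorem for a measure of possibly infinite mass, where L2 does not
  embed into L1. The increments \<open>D k\<close> of a fast subsequence have almost everywhere
  finite \<open>2 ^ k\<close>-weighted square sums; summability of \<open>D k\<close> itself follows
  from the inequality between arithmetic and geometric means.\<close>

lemma L2_Cauchy_limit:
  fixes X :: "nat \<Rightarrow> 'a \<Rightarrow> real"
  assumes X: "\<And>n. X n \<in> L2_space \<mu>"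
    and Cauchy: "\<And>e. 0 < e \<Longrightarrow> \<exists>N. \<forall>m\<ge>N. \<forall>n\<ge>N. (\<integral>x. (X m x - X n x)\<^sup>2 \<partial>\<mu>) < e"
  shows "\<exists>f\<in>L2_space \<mu>. (\<lambda>n. \<integral>x. (X n x - f x)\<^sup>2 \<partial>\<mu>) \<longlonglongrightarrow> 0"
proof -
  have [measurable]: "X n \<in> borel_measurable \<mu>" for n using L2_spaceD[OF X] by simp
  have "X m - X n \<in> L2_space \<mu>" for m n
    by (rule subspace_diff[OF L2_subspace X X])
  then have int: "integrable \<mu> (\<lambda>x. (X m x - X n x)\<^sup>2)" for m n
    by (auto simp: L2_space_def fun_diff_def)
  have nn: "(\<integral>\<^sup>+x. ennreal ((X m x - X n x)\<^sup>2) \<partial>\<mu>) = ennreal (\<integral>x. (X m x - X n x)\<^sup>2 \<partial>\<mu>)" for m n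
    by (rule nn_integral_eq_integral[OF int]) simp
  have "\<exists>N. \<forall>m\<ge>N. \<forall>n\<ge>N. (\<integral>x. (X m x - X n x)\<^sup>2 \<partial>\<mu>) < (1/4) ^ k" for k :: nat
    by (rule Cauchy) simp
  then obtain N where N: "\<And>k m n. m \<ge> N k \<Longrightarrow> n \<ge> N k \<Longrightarrow> (\<integral>x. (X m x - X n x)\<^sup>2 \<partial>\<mu>) < (1/4) ^ k"
    by metis
  \<comment> \<open>The partial sums make \<open>r\<close> monotone and at least \<open>N k\<close>;
    the summand \<open>k\<close> makes it unbounded.\<close>
  define r where "r k = (\<Sum>i\<le>k. N i) + k" for k
  have r_N: "N k \<le> r k" for k unfolding r_def by (simp add: member_le_sum trans_le_add1)
  have r_mono: "r k \<le> r (Suc k)" for k by (simp add: r_def)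
  have r_ge: "k \<le> r k" for k by (simp add: r_def)
  define D where "D k x = \<bar>X (r (Suc k)) x - X (r k) x\<bar>" for k x
  have [measurable]: "D k \<in> borel_measurable \<mu>" for k unfolding D_def by measurable
  have "(\<integral>\<^sup>+x. (\<Sum>k. ennreal (2 ^ k * (D k x)\<^sup>2)) \<partial>\<mu>) = (\<Sum>k. \<integral>\<^sup>+x. ennreal (2 ^ k * (D k x)\<^sup>2) \<partial>\<mu>)"
    by (rule nn_integral_suminf) measurable
  also have "\<dots> \<le> (\<Sum>k. ennreal ((1/2) ^ k))"
  proof (rule suminf_le)
    fix k
    have "(\<integral>\<^sup>+x. ennreal (2 ^ k * (D k x)\<^sup>2) \<partial>\<mu>) = ennreal (2 ^ k) * (\<integral>\<^sup>+x. ennreal ((X (r (Suc k)) x - X (r k) x)\<^sup>2) \<partial>\<mu>)"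
      by (subst nn_integral_cmult[symmetric]) (auto simp: D_def ennreal_mult')
    also have "\<dots> = ennreal (2 ^ k * (\<integral>x. (X (r (Suc k)) x - X (r k) x)\<^sup>2 \<partial>\<mu>))"
      by (simp add: nn ennreal_mult')
    also have "\<dots> \<le> ennreal (2 ^ k * (1/4) ^ k)"
      using N[of k "r (Suc k)" "r k"] r_N[of k] r_mono[of k]
      by (intro ennreal_leI mult_left_mono) auto
    also have "2 ^ k * (1/4) ^ k = ((1/2) ^ k :: real)" by (simp flip: power_mult_distrib)
    finally show "(\<integral>\<^sup>+x. ennreal (2 ^ k * (D k x)\<^sup>2) \<partial>\<mu>) \<le> ennreal ((1/2) ^ k)" .
  qed auto
  also have "\<dots> = ennreal (\<Sum>k. (1/2) ^ k)" by (rule suminf_ennreal2) auto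
  also have "\<dots> < \<infinity>" by simp
  finally have "AE x in \<mu>. (\<Sum>k. ennreal (2 ^ k * (D k x)\<^sup>2)) \<noteq> \<infinity>"
    by (intro nn_integral_PInf_AE) auto
  then have conv: "AE x in \<mu>. convergent (\<lambda>k. X (r k) x)"
  proof eventually_elim
    case (elim x)
    then have s1: "summable (\<lambda>k. 2 ^ k * (D k x)\<^sup>2)" by (intro summable_suminf_not_top) auto
    have "summable (\<lambda>k. (1/2) ^ k + 2 ^ k * (D k x)\<^sup>2)"
      by (intro summable_add s1) simp
    then have "summable (\<lambda>k. D k x)"
    proof (rule summable_comparison_test')
      fix k
      have "D k x \<le> (1/2) ^ k + 2 ^ k * (D k x)\<^sup>2"
      proof -
        define a :: real where "a = (1/2) ^ k"
        have a: "0 < a" "2 ^ k = 1 / a" by (auto simp: a_def power_one_over)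
        have "0 \<le> (D k x - a)\<^sup>2 / a" "0 \<le> D k x" using a by (auto simp: D_def)
        moreover have "(D k x - a)\<^sup>2 / a = (D k x)\<^sup>2 / a - 2 * D k x + a"
          using a by (simp add: power2_eq_square field_simps)
        ultimately have "D k x \<le> a + (1 / a) * (D k x)\<^sup>2" by simp
        then show ?thesis by (simp only: a(2) a_def[symmetric])
      qed
      moreover have "norm (D k x) = D k x" by (simp add: D_def)
      ultimately show "norm (D k x) \<le> (1/2) ^ k + 2 ^ k * (D k x)\<^sup>2" by (simp only:)
    qed
    then have "summable (\<lambda>k. X (r (Suc k)) x - X (r k) x)"
      unfolding D_def by (rule summable_rabs_cancel)
    then have "convergent (\<lambda>n. X (r n) x - X (r 0) x)"
      unfolding summable_iff_convergent by (simp only: sum_lessThan_telescope[of "\<lambda>k. X (r k) x"])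
    then have "convergent (\<lambda>n. (X (r n) x - X (r 0) x) + X (r 0) x)"
      by (intro convergent_add convergent_const)
    then show ?case by simp
  qed
  define f where "f x = lim (\<lambda>k. X (r k) x)" for x
  have f_meas [measurable]: "f \<in> borel_measurable \<mu>" unfolding f_def by measurable
  \<comment> \<open>The subsequence converges pointwise, and Fatou's lemma applied along it turns
    the Cauchy condition into convergence of the full sequence.\<close>
  have Fatou: "(\<integral>\<^sup>+x. ennreal ((X m x - f x)\<^sup>2) \<partial>\<mu>) \<le> ennreal e"
    if m: "\<And>n. n \<ge> M \<Longrightarrow> (\<integral>x. (X m x - X n x)\<^sup>2 \<partial>\<mu>) \<le> e" for m M e
  proof -
    have "(\<integral>\<^sup>+x. ennreal ((X m x - f x)\<^sup>2) \<partial>\<mu>) = (\<integral>\<^sup>+x. liminf (\<lambda>k. ennreal ((X m x - X (r k) x)\<^sup>2)) \<partial>\<mu>)"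
    proof (rule nn_integral_cong_AE)
      show "AE x in \<mu>. ennreal ((X m x - f x)\<^sup>2) = liminf (\<lambda>k. ennreal ((X m x - X (r k) x)\<^sup>2))"
        using conv
      proof eventually_elim
        case (elim x)
        then have "(\<lambda>k. X (r k) x) \<longlonglongrightarrow> f x" by (simp add: f_def convergent_LIMSEQ_iff)
        then have "(\<lambda>k. ennreal ((X m x - X (r k) x)\<^sup>2)) \<longlonglongrightarrow> ennreal ((X m x - f x)\<^sup>2)"
          by (intro tendsto_intros) auto
        then show ?case by (intro lim_imp_Liminf[symmetric]) auto
      qed
    qed
    also have "\<dots> \<le> liminf (\<lambda>k. \<integral>\<^sup>+x. ennreal ((X m x - X (r k) x)\<^sup>2) \<partial>\<mu>)"
      by (rule nn_integral_liminf) measurable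
    also have "\<dots> \<le> ennreal e"
    proof (rule Liminf_le)
      show "eventually (\<lambda>k. (\<integral>\<^sup>+x. ennreal ((X m x - X (r k) x)\<^sup>2) \<partial>\<mu>) \<le> ennreal e) sequentially"
        using eventually_ge_at_top[of M]
      proof eventually_elim
        case (elim k)
        then have "M \<le> r k" using r_ge[of k] by simp
        then show ?case unfolding nn by (intro ennreal_leI m)
      qed
    qed simp
    finally show ?thesis .
  qed
  obtain N0 where N0: "\<And>m n. m \<ge> N0 \<Longrightarrow> n \<ge> N0 \<Longrightarrow> (\<integral>x. (X m x - X n x)\<^sup>2 \<partial>\<mu>) < 1"
    using Cauchy[of 1] by auto
  have "(\<integral>\<^sup>+x. ennreal ((X N0 x - f x)\<^sup>2) \<partial>\<mu>) \<le> ennreal 1"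
    by (rule Fatou[of N0]) (use N0 in \<open>auto intro: less_imp_le\<close>)
  then have "integrable \<mu> (\<lambda>x. (X N0 x - f x)\<^sup>2)"
    by (intro integrableI_nonneg) (auto simp: le_less_trans)
  then have "X N0 - f \<in> L2_space \<mu>" by (simp add: L2_space_def fun_diff_def)
  then have f_L2: "f \<in> L2_space \<mu>"
    using subspace_diff[OF L2_subspace X[of N0], of "X N0 - f"] by simp
  have "(\<lambda>n. \<integral>x. (X n x - f x)\<^sup>2 \<partial>\<mu>) \<longlonglongrightarrow> 0"
    unfolding tendsto_iff
  proof (intro allI impI)
    fix e :: real assume e: "0 < e"
    then obtain M where M: "\<And>m n. m \<ge> M \<Longrightarrow> n \<ge> M \<Longrightarrow> (\<integral>x. (X m x - X n x)\<^sup>2 \<partial>\<mu>) < e / 2"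
      using Cauchy[of "e / 2"] by auto
    have "(\<integral>x. (X m x - f x)\<^sup>2 \<partial>\<mu>) \<le> e / 2" if m: "m \<ge> M" for m
    proof -
      have "(\<integral>\<^sup>+x. ennreal ((X m x - f x)\<^sup>2) \<partial>\<mu>) \<le> ennreal (e / 2)"
        by (rule Fatou[of M]) (use M m in \<open>auto intro: less_imp_le\<close>)
      then have "enn2real (\<integral>\<^sup>+x. ennreal ((X m x - f x)\<^sup>2) \<partial>\<mu>) \<le> enn2real (ennreal (e / 2))"
        by (rule enn2real_mono) simp
      then show ?thesis using e by (subst integral_eq_nn_integral) auto
    qed
    then have "eventually (\<lambda>m. (\<integral>x. (X m x - f x)\<^sup>2 \<partial>\<mu>) \<le> e / 2) sequentially"
      using eventually_sequentially by blast
    then show "eventually (\<lambda>m. dist (\<integral>x. (X m x - f x)\<^sup>2 \<partial>\<mu>) 0 < e) sequentially"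
      by eventually_elim (use e in simp)
  qed
  with f_L2 show ?thesis by blast
qed

lemma semi_hilbert_L2: "semi_hilbert (L2_space \<mu>) (L2_inner \<mu>)"
proof
  show "subspace (L2_space \<mu>)" by (rule L2_subspace)
  show "L2_inner \<mu> (f + g) h = L2_inner \<mu> f h + L2_inner \<mu> g h"
    if "f \<in> L2_space \<mu>" "g \<in> L2_space \<mu>" "h \<in> L2_space \<mu>" for f g h
    using L2_space_mult_integrable[OF that(1,3)] L2_space_mult_integrable[OF that(2,3)]
    by (simp add: L2_inner_def plus_fun_def distrib_right)
  show "\<exists>f\<in>L2_space \<mu>. (\<lambda>n. L2_inner \<mu> (X n - f) (X n - f)) \<longlonglongrightarrow> 0"
    if "\<And>n. X n \<in> L2_space \<mu>"
      "\<And>e. 0 < e \<Longrightarrow> \<exists>N. \<forall>m\<ge>N. \<forall>n\<ge>N. L2_inner \<mu> (X m - X n) (X m - X n) < e" for X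
    using L2_Cauchy_limit[of X \<mu>] that by (simp add: L2_inner_def fun_diff_def power2_eq_square)
  show "L2_inner \<mu> f g = L2_inner \<mu> g f" for f g by (simp add: L2_inner_def mult.commute)
qed (simp_all add: L2_inner_def scaleR_fun_def mult.assoc)

lemma L2_nrm: "semi_hilbert.nrm (L2_inner \<mu>) = L2_norm \<mu>"
  by (simp add: fun_eq_iff semi_hilbert.nrm_def[OF semi_hilbert_L2] L2_norm_def L2_inner_def power2_eq_square)

lemma L2_norm_eq_0_iff:
  assumes "f \<in> L2_space \<mu>" shows "L2_norm \<mu> f = 0 \<longleftrightarrow> (AE x in \<mu>. f x = 0)"
  using integral_nonneg_eq_0_iff_AE[OF L2_spaceD(2)[OF assms]] by (simp add: L2_norm_def)

section \<open>Symmetric Markov kernels\<close>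

context symmetric_markov_semigroup
begin

abbreviation P :: "real \<Rightarrow> ('a \<Rightarrow> real) \<Rightarrow> 'a \<Rightarrow> real" where
  "P t \<equiv> kernel_op (\<kappa> t)"

abbreviation L2 :: "('a \<Rightarrow> real) set" where
  "L2 \<equiv> L2_space \<mu>"

abbreviation ip :: "('a \<Rightarrow> real) \<Rightarrow> ('a \<Rightarrow> real) \<Rightarrow> real" where
  "ip \<equiv> L2_inner \<mu>"

section \<open>Measurability, symmetry and integrability under the kernels\<close>

lemma kernel_measurable: "0 \<le> t \<Longrightarrow> \<kappa> t \<in> \<mu> \<rightarrow>\<^sub>M subprob_algebra \<mu>"
  using kernel by (rule measurable_prob_algebraD)

lemma kernel_prob:
  assumes "0 \<le> t" "x \<in> space \<mu>"
  shows "prob_space (\<kappa> t x)" "sets (\<kappa> t x) = sets \<mu>" "space (\<kappa> t x) = space \<mu>"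
proof -
  have "\<kappa> t x \<in> space (prob_algebra \<mu>)" using kernel[OF assms(1)] assms(2) by (rule measurable_space)
  then show "prob_space (\<kappa> t x)" "sets (\<kappa> t x) = sets \<mu>" by (auto simp: space_prob_algebra)
  then show "space (\<kappa> t x) = space \<mu>" using sets_eq_imp_space_eq by blast
qed

lemma kernel_borel:
  assumes "0 \<le> t" "x \<in> space \<mu>" shows "f \<in> borel_measurable (\<kappa> t x) \<longleftrightarrow> f \<in> borel_measurable \<mu>"
  using measurable_cong_sets[OF kernel_prob(2)[OF assms] refl] by blast

lemma kernel_op_measurable [measurable (raw)]:
  assumes "0 \<le> t" "f \<in> borel_measurable \<mu>" shows "P t f \<in> borel_measurable \<mu>"
  using measurable_compose[OF kernel_measurable integral_measurable_subprob_algebra] assms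
  by (simp add: kernel_op_def[abs_def])

lemma kernel_nn_measurable:
  assumes "0 \<le> t" "f \<in> borel_measurable \<mu>" shows "(\<lambda>x. \<integral>\<^sup>+y. f y \<partial>\<kappa> t x) \<in> borel_measurable \<mu>"
  using measurable_compose[OF kernel_measurable nn_integral_measurable_subprob_algebra] assms by simp

text \<open>Symmetry is given for square integrable functions only. In extended nonnegative reals it
  passes to all nonnegative measurable functions by monotone approximation; in particular to the
  constant 1, which is not in L2 when the mass is infinite, and to functions of finite weighted
  norm.\<close>

lemma nn_symmetric:
  fixes f g :: "'a \<Rightarrow> real"
  assumes t: "0 \<le> t" and [measurable]: "f \<in> borel_measurable \<mu>" "g \<in> borel_measurable \<mu>"
    and pos: "\<And>x. 0 \<le> f x" "\<And>x. 0 \<le> g x"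
  shows "(\<integral>\<^sup>+x. ennreal (f x) * (\<integral>\<^sup>+y. ennreal (g y) \<partial>\<kappa> t x) \<partial>\<mu>)
       = (\<integral>\<^sup>+x. ennreal (g x) * (\<integral>\<^sup>+y. ennreal (f y) \<partial>\<kappa> t x) \<partial>\<mu>)"
proof -
  obtain A :: "nat \<Rightarrow> 'a set" where A: "range A \<subseteq> sets \<mu>" "(\<Union>i. A i) = space \<mu>"
      "\<And>i. emeasure \<mu> (A i) \<noteq> \<infinity>" "incseq A"
    by (rule sigma_finite_incseq) blast
  have [measurable]: "A n \<in> sets \<mu>" for n using A by auto
  \<comment> \<open>Cutting both the values and the support makes the truncations square integrable;
    they increase to \<open>f\<close> on the whole space.\<close>
  define tr where "tr f n x = min (f x) (real n) * indicator (A n) x" for f :: "'a \<Rightarrow> real" and n x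
  have tr_meas [measurable]: "tr h n \<in> borel_measurable \<mu>" if [measurable]: "h \<in> borel_measurable \<mu>" for h n
    unfolding tr_def by measurable
  have tr_pos: "0 \<le> tr h n x" if "\<And>x. 0 \<le> h x" for h n x
    using that[of x] by (auto simp: tr_def)
  have tr_le: "tr h n x \<le> real n * indicator (A n) x" for h n x
    by (auto simp: tr_def indicator_def)
  have tr_le_n: "tr h n x \<le> real n" for h n x
    by (auto simp: tr_def indicator_def)
  have tr_L2: "tr h n \<in> L2" if "h \<in> borel_measurable \<mu>" "\<And>x. 0 \<le> h x" for h n
  proof (rule L2_space_bound)
    show "real n *\<^sub>R indicator (A n) \<in> L2" using A by (intro L2_space_scale L2_indicator) auto
    show "AE x in \<mu>. \<bar>tr h n x\<bar> \<le> \<bar>(real n *\<^sub>R indicator (A n)) x\<bar>"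
      using tr_le tr_pos[OF that(2)] by (auto simp: scaleR_fun_def)
  qed (use that in measurable)
  have tr_mono: "tr h m x \<le> tr h n x" if "m \<le> n" "\<And>x. 0 \<le> h x" for h m n x
    using that(2)[of x] that(1) incseqD[OF A(4) that(1)] by (auto simp: tr_def indicator_def)
  have tr_sup: "(SUP n. ennreal (tr h n x)) = ennreal (h x)" if "x \<in> space \<mu>" "\<And>x. 0 \<le> h x" for h x
  proof (rule LIMSEQ_unique[OF LIMSEQ_SUP])
    show "incseq (\<lambda>n. ennreal (tr h n x))" using tr_mono that(2) by (auto simp: incseq_def intro!: ennreal_leI)
    have "x \<in> (\<Union>i. A i)" using A(2) that(1) by simp
    then obtain k where k: "x \<in> A k" by (rule UN_E)
    have "eventually (\<lambda>n. ennreal (tr h n x) = ennreal (h x)) sequentially"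
      using eventually_ge_at_top[of "max k (nat \<lceil>h x\<rceil>)"]
    proof eventually_elim
      case (elim n)
      then have "x \<in> A n" using k incseqD[OF A(4), of k n] by auto
      moreover have "h x \<le> real n" using elim by linarith
      ultimately show ?case by (simp add: tr_def)
    qed
    then show "(\<lambda>n. ennreal (tr h n x)) \<longlonglongrightarrow> ennreal (h x)" by (rule tendsto_eventually)
  qed
  have step: "(\<integral>\<^sup>+x. ennreal (tr h n x) * (\<integral>\<^sup>+y. ennreal (tr k n y) \<partial>\<kappa> t x) \<partial>\<mu>)
      = ennreal (ip (tr h n) (P t (tr k n)))"
    if h: "h \<in> borel_measurable \<mu>" "\<And>x. 0 \<le> h x" and k: "k \<in> borel_measurable \<mu>" "\<And>x. 0 \<le> k x" for h k n
  proof -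
    have [measurable]: "h \<in> borel_measurable \<mu>" "k \<in> borel_measurable \<mu>" by fact+
    have hp: "0 \<le> tr h n x" and kp: "0 \<le> tr k n x" for x by (rule tr_pos, rule h k)+
    have int: "integrable (\<kappa> t x) (tr k n)" if "x \<in> space \<mu>" for x
    proof -
      interpret K: prob_space "\<kappa> t x" using kernel_prob[OF t that] by simp
      have "\<bar>tr k n y\<bar> \<le> real n" for y using tr_le_n kp by simp
      then show ?thesis by (intro K.integrable_const_bound[of _ "real n"]) (auto simp: kernel_borel[OF t that])
    qed
    have op: "(\<integral>\<^sup>+y. ennreal (tr k n y) \<partial>\<kappa> t x) = ennreal (P t (tr k n) x)"
      if "x \<in> space \<mu>" for x
      using int[OF that] kp by (simp add: kernel_op_def nn_integral_eq_integral)
    have op_pos: "0 \<le> P t (tr k n) x" for x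
      using kp by (simp add: kernel_op_def)
    have op_le: "P t (tr k n) x \<le> real n" if "x \<in> space \<mu>" for x
    proof -
      interpret K: prob_space "\<kappa> t x" using kernel_prob[OF t that] by simp
      show ?thesis unfolding kernel_op_def using int[OF that] tr_le_n
        by (intro K.integral_le_const) auto
    qed
    have "integrable \<mu> (\<lambda>x. tr h n x * P t (tr k n) x)"
    proof (rule integrableI_bounded_set[of "A n" _ _ "real n * real n"])
      show "AE x in \<mu>. x \<in> A n \<longrightarrow> norm (tr h n x * P t (tr k n) x) \<le> real n * real n"
      proof (intro AE_I2 impI)
        fix x assume x: "x \<in> space \<mu>" "x \<in> A n"
        have "tr h n x * P t (tr k n) x \<le> real n * real n"
          using op_le[OF x(1)] op_pos tr_le_n by (intro mult_mono) auto
        then show "norm (tr h n x * P t (tr k n) x) \<le> real n * real n"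
          using op_pos hp by (simp add: abs_mult)
      qed
    qed (use A t in \<open>auto simp: less_top tr_def\<close>)
    then have "ennreal (ip (tr h n) (P t (tr k n)))
        = (\<integral>\<^sup>+x. ennreal (tr h n x * P t (tr k n) x) \<partial>\<mu>)"
      unfolding L2_inner_def using op_pos hp
      by (intro nn_integral_eq_integral[symmetric]) auto
    also have "\<dots> = (\<integral>\<^sup>+x. ennreal (tr h n x) * (\<integral>\<^sup>+y. ennreal (tr k n y) \<partial>\<kappa> t x) \<partial>\<mu>)"
      using op op_pos hp by (intro nn_integral_cong) (simp add: ennreal_mult')
    finally show ?thesis ..
  qed
  have lim: "(\<integral>\<^sup>+x. ennreal (h x) * (\<integral>\<^sup>+y. ennreal (k y) \<partial>\<kappa> t x) \<partial>\<mu>)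
      = (SUP n. \<integral>\<^sup>+x. ennreal (tr h n x) * (\<integral>\<^sup>+y. ennreal (tr k n y) \<partial>\<kappa> t x) \<partial>\<mu>)"
    if h: "h \<in> borel_measurable \<mu>" "\<And>x. 0 \<le> h x" and k: "k \<in> borel_measurable \<mu>" "\<And>x. 0 \<le> k x" for h k
  proof -
    have [measurable]: "h \<in> borel_measurable \<mu>" "k \<in> borel_measurable \<mu>" by fact+
    let ?a = "\<lambda>n x. ennreal (tr h n x)" and ?b = "\<lambda>n x. \<integral>\<^sup>+y. ennreal (tr k n y) \<partial>\<kappa> t x"
    have inc: "incseq (\<lambda>n x. ?a n x * ?b n x)"
      using tr_mono h k by (auto simp: incseq_def le_fun_def intro!: mult_mono nn_integral_mono ennreal_leI)
    have "(\<integral>\<^sup>+x. ennreal (h x) * (\<integral>\<^sup>+y. ennreal (k y) \<partial>\<kappa> t x) \<partial>\<mu>) = (\<integral>\<^sup>+x. (SUP n. ?a n x * ?b n x) \<partial>\<mu>)"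
    proof (rule nn_integral_cong)
      fix x assume x: "x \<in> space \<mu>"
      have "(\<integral>\<^sup>+y. ennreal (k y) \<partial>\<kappa> t x) = (\<integral>\<^sup>+y. (SUP n. ennreal (tr k n y)) \<partial>\<kappa> t x)"
        using tr_sup k kernel_prob(3)[OF t x] by (intro nn_integral_cong) auto
      also have "\<dots> = (SUP n. ?b n x)"
      proof (rule nn_integral_monotone_convergence_SUP)
        show "incseq (\<lambda>n y. ennreal (tr k n y))"
          using tr_mono k by (auto simp: incseq_def le_fun_def intro!: ennreal_leI)
        show "(\<lambda>y. ennreal (tr k n y)) \<in> borel_measurable (\<kappa> t x)" for n
          unfolding kernel_borel[OF t x] by measurable
      qed
      finally have "ennreal (h x) * (\<integral>\<^sup>+y. ennreal (k y) \<partial>\<kappa> t x) = (SUP n. ?a n x) * (SUP n. ?b n x)"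
        using tr_sup[OF x h(2)] by simp
      also have "\<dots> = (SUP n. ?a n x * ?b n x)"
      proof (rule LIMSEQ_unique)
        have *: "incseq (\<lambda>n. ?a n x)" "incseq (\<lambda>n. ?b n x)"
          using tr_mono h k by (auto simp: incseq_def intro!: nn_integral_mono ennreal_leI)
        show "(\<lambda>n. ?a n x * ?b n x) \<longlonglongrightarrow> (SUP n. ?a n x * ?b n x)"
          using inc by (intro LIMSEQ_SUP) (auto simp: incseq_def le_fun_def)
        show "(\<lambda>n. ?a n x * ?b n x) \<longlonglongrightarrow> (SUP n. ?a n x) * (SUP n. ?b n x)"
        \<comment> \<open>Multiplication of extended reals is discontinuous at 0 times infinity, so
          a vanishing factor is treated apart. The other factor may be infinite.\<close>
        proof (cases "h x = 0")
          case True
          then have "?a n x = 0" for n by (simp add: tr_def)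
          then show ?thesis by simp
        next
          case False
          then have "(SUP n. ?a n x) \<noteq> 0" "(SUP n. ?a n x) \<noteq> \<infinity>" using tr_sup[OF x h(2)] h(2)[of x] by auto
          then show ?thesis by (intro tendsto_mult_ennreal LIMSEQ_SUP *) auto
        qed
      qed
      finally show "ennreal (h x) * (\<integral>\<^sup>+y. ennreal (k y) \<partial>\<kappa> t x) = (SUP n. ?a n x * ?b n x)" .
    qed
    also have "\<dots> = (SUP n. \<integral>\<^sup>+x. ?a n x * ?b n x \<partial>\<mu>)"
      using t by (intro nn_integral_monotone_convergence_SUP inc borel_measurable_times_ennreal kernel_nn_measurable) auto
    finally show ?thesis .
  qed
  have "ip (tr f n) (P t (tr g n)) = ip (tr g n) (P t (tr f n))" for n
    using symmetric[OF t tr_L2 tr_L2, of f g n n] pos by (simp add: L2_inner_def mult.commute)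
  then show ?thesis using pos by (simp add: lim step)
qed

lemma invariant:
  fixes f :: "'a \<Rightarrow> real"
  assumes t: "0 \<le> t" and f: "f \<in> borel_measurable \<mu>" "\<And>x. 0 \<le> f x"
  shows "(\<integral>\<^sup>+x. (\<integral>\<^sup>+y. ennreal (f y) \<partial>\<kappa> t x) \<partial>\<mu>) = (\<integral>\<^sup>+x. ennreal (f x) \<partial>\<mu>)"
proof -
  have "(\<integral>\<^sup>+x. (\<integral>\<^sup>+y. ennreal (f y) \<partial>\<kappa> t x) \<partial>\<mu>) = (\<integral>\<^sup>+x. ennreal (f x) * (\<integral>\<^sup>+y. ennreal 1 \<partial>\<kappa> t x) \<partial>\<mu>)"
    using nn_symmetric[OF t _ f(1), of "\<lambda>_. 1"] f by simp
  also have "\<dots> = (\<integral>\<^sup>+x. ennreal (f x) \<partial>\<mu>)"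
  proof (rule nn_integral_cong)
    fix x assume x: "x \<in> space \<mu>"
    show "ennreal (f x) * (\<integral>\<^sup>+y. ennreal 1 \<partial>\<kappa> t x) = ennreal (f x)"
      using prob_space.emeasure_space_1[OF kernel_prob(1)[OF t x]] by simp
  qed
  finally show ?thesis .
qed

lemma AE_kernel_integrable_sq:
  assumes t: "0 \<le> t" and f: "f \<in> L2"
  shows "AE x in \<mu>. integrable (\<kappa> t x) (\<lambda>y. (f y)\<^sup>2)" "AE x in \<mu>. integrable (\<kappa> t x) f"
proof -
  note fD = L2_spaceD[OF f]
  have "(\<integral>\<^sup>+x. (\<integral>\<^sup>+y. ennreal ((f y)\<^sup>2) \<partial>\<kappa> t x) \<partial>\<mu>) < \<infinity>"
    using fD by (subst invariant[OF t]) (auto simp: nn_integral_eq_integral)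
  then have "AE x in \<mu>. (\<integral>\<^sup>+y. ennreal ((f y)\<^sup>2) \<partial>\<kappa> t x) \<noteq> \<infinity>"
    using t fD by (intro nn_integral_PInf_AE kernel_nn_measurable) auto
  then show sq: "AE x in \<mu>. integrable (\<kappa> t x) (\<lambda>y. (f y)\<^sup>2)"
    using AE_space
  proof eventually_elim
    case (elim x)
    then show ?case using kernel_borel[OF t elim(2)] fD
      by (intro integrableI_nonneg) (auto simp: less_top)
  qed
  then show "AE x in \<mu>. integrable (\<kappa> t x) f"
    using AE_space
  proof eventually_elim
    case (elim x)
    interpret K: prob_space "\<kappa> t x" using kernel_prob[OF t elim(2)] by simp
    show ?case
      by (rule K.square_integrable_imp_integrable) (use elim fD kernel_borel[OF t elim(2)] in auto)
  qed
qed

lemma kernel_op_sq_le: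
  assumes t: "0 \<le> t" and f: "f \<in> L2"
  shows "(\<integral>\<^sup>+x. ennreal ((P t f x)\<^sup>2) \<partial>\<mu>) \<le> ennreal (\<integral>x. (f x)\<^sup>2 \<partial>\<mu>)"
proof -
  note fD = L2_spaceD[OF f]
  have "(\<integral>\<^sup>+x. ennreal ((P t f x)\<^sup>2) \<partial>\<mu>) \<le> (\<integral>\<^sup>+x. (\<integral>\<^sup>+y. ennreal ((f y)\<^sup>2) \<partial>\<kappa> t x) \<partial>\<mu>)"
  proof (rule nn_integral_mono_AE)
    show "AE x in \<mu>. ennreal ((P t f x)\<^sup>2) \<le> (\<integral>\<^sup>+y. ennreal ((f y)\<^sup>2) \<partial>\<kappa> t x)"
      using AE_kernel_integrable_sq[OF t f] AE_space
    proof eventually_elim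
      case (elim x)
      interpret K: prob_space "\<kappa> t x" using kernel_prob[OF t elim(3)] by simp
      \<comment> \<open>Jensen's inequality for the square, in the form that the variance of
        \<open>f\<close> under \<open>\<kappa> t x\<close> is nonnegative.\<close>
      have "(P t f x)\<^sup>2 \<le> (\<integral>y. (f y)\<^sup>2 \<partial>\<kappa> t x)"
        using K.variance_positive[of f] K.variance_eq[OF elim(2,1)] by (simp add: kernel_op_def)
      then show ?case using elim by (simp add: nn_integral_eq_integral ennreal_leI)
    qed
  qed
  also have "\<dots> = ennreal (\<integral>x. (f x)\<^sup>2 \<partial>\<mu>)"
    using fD by (subst invariant[OF t]) (auto simp: nn_integral_eq_integral)
  finally show ?thesis .
qed

lemma kernel_op_L2:
  assumes t: "0 \<le> t" and f: "f \<in> L2"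
  shows "P t f \<in> L2" "L2_norm \<mu> (P t f) \<le> L2_norm \<mu> f"
proof -
  note m = kernel_op_measurable[OF t L2_spaceD(1)[OF f]]
  have int: "integrable \<mu> (\<lambda>x. (P t f x)\<^sup>2)"
    using kernel_op_sq_le[OF t f] m by (intro integrableI_nonneg) (auto simp: le_less_trans)
  then show "P t f \<in> L2" using m by (simp add: L2_space_def)
  show "L2_norm \<mu> (P t f) \<le> L2_norm \<mu> f"
    unfolding L2_norm_def using kernel_op_sq_le[OF t f] int
    by (intro real_sqrt_le_mono) (simp add: nn_integral_eq_integral ennreal_le_iff)
qed

section \<open>The semigroup on square integrable functions\<close>

sublocale hilb: semi_hilbert "L2" "ip"
  by (rule semi_hilbert_L2)

lemma L2_inner_truncate:
  assumes f: "f \<in> L2" and g: "g \<in> L2"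
  shows "(\<lambda>n. ip (\<lambda>x. if \<bar>f x\<bar> \<le> real n then f x else 0) g) \<longlonglongrightarrow> ip f g"
  unfolding L2_inner_def
proof (rule integral_dominated_convergence)
  have [measurable]: "f \<in> borel_measurable \<mu>" "g \<in> borel_measurable \<mu>"
    using f g by (auto dest: L2_spaceD)
  show "(\<lambda>x. f x * g x) \<in> borel_measurable \<mu>"
    "(\<lambda>x. (if \<bar>f x\<bar> \<le> real n then f x else 0) * g x) \<in> borel_measurable \<mu>" for n by measurable
  show "integrable \<mu> (\<lambda>x. \<bar>f x * g x\<bar>)" using L2_space_mult_integrable[OF f g] by simp
  show "AE x in \<mu>. (\<lambda>n. (if \<bar>f x\<bar> \<le> real n then f x else 0) * g x) \<longlonglongrightarrow> f x * g x"
  proof (rule AE_I2)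
    fix x
    have "eventually (\<lambda>n. (if \<bar>f x\<bar> \<le> real n then f x else 0) * g x = f x * g x) sequentially"
      using eventually_ge_at_top[of "nat \<lceil>\<bar>f x\<bar>\<rceil>"]
      by eventually_elim (auto simp: nat_le_iff ceiling_le_iff)
    then show "(\<lambda>n. (if \<bar>f x\<bar> \<le> real n then f x else 0) * g x) \<longlonglongrightarrow> f x * g x"
      by (rule tendsto_eventually)
  qed
qed (simp add: abs_mult)

sublocale hilb: contraction_semigroup "L2" "ip" P
proof
  show sym: "hilb.symmetric_op (P t)" if "0 \<le> t" for t
    using symmetric[OF that] kernel_op_L2[OF that] by (simp add: hilb.symmetric_op_def)
  show "hilb.nrm (P t f) \<le> hilb.nrm f" if "0 \<le> t" "f \<in> L2" for t f
    using kernel_op_L2(2)[OF that] by (simp add: L2_nrm)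
  show "((\<lambda>t. hilb.nrm (P t f - f)) \<longlongrightarrow> 0) (at_right 0)" if "f \<in> L2" for f
    using continuous[OF that] by (simp add: L2_nrm fun_diff_def)
  fix s t :: real and f assume s: "0 \<le> s" and t: "0 \<le> t" and f: "f \<in> L2"
  \<comment> \<open>The semigroup law is given for bounded functions. The truncations satisfy it,
    and by symmetry the operators can be moved to \<open>g\<close>, so that only \<open>F n\<close>
    has to converge, and only in a weak sense.\<close>
  define F where "F n x = (if \<bar>f x\<bar> \<le> real n then f x else 0)" for n :: nat and x
  have [measurable]: "f \<in> borel_measurable \<mu>" using f by (auto dest: L2_spaceD)
  have F: "F n \<in> L2" for n
    by (rule L2_space_bound[OF f]) (auto simp: F_def[abs_def])
  have Fb: "bounded (F n ` space \<mu>)" for n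
    by (rule boundedI[of _ "real n"]) (auto simp: F_def)
  show "hilb.nrm (P t (P s f) - P (t + s) f) = 0"
  proof (rule hilb.null_diffI)
    fix g assume g: "g \<in> L2"
    let ?g = "P s (P t g)"
    have eq: "ip (F n) ?g = ip (F n) (P (t + s) g)" for n
    proof -
      have "ip (F n) ?g = ip (P t (P s (F n))) g"
        using s t F g kernel_op_L2 symmetric by simp
      also have "\<dots> = ip (P (t + s) (F n)) g"
      proof -
        have [measurable]: "g \<in> borel_measurable \<mu>" using g by (rule L2_spaceD)
        have [measurable]: "P t (P s (F n)) \<in> borel_measurable \<mu>"
          "P (t + s) (F n) \<in> borel_measurable \<mu>"
          using s t L2_spaceD(1)[OF F, of n] by (auto intro!: kernel_op_measurable)
        show ?thesis
          unfolding L2_inner_def using semigroup[OF s t L2_spaceD(1)[OF F] Fb, of n]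
          by (intro integral_cong_AE) auto
      qed
      also have "\<dots> = ip (F n) (P (t + s) g)" using s t F g symmetric by simp
      finally show ?thesis .
    qed
    have "ip f ?g = ip f (P (t + s) g)"
    proof (rule LIMSEQ_unique)
      show "(\<lambda>n. ip (F n) ?g) \<longlonglongrightarrow> ip f ?g"
        unfolding F_def using s t f g kernel_op_L2 by (intro L2_inner_truncate) auto
      show "(\<lambda>n. ip (F n) ?g) \<longlonglongrightarrow> ip f (P (t + s) g)"
        unfolding eq unfolding F_def using s t f g kernel_op_L2 by (intro L2_inner_truncate) auto
    qed
    then show "ip (P t (P s f)) g = ip (P (t + s) f) g"
      using s t f g kernel_op_L2 symmetric by simp
  qed (use s t f kernel_op_L2 in auto)
qed

lemma gen_iff: "hilb.gen f g \<longleftrightarrow> is_generator_image \<mu> \<kappa> f g"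
  by (simp add: hilb.gen_def is_generator_image_def L2_nrm fun_diff_def scaleR_fun_def)

end

section \<open>Growth from one-sided derivatives\<close>

text \<open>For a slope \<open>L - e\<close>, the set of times at which the claimed growth holds
  contains its supremum by the left condition, and the right condition extends it beyond any point
  before \<open>t\<close>. The left condition is one-sided, so that it covers continuous functions
  as well as non-decreasing ones.\<close>

lemma right_lower_derivative_growth:
  fixes G :: "real \<Rightarrow> real"
  assumes t: "0 \<le> t"
    and left: "\<And>s e. 0 < s \<Longrightarrow> s \<le> t \<Longrightarrow> 0 < e \<Longrightarrow> eventually (\<lambda>r. G r \<le> G s + e) (at_left s)"
    and right: "\<And>s e. 0 \<le> s \<Longrightarrow> s < t \<Longrightarrow> 0 < e \<Longrightarrow>
      eventually (\<lambda>r. (L - e) * (r - s) \<le> G r - G s) (at_right s)"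
  shows "L * t \<le> G t - G 0"
proof -
  have main: "(L - e) * t \<le> G t - G 0" if e: "0 < e" for e
  proof -
    define S where "S = {s \<in> {0..t}. (L - e) * s \<le> G s - G 0}"
    define m where "m = Sup S"
    have S0: "0 \<in> S" using t by (simp add: S_def)
    have bdd: "bdd_above S" by (rule bdd_aboveI[of _ t]) (auto simp: S_def)
    have le_m: "s \<le> m" if "s \<in> S" for s unfolding m_def using that bdd by (rule cSup_upper)
    have m: "0 \<le> m" "m \<le> t"
      using le_m[OF S0] S0 by (auto simp: m_def S_def intro!: cSup_least)
    have "m \<in> S"
    proof (rule ccontr)
      assume "m \<notin> S"
      then have "0 < m" using m S0 by (cases "m = 0") auto
      define d where "d = (L - e) * m - (G m - G 0)"
      have d: "0 < d" using \<open>m \<notin> S\<close> m by (auto simp: S_def d_def)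
      have "((\<lambda>r. (L - e) * (m - r)) \<longlongrightarrow> (L - e) * (m - m)) (at_left m)"
        by (intro tendsto_intros)
      then have "eventually (\<lambda>r. (L - e) * (m - r) < d / 2) (at_left m)"
        by (rule order_tendstoD) (use d in simp)
      moreover have "eventually (\<lambda>r. G r \<le> G m + d / 2) (at_left m)"
        using left[of m "d / 2"] \<open>0 < m\<close> m d by simp
      ultimately have "eventually (\<lambda>r. (L - e) * (m - r) < d / 2 \<and> G r \<le> G m + d / 2) (at_left m)"
        by (rule eventually_conj)
      then obtain b where b: "b < m"
          "\<And>r. b < r \<Longrightarrow> r < m \<Longrightarrow> (L - e) * (m - r) < d / 2 \<and> G r \<le> G m + d / 2"
        using \<open>0 < m\<close> by (auto simp: eventually_at_left_field)
      obtain s where s: "s \<in> S" "b < s"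
        using less_cSupD[of S b] b(1) S0 by (auto simp: m_def)
      then have "s < m" using le_m[of s] \<open>m \<notin> S\<close> by (cases "s = m") auto
      then have "(L - e) * (m - s) < d / 2" "G s \<le> G m + d / 2" using b(2)[OF s(2)] by auto
      moreover have "(L - e) * s \<le> G s - G 0" using s by (simp add: S_def)
      moreover have "(L - e) * (m - s) = (L - e) * m - (L - e) * s" by (simp add: right_diff_distrib)
      ultimately show False using d_def by argo
    qed
    have "m = t"
    proof (rule ccontr)
      assume "m \<noteq> t"
      then have mt: "m < t" using m by simp
      obtain b where b: "m < b" "\<And>r. m < r \<Longrightarrow> r < b \<Longrightarrow> (L - e) * (r - m) \<le> G r - G m"
        using right[OF m(1) mt e] by (auto simp: eventually_at_right_field)
      define r where "r = (m + min b t) / 2"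
      have r: "m < r" "r < b" "r \<le> t" using b mt by (auto simp: r_def)
      have "(L - e) * (r - m) \<le> G r - G m" by (rule b(2)[OF r(1,2)])
      moreover have "(L - e) * m \<le> G m - G 0" using \<open>m \<in> S\<close> by (simp add: S_def)
      ultimately have "r \<in> S" using r m by (simp add: S_def algebra_simps)
      then show False using le_m[of r] r by simp
    qed
    then show ?thesis using \<open>m \<in> S\<close> by (simp add: S_def)
  qed
  show ?thesis
  proof (rule field_le_epsilon)
    fix d :: real assume d: "0 < d"
    define e where "e = d / (t + 1)"
    have e: "0 < e" "e * t \<le> d" using d t by (auto simp: e_def field_simps)
    show "L * t \<le> G t - G 0 + d" using main[OF e(1)] e(2) by (simp add: algebra_simps)
  qed
qed

lemma right_derivative_eventually_ge:
  fixes G :: "real \<Rightarrow> real"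
  assumes "(G has_real_derivative D) (at_right s)" "d < D"
  shows "eventually (\<lambda>r. d * (r - s) \<le> G r - G s) (at_right s)"
proof -
  have "((\<lambda>r. (G r - G s) / (r - s)) \<longlongrightarrow> D) (at_right s)"
    using assms(1) by (simp add: has_field_derivative_iff)
  then have "eventually (\<lambda>r. d < (G r - G s) / (r - s)) (at_right s)"
    using assms(2) by (rule order_tendstoD)
  then show ?thesis using eventually_at_right_less[of s]
    by eventually_elim (simp add: field_simps)
qed

section \<open>Rate functions\<close>

locale nash_rate =
  fixes M :: real and \<phi> :: "real \<Rightarrow> real"
  assumes M_nonneg: "0 \<le> M"
    and rate_pos: "M < x \<Longrightarrow> 0 < \<phi> x"
    and rate_mono: "mono_on {M<..} (\<lambda>x. \<phi> x / x)"
    and rate_integrable: "\<exists>a>M. set_integrable lborel {a<..} (\<lambda>x. 1 / \<phi> x)"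
begin

lemma rate_ratio_le: "M < x \<Longrightarrow> x \<le> y \<Longrightarrow> \<phi> x / x \<le> \<phi> y / y"
  using rate_mono by (rule mono_onD) auto

lemma rate_le:
  assumes "M < x" "x \<le> y" shows "\<phi> x \<le> \<phi> y"
proof -
  have x: "0 < x" "0 < y" using assms M_nonneg by auto
  have "\<phi> x = x * (\<phi> x / x)" using x by simp
  also have "\<dots> \<le> y * (\<phi> y / y)"
    using assms x rate_ratio_le[OF assms] rate_pos[OF assms(1)] by (intro mult_mono) auto
  also have "\<dots> = \<phi> y" using x by simp
  finally show ?thesis .
qed

lemma inverse_rate_le: "M < x \<Longrightarrow> x \<le> y \<Longrightarrow> 1 / \<phi> y \<le> 1 / \<phi> x"
  using rate_le[of x y] rate_pos[of x] rate_pos[of y] by (intro divide_left_mono) auto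

lemma inverse_rate_measurable: "(\<lambda>u. 1 / \<phi> u) \<in> borel_measurable (restrict_space borel {M<..})"
proof -
  have "\<phi> \<in> borel_measurable (restrict_space borel {M<..})"
    by (rule borel_measurable_mono_on_fnc) (auto simp: mono_on_def intro: rate_le)
  then show ?thesis by measurable
qed

text \<open>Between \<open>x\<close> and the given ray, monotonicity bounds
  \<open>1 / \<phi>\<close> by \<open>1 / \<phi> x\<close>. Divergence is possible only at
  \<open>M\<close> itself, which is the case \<open>U(M) = \<infinity>\<close>.\<close>

lemma set_integrable_inverse_rate:
  assumes x: "M < x" shows "set_integrable lborel {x<..} (\<lambda>u. 1 / \<phi> u)"
proof -
  obtain a where a: "M < a" "set_integrable lborel {a<..} (\<lambda>u. 1 / \<phi> u)"
    using rate_integrable by blast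
  show ?thesis
  proof (cases "a \<le> x")
    case True
    then show ?thesis using a by (intro set_integrable_subset[OF a(2)]) auto
  next
    case False
    have "set_integrable lborel {x<..a} (\<lambda>u. 1 / \<phi> u)"
      unfolding set_integrable_def
    proof (rule integrableI_bounded_set)
      show "AE u in lborel. u \<in> {x<..a} \<longrightarrow> norm (indicator {x<..a} u *\<^sub>R (1 / \<phi> u)) \<le> 1 / \<phi> x"
        using inverse_rate_le[OF x] rate_pos x by (auto simp: less_imp_le)
      \<comment> \<open>Outside \<open>{M<..}\<close> nothing is known about \<open>\<phi>\<close>,
        not even measurability, hence the additional indicator.\<close>
      have "(\<lambda>u. indicator {M<..} u *\<^sub>R (1 / \<phi> u)) \<in> borel_measurable borel"
        using inverse_rate_measurable by (simp add: borel_measurable_restrict_space_iff)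
      then have "(\<lambda>u. indicator {x<..a} u *\<^sub>R (indicator {M<..} u *\<^sub>R (1 / \<phi> u))) \<in> borel_measurable borel"
        by measurable
      also have "(\<lambda>u. indicator {x<..a} u *\<^sub>R (indicator {M<..} u *\<^sub>R (1 / \<phi> u))) = (\<lambda>u. indicator {x<..a} u *\<^sub>R (1 / \<phi> u))"
        using x by (auto simp: fun_eq_iff indicator_def)
      finally show "(\<lambda>u. indicator {x<..a} u *\<^sub>R (1 / \<phi> u)) \<in> borel_measurable lborel" by simp
    qed (use False in auto)
    then have "set_integrable lborel ({x<..a} \<union> {a<..}) (\<lambda>u. 1 / \<phi> u)"
      using a(2) by (rule set_integrable_Un) auto
    moreover have "{x<..a} \<union> {a<..} = {x<..}" using False by auto
    ultimately show ?thesis by simp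
  qed
qed

lemma nash_U_diff:
  assumes x: "M < x" and xy: "x \<le> y"
  shows "nash_U \<phi> x - nash_U \<phi> y = (LINT u:{x<..y}|lborel. 1 / \<phi> u)"
    and "set_integrable lborel {x<..y} (\<lambda>u. 1 / \<phi> u)"
proof -
  show int: "set_integrable lborel {x<..y} (\<lambda>u. 1 / \<phi> u)"
    using set_integrable_inverse_rate[OF x] by (rule set_integrable_subset) auto
  have eq: "{x<..y} \<union> {y<..} = {x<..}" using xy by auto
  have "(LINT u:{x<..y} \<union> {y<..}|lborel. 1 / \<phi> u)
      = (LINT u:{x<..y}|lborel. 1 / \<phi> u) + (LINT u:{y<..}|lborel. 1 / \<phi> u)"
    by (rule set_integral_Un) (use int set_integrable_inverse_rate[of y] x xy in auto)
  then show "nash_U \<phi> x - nash_U \<phi> y = (LINT u:{x<..y}|lborel. 1 / \<phi> u)"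
    by (simp add: eq nash_U_def)
qed

text \<open>As \<open>\<phi>\<close> may jump, these secant bounds replace
  \<open>U' = - 1 / \<phi>\<close>; both come from the monotonicity of \<open>1 / \<phi>\<close>.
  The lower one drives the decay argument and strict monotonicity, the upper one gives local
  Lipschitz continuity.\<close>

lemma nash_U_bounds:
  assumes x: "M < x" and xy: "x \<le> y"
  shows "(y - x) / \<phi> y \<le> nash_U \<phi> x - nash_U \<phi> y" "nash_U \<phi> x - nash_U \<phi> y \<le> (y - x) / \<phi> x"
proof -
  have const: "set_integrable lborel {x<..y} (\<lambda>u. k)" "(LINT u:{x<..y}|lborel. k) = k * (y - x)" for k :: real
    using xy by (auto simp: set_integrable_def set_lebesgue_integral_def)
  have "(LINT u:{x<..y}|lborel. 1 / \<phi> y) \<le> (LINT u:{x<..y}|lborel. 1 / \<phi> u)"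
    using x by (intro set_integral_mono const nash_U_diff[OF x xy] inverse_rate_le) auto
  then show "(y - x) / \<phi> y \<le> nash_U \<phi> x - nash_U \<phi> y" by (simp add: nash_U_diff[OF x xy] const)
  have "(LINT u:{x<..y}|lborel. 1 / \<phi> u) \<le> (LINT u:{x<..y}|lborel. 1 / \<phi> x)"
    using x by (intro set_integral_mono const nash_U_diff[OF x xy] inverse_rate_le) auto
  then show "nash_U \<phi> x - nash_U \<phi> y \<le> (y - x) / \<phi> x" by (simp add: nash_U_diff[OF x xy] const)
qed

lemma nash_U_strict_antimono: "M < x \<Longrightarrow> x < y \<Longrightarrow> nash_U \<phi> y < nash_U \<phi> x"
  using nash_U_bounds(1)[of x y] rate_pos[of y] divide_pos_pos[of "y - x" "\<phi> y"] by linarith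

lemma nash_U_antimono: "M < x \<Longrightarrow> x \<le> y \<Longrightarrow> nash_U \<phi> y \<le> nash_U \<phi> x"
  using nash_U_strict_antimono[of x y] by (cases "x = y") auto

lemma nash_U_nonneg: "M < x \<Longrightarrow> 0 \<le> nash_U \<phi> x"
  unfolding nash_U_def set_lebesgue_integral_def
  by (intro integral_nonneg_AE) (auto simp: indicator_def intro!: less_imp_le[OF rate_pos])

section \<open>Inverting \<open>U\<close>\<close>

lemma inj_on_nash_U: "inj_on (nash_U \<phi>) {M<..}"
  using nash_U_strict_antimono by (intro linorder_inj_onI) (auto simp: order_less_imp_not_eq2)

lemma nash_U_tendsto_0: "(\<lambda>n. nash_U \<phi> (M + 1 + real n)) \<longlonglongrightarrow> 0"
proof -
  have "(\<lambda>n. LINT u|lborel. indicator {M + 1 + real n<..} u *\<^sub>R (1 / \<phi> u)) \<longlonglongrightarrow> (LINT u::real|lborel. (0::real))"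
  proof (rule integral_dominated_convergence)
    have int: "integrable lborel (\<lambda>u. indicator {M + 1<..} u *\<^sub>R (1 / \<phi> u))"
      using set_integrable_inverse_rate[of "M + 1"] by (simp add: set_integrable_def)
    then show "integrable lborel (\<lambda>u. \<bar>indicator {M + 1<..} u *\<^sub>R (1 / \<phi> u)\<bar>)" by (rule integrable_abs)
    show "(\<lambda>u. indicator {M + 1 + real n<..} u *\<^sub>R (1 / \<phi> u)) \<in> borel_measurable lborel" for n
      using set_integrable_inverse_rate[of "M + 1 + real n"]
      by (auto simp: set_integrable_def dest: borel_measurable_integrable)
    show "AE u in lborel. (\<lambda>n. indicator {M + 1 + real n<..} u *\<^sub>R (1 / \<phi> u)) \<longlonglongrightarrow> 0"
    proof (rule AE_I2)
      fix u
      have "eventually (\<lambda>n. indicator {M + 1 + real n<..} u *\<^sub>R (1 / \<phi> u) = 0) sequentially"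
        using eventually_ge_at_top[of "nat \<lceil>u - M\<rceil>"]
      proof eventually_elim
        case (elim n)
        then have "u \<le> M + 1 + real n" by linarith
        then show ?case by simp
      qed
      then show "(\<lambda>n. indicator {M + 1 + real n<..} u *\<^sub>R (1 / \<phi> u)) \<longlonglongrightarrow> 0"
        by (rule tendsto_eventually)
    qed
  qed (auto simp: indicator_def)
  then show ?thesis by (simp add: nash_U_def set_lebesgue_integral_def)
qed

lemma nash_U_continuous_on:
  assumes "M < a" shows "continuous_on {a..b} (nash_U \<phi>)"
proof -
  have le: "\<bar>nash_U \<phi> x - nash_U \<phi> y\<bar> \<le> 1 / \<phi> a * \<bar>x - y\<bar>" if "a \<le> x" "x \<le> y" for x y
  proof -
    have "nash_U \<phi> x - nash_U \<phi> y \<le> (y - x) / \<phi> x"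
      using assms that by (intro nash_U_bounds) auto
    also have "\<dots> = (y - x) * (1 / \<phi> x)" by simp
    also have "\<dots> \<le> (y - x) * (1 / \<phi> a)"
      using assms that by (intro mult_left_mono inverse_rate_le) auto
    finally show ?thesis using nash_U_antimono[of x y] assms that by (simp add: mult.commute)
  qed
  have "(1 / \<phi> a)-lipschitz_on {a..b} (nash_U \<phi>)"
  proof (rule lipschitz_onI)
    fix x y assume "x \<in> {a..b}" "y \<in> {a..b}"
    then show "dist (nash_U \<phi> x) (nash_U \<phi> y) \<le> 1 / \<phi> a * dist x y"
      using le[of x y] le[of y x] by (cases "x \<le> y") (auto simp: dist_real_def abs_minus_commute)
  qed (use rate_pos[OF assms] in simp)
  then show ?thesis by (rule lipschitz_on_continuous_on)
qed

lemma nash_U_lim_SUP: "nash_U_lim M \<phi> = (SUP x\<in>{M<..}. ereal (nash_U \<phi> x))"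
  unfolding nash_U_lim_def
proof (rule tendsto_Lim)
  show "((\<lambda>x. ereal (nash_U \<phi> x)) \<longlongrightarrow> (SUP x\<in>{M<..}. ereal (nash_U \<phi> x))) (at_right M)"
  proof (rule increasing_tendsto)
    show "eventually (\<lambda>x. ereal (nash_U \<phi> x) \<le> (SUP x\<in>{M<..}. ereal (nash_U \<phi> x))) (at_right M)"
      using eventually_at_right_less[of M] by eventually_elim (auto intro: SUP_upper)
    fix z assume "z < (SUP x\<in>{M<..}. ereal (nash_U \<phi> x))"
    then obtain x where x: "M < x" "z < ereal (nash_U \<phi> x)" by (auto simp: less_SUP_iff)
    have "eventually (\<lambda>y. M < y \<and> y < x) (at_right M)"
      using x(1) by (intro eventually_at_rightI) auto
    then show "eventually (\<lambda>y. z < ereal (nash_U \<phi> y)) (at_right M)"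
    proof eventually_elim
      case (elim y)
      then have "nash_U \<phi> x \<le> nash_U \<phi> y" by (intro nash_U_antimono) auto
      then show ?case using x(2) less_le_trans by fastforce
    qed
  qed
qed simp

lemma nash_U_surj:
  assumes z: "0 < z" "ereal z < nash_U_lim M \<phi>"
  obtains y where "M < y" "nash_U \<phi> y = z"
proof -
  obtain a where a: "M < a" "z < nash_U \<phi> a"
    using z(2) by (auto simp: nash_U_lim_SUP less_SUP_iff)
  have "eventually (\<lambda>n. nash_U \<phi> (M + 1 + real n) < z) sequentially"
    using nash_U_tendsto_0 z(1) by (rule order_tendstoD)
  then obtain n where n: "nash_U \<phi> (M + 1 + real n) < z"
    by (auto simp: eventually_sequentially)
  define b where "b = M + 1 + real n"
  have ab: "a \<le> b"
  proof (rule ccontr)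
    assume "\<not> a \<le> b"
    then have "nash_U \<phi> a \<le> nash_U \<phi> b" by (intro nash_U_antimono) (auto simp: b_def)
    then show False using a n by (simp add: b_def)
  qed
  have "\<exists>y\<ge>a. y \<le> b \<and> nash_U \<phi> y = z"
    using a n ab nash_U_continuous_on[OF a(1)] by (intro IVT2') (auto simp: b_def)
  then obtain y where "a \<le> y" "nash_U \<phi> y = z" by blast
  then show thesis using that[of y] a(1) by auto
qed

text \<open>Gives access to \<open>nash_K\<close> without \<open>the_inv_into\<close>: the point
  \<open>y\<close> exists because \<open>U\<close> is continuous, tends to 0 at infinity and exceeds
  \<open>z\<close> near \<open>M\<close>.\<close>

lemma nash_K_cases:
  assumes "0 < z"
  obtains y where "M < y" "nash_U \<phi> y = z" "nash_K M \<phi> z = sqrt y"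
  | "nash_U_lim M \<phi> \<le> ereal z" "nash_K M \<phi> z = sqrt M"
proof (cases "ereal z < nash_U_lim M \<phi>")
  case True
  then obtain y where y: "M < y" "nash_U \<phi> y = z" using nash_U_surj assms by blast
  then have "the_inv_into {M<..} (nash_U \<phi>) z = y"
    using the_inv_into_f_f[OF inj_on_nash_U, of y] by simp
  then show thesis using that(1) y True by (simp add: nash_K_def)
qed (use that(2) in \<open>simp add: nash_K_def\<close>)

lemma nash_K_nonneg: "0 < z \<Longrightarrow> 0 \<le> nash_K M \<phi> z"
  by (rule nash_K_cases[of z]) (use M_nonneg in auto)

text \<open>Below \<open>U(M)\<close> the bound is strict antitonicity of \<open>U\<close>. From
  \<open>U(M)\<close> on, no \<open>h\<close> above \<open>M\<close> can satisfy the hypothesis, so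
  \<open>h \<le> M\<close>. The hypothesis is conditional because \<open>U\<close> has its meaning
  only above \<open>M\<close>.\<close>

lemma le_nash_K_sq:
  assumes z: "0 < z" and h: "M < h \<Longrightarrow> z \<le> nash_U \<phi> h"
  shows "h \<le> (nash_K M \<phi> z)\<^sup>2"
  using z
proof (cases rule: nash_K_cases)
  case (1 y)
  have "h \<le> y"
    using h nash_U_strict_antimono[OF 1(1), of h] 1 by (cases "h \<le> y") auto
  then show ?thesis using 1 M_nonneg by simp
next
  case 2
  have "h \<le> M"
  proof (rule ccontr)
    assume "\<not> h \<le> M"
    then have Mh: "M < h" by simp
    \<comment> \<open>A point strictly between \<open>M\<close> and \<open>h\<close> turns
      \<open>z \<le> U(h)\<close> into a strict inequality, which contradicts
      \<open>U(M) \<le> z\<close>.\<close>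
    define k where "k = (M + h) / 2"
    have k: "M < k" "k < h" using Mh by (auto simp: k_def)
    have "z < nash_U \<phi> k" using h[OF Mh] nash_U_strict_antimono[OF k] by simp
    moreover have "ereal (nash_U \<phi> k) \<le> nash_U_lim M \<phi>"
      unfolding nash_U_lim_SUP using k by (intro SUP_upper) auto
    ultimately show False using 2(1) by (meson ereal_less_eq(3) leD order_trans)
  qed
  then show ?thesis using 2 M_nonneg by simp
qed

end

section \<open>Decay of the semigroup\<close>

context symmetric_markov_semigroup
begin

section \<open>The Dirichlet form on the domain of the generator\<close>

lemma gen_generator: "f \<in> generator_domain \<mu> \<kappa> \<Longrightarrow> hilb.gen f (generator \<mu> \<kappa> f)"
  unfolding gen_iff generator_domain_def generator_def mem_Collect_eq
  by (rule someI_ex[of "is_generator_image \<mu> \<kappa> f"])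

lemma gen_generator_domain: "hilb.gen f g \<Longrightarrow> f \<in> generator_domain \<mu> \<kappa>"
  unfolding gen_iff generator_domain_def by blast

lemma pre_dirichlet_eq:
  assumes "hilb.gen f g" shows "pre_dirichlet \<mu> \<kappa> f = - ip f g"
proof -
  have g: "hilb.gen f (generator \<mu> \<kappa> f)"
    using assms by (intro gen_generator gen_generator_domain)
  have "ip f (generator \<mu> \<kappa> f) = ip f g"
    using hilb.gen_unique[OF g assms] hilb.genD[OF g] hilb.genD[OF assms] by (intro hilb.null_diff_ip)
  then show ?thesis by (simp add: pre_dirichlet_def L2_inner_def)
qed

text \<open>The constant sequence is an admissible approximation. Closability shows that every other
  one gives the same limit, which is the uniqueness that the definite description in
  \<open>dirichlet_form\<close> requires.\<close>

lemma dirichlet_form_generator: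
  assumes f: "hilb.gen f g"
  shows "f \<in> dirichlet_domain \<mu> \<kappa>" "dirichlet_form \<mu> \<kappa> f = - ip f g"
proof -
  have zero: "hilb.gen 0 0" using hilb.gen_diff[OF f f] by simp
  have const: "dirichlet_approx \<mu> \<kappa> f (\<lambda>_. f)"
    using gen_generator_domain[OF f] pre_dirichlet_eq[OF zero]
    by (simp add: dirichlet_approx_def L2_norm_def L2_inner_def zero_fun_def)
  then show "f \<in> dirichlet_domain \<mu> \<kappa>" using hilb.genD[OF f] by (auto simp: dirichlet_domain_def)
  have lim: "(\<lambda>n. pre_dirichlet \<mu> \<kappa> (u n)) \<longlonglongrightarrow> - ip f g" if u: "dirichlet_approx \<mu> \<kappa> f u" for u
  proof -
    have gu: "hilb.gen (u n) (generator \<mu> \<kappa> (u n))" for n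
      using u by (intro gen_generator) (simp add: dirichlet_approx_def)
    have "(\<lambda>n. - ip (u n) (generator \<mu> \<kappa> (u n))) \<longlonglongrightarrow> - ip f g"
    proof (rule hilb.form_closable[OF f gu])
      show "(\<lambda>n. hilb.nrm (u n - f)) \<longlonglongrightarrow> 0"
        using u by (simp add: dirichlet_approx_def L2_nrm fun_diff_def)
      fix e :: real assume "0 < e"
      then obtain N where "\<And>m n. m \<ge> N \<Longrightarrow> n \<ge> N \<Longrightarrow> pre_dirichlet \<mu> \<kappa> (\<lambda>x. u m x - u n x) < e"
        using u unfolding dirichlet_approx_def by blast
      moreover have "pre_dirichlet \<mu> \<kappa> (\<lambda>x. u m x - u n x)
          = - ip (u m - u n) (generator \<mu> \<kappa> (u m) - generator \<mu> \<kappa> (u n))" for m n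
        using pre_dirichlet_eq[OF hilb.gen_diff[OF gu gu], of m n] by (simp add: fun_diff_def)
      ultimately show "\<exists>N. \<forall>m\<ge>N. \<forall>n\<ge>N.
          - ip (u m - u n) (generator \<mu> \<kappa> (u m) - generator \<mu> \<kappa> (u n)) < e" by auto
    qed
    then show ?thesis by (simp add: pre_dirichlet_eq[OF gu])
  qed
  show "dirichlet_form \<mu> \<kappa> f = - ip f g"
    unfolding dirichlet_form_def
  proof (rule the_equality)
    show "\<exists>u. dirichlet_approx \<mu> \<kappa> f u \<and> (\<lambda>n. pre_dirichlet \<mu> \<kappa> (u n)) \<longlonglongrightarrow> - ip f g"
      using const lim by blast
  qed (use lim LIMSEQ_unique in blast)
qed

section \<open>Positivity and order\<close>

lemma kernel_op_nonneg: "(\<And>x. 0 \<le> f x) \<Longrightarrow> 0 \<le> P t f x"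
  by (simp add: kernel_op_def)

lemma abs_kernel_op_le: "\<bar>P t f x\<bar> \<le> P t (\<lambda>y. \<bar>f y\<bar>) x"
  unfolding kernel_op_def by (rule integral_abs_bound)

lemma L2_inner_mono:
  assumes "f \<in> L2" "g \<in> L2" "h \<in> L2"
    and "\<And>x. x \<in> space \<mu> \<Longrightarrow> 0 \<le> f x" "AE x in \<mu>. g x \<le> h x"
  shows "ip f g \<le> ip f h"
proof -
  have "AE x in \<mu>. f x * g x \<le> f x * h x"
    using assms(5) AE_space by eventually_elim (use assms(4) in \<open>auto intro: mult_left_mono\<close>)
  then show ?thesis
    unfolding L2_inner_def using assms by (intro integral_mono_AE L2_space_mult_integrable)
qed

text \<open>The test function is the positive part of \<open>u - v\<close>: its squared norm equals
  \<open>ip g u - ip g v\<close>, which is at most 0.\<close>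

lemma AE_le_of_weak_le:
  assumes u: "u \<in> L2" and v: "v \<in> L2"
    and le: "\<And>g. g \<in> L2 \<Longrightarrow> (\<And>x. 0 \<le> g x) \<Longrightarrow> ip g u \<le> ip g v"
  shows "AE x in \<mu>. u x \<le> v x"
proof -
  define g where "g x = max 0 (u x - v x)" for x
  have uv: "u - v \<in> L2" using u v by simp
  have [measurable]: "u \<in> borel_measurable \<mu>" "v \<in> borel_measurable \<mu>" using u v by (auto dest: L2_spaceD)
  have g: "g \<in> L2"
    by (rule L2_space_bound[OF uv]) (auto simp: g_def[abs_def] fun_diff_def)
  have "(\<integral>x. (g x)\<^sup>2 \<partial>\<mu>) = ip g (u - v)"
    unfolding L2_inner_def by (intro Bochner_Integration.integral_cong) (auto simp: g_def power2_eq_square max_def)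
  also have "\<dots> = ip g u - ip g v" using g u v by (simp add: hilb.ip_diff_right)
  also have "\<dots> \<le> 0" using le[OF g] by (simp add: g_def)
  finally have "(\<integral>x. (g x)\<^sup>2 \<partial>\<mu>) \<le> 0" .
  moreover have "0 \<le> (\<integral>x. (g x)\<^sup>2 \<partial>\<mu>)" by (intro Bochner_Integration.integral_nonneg) auto
  ultimately have "(\<integral>x. (g x)\<^sup>2 \<partial>\<mu>) = 0" by simp
  then have "AE x in \<mu>. (g x)\<^sup>2 = 0"
    using integral_nonneg_eq_0_iff_AE[OF L2_spaceD(2)[OF g]] by simp
  then show ?thesis by eventually_elim (auto simp: g_def max_def split: if_splits)
qed

end

locale nash_lyapunov = symmetric_markov_semigroup \<mu> \<kappa> + nash_rate M \<phi>
  for \<mu> :: "'a measure" and \<kappa> :: "real \<Rightarrow> 'a \<Rightarrow> 'a measure" and M :: real and \<phi> :: "real \<Rightarrow> real" +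
  fixes V :: "'a \<Rightarrow> real" and c :: real
  assumes V_L2: "V \<in> L2"
    and V_lyapunov: "lyapunov_function \<mu> \<kappa> V c"
    and c_nonneg: "0 \<le> c"
    and nash: "weighted_nash \<mu> \<kappa> V M \<phi>"
begin

section \<open>The weighted norm\<close>

definition wnorm :: "('a \<Rightarrow> real) \<Rightarrow> real" where
  "wnorm f = L1_norm \<mu> (\<lambda>x. f x * V x)"

lemma V_pos: "x \<in> space \<mu> \<Longrightarrow> 0 < V x"
  using V_lyapunov by (simp add: lyapunov_function_def)

lemma V_meas [measurable]: "V \<in> borel_measurable \<mu>"
  using V_L2 by (rule L2_spaceD)

text \<open>Positivity of \<open>V\<close> turns the weighted norm into an inner product, so that
  the symmetry of \<open>P t\<close> can be applied to it.\<close>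

lemma wnorm_eq: "wnorm f = ip (\<lambda>x. \<bar>f x\<bar>) V"
  unfolding wnorm_def L1_norm_def L2_inner_def
  by (intro Bochner_Integration.integral_cong) (simp_all add: abs_mult abs_of_pos[OF V_pos])

lemma wnorm_nonneg_fun: "(\<And>x. 0 \<le> f x) \<Longrightarrow> wnorm f = ip f V"
  by (simp add: wnorm_eq)

lemma wnorm_nonneg: "0 \<le> wnorm f"
  by (simp add: wnorm_def L1_norm_def)

lemma wnorm_le: "f \<in> L2 \<Longrightarrow> wnorm f \<le> L2_norm \<mu> f * L2_norm \<mu> V"
  using hilb.ip_le_nrm[OF L2_space_abs V_L2, of f] by (simp add: wnorm_eq L2_nrm) (simp add: L2_norm_def)

lemma wnorm_triangle:
  assumes "f \<in> L2" "g \<in> L2"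
  shows "wnorm g \<le> wnorm f + wnorm (g - f)"
proof -
  have d: "g - f \<in> L2" using assms by simp
  have S: "(\<lambda>x. \<bar>f x\<bar>) + (\<lambda>x. \<bar>(g - f) x\<bar>) \<in> L2"
    by (intro L2_space_add L2_space_abs assms d)
  have "wnorm g = ip V (\<lambda>x. \<bar>g x\<bar>)"
    unfolding wnorm_eq by (intro hilb.ip_commute L2_space_abs assms V_L2)
  also have "\<dots> \<le> ip V ((\<lambda>x. \<bar>f x\<bar>) + (\<lambda>x. \<bar>(g - f) x\<bar>))"
    by (rule L2_inner_mono[OF V_L2 L2_space_abs[OF assms(2)] S])
      (auto simp: plus_fun_def fun_diff_def intro: less_imp_le V_pos)
  also have "\<dots> = ip V (\<lambda>x. \<bar>f x\<bar>) + ip V (\<lambda>x. \<bar>(g - f) x\<bar>)"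
    by (intro hilb.ip_add_right L2_space_abs assms d V_L2)
  also have "ip V (\<lambda>x. \<bar>f x\<bar>) = wnorm f"
    unfolding wnorm_eq by (intro hilb.ip_commute L2_space_abs assms V_L2)
  also have "ip V (\<lambda>x. \<bar>(g - f) x\<bar>) = wnorm (g - f)"
    unfolding wnorm_eq by (intro hilb.ip_commute L2_space_abs d V_L2)
  finally show ?thesis .
qed

lemma wnorm_eq_0:
  assumes f: "f \<in> L2" and "wnorm f = 0" shows "L2_norm \<mu> f = 0"
proof -
  have int: "integrable \<mu> (\<lambda>x. \<bar>f x\<bar> * V x)" using L2_space_mult_integrable[OF L2_space_abs[OF f] V_L2] .
  have nonneg: "AE x in \<mu>. 0 \<le> \<bar>f x\<bar> * V x" by (intro AE_I2 mult_nonneg_nonneg less_imp_le[OF V_pos]) auto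
  have "AE x in \<mu>. \<bar>f x\<bar> * V x = 0"
    using assms(2) unfolding wnorm_eq L2_inner_def integral_nonneg_eq_0_iff_AE[OF int nonneg] .
  then have "AE x in \<mu>. f x = 0" using AE_space
    by eventually_elim (use V_pos in \<open>auto simp: order_less_imp_not_eq2\<close>)
  then show ?thesis using L2_norm_eq_0_iff[OF f] by simp
qed

text \<open>The function \<open>y s = ip (P s V) g\<close> has right derivative
  \<open>ip (P s ?L) g\<close>, which is the integral of \<open>?L\<close> against the nonnegative
  \<open>P s g\<close> and hence at most \<open>c * y s\<close>. So
  \<open>exp (- c * s) * y s\<close> does not increase.\<close>

lemma lyapunov_weak:
  assumes g: "g \<in> L2" "\<And>x. 0 \<le> g x" and t: "0 \<le> t"
  shows "ip g (P t V) \<le> exp (c * t) * ip g V"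
proof -
  let ?L = "generator \<mu> \<kappa> V"
  have gV: "hilb.gen V ?L" using V_lyapunov by (intro gen_generator) (simp add: lyapunov_function_def)
  have L: "?L \<in> L2" "AE x in \<mu>. ?L x \<le> c * V x"
    using hilb.genD[OF gV] V_lyapunov by (auto simp: lyapunov_function_def)
  define y where "y s = ip (P s V) g" for s
  define G where "G s = - (exp (- c * s) * y s)" for s
  have y_deriv: "\<exists>D. (y has_real_derivative D) (at_right s) \<and> D \<le> c * y s" if s: "0 \<le> s" for s
  proof (intro exI conjI)
    show "(y has_real_derivative ip (P s ?L) g) (at_right s)"
      unfolding y_def by (rule hilb.gen_right_derivative[OF gV g(1) s])
    let ?p = "P s g"
    have p: "?p \<in> L2" "\<And>x. 0 \<le> ?p x" using kernel_op_L2[OF s g(1)] kernel_op_nonneg g by auto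
    have "ip (P s ?L) g = ip ?p ?L"
      using s g p L by (simp add: hilb.ip_P hilb.ip_commute[of ?L])
    also have "\<dots> \<le> ip ?p (c *\<^sub>R V)"
      using L by (intro L2_inner_mono p L hilb.H_closed V_L2) (simp add: scaleR_fun_def)
    also have "\<dots> = c * y s"
      unfolding y_def using s g p V_L2 by (simp add: hilb.ip_scale_right hilb.ip_P hilb.ip_commute[of V])
    finally show "ip (P s ?L) g \<le> c * y s" .
  qed
  have "0 * t \<le> G t - G 0"
  proof (rule right_lower_derivative_growth[OF t])
    fix s e :: real assume s: "0 < s" and e: "0 < e"
    have "continuous_on {0..} G"
      unfolding G_def y_def by (intro continuous_intros hilb.continuous_on_ip_P V_L2 g)
    then have "isCont G s" using s by (intro continuous_on_interior) (auto simp: interior_real_atLeast)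
    then have "(G \<longlongrightarrow> G s) (at_left s)"
      using filterlim_at_split[of G "nhds (G s)" s] by (simp add: isCont_def)
    then have "eventually (\<lambda>r. G r < G s + e) (at_left s)" by (rule order_tendstoD) (use e in simp)
    then show "eventually (\<lambda>r. G r \<le> G s + e) (at_left s)" by (auto elim: eventually_mono)
  next
    fix s e :: real assume s: "0 \<le> s" and e: "0 < e"
    obtain D where D: "(y has_real_derivative D) (at_right s)" "D \<le> c * y s" using y_deriv[OF s] by blast
    have "(G has_real_derivative - (exp (- c * s) * (D - c * y s))) (at_right s)"
      unfolding G_def by (rule derivative_eq_intros D refl | simp add: algebra_simps)+
    moreover have "0 - e < - (exp (- c * s) * (D - c * y s))"
      using D(2) e mult_nonneg_nonpos[of "exp (- c * s)" "D - c * y s"] by simp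
    ultimately show "eventually (\<lambda>r. (0 - e) * (r - s) \<le> G r - G s) (at_right s)"
      by (rule right_derivative_eventually_ge)
  qed
  then have "exp (- c * t) * y t \<le> y 0" by (simp add: G_def)
  also have "y 0 = ip V g"
    unfolding y_def using hilb.P_zero[OF V_L2] V_L2 g kernel_op_L2[of 0 V]
    by (intro hilb.null_diff_ip) auto
  finally have "exp (c * t) * (exp (- c * t) * y t) \<le> exp (c * t) * ip V g"
    by (intro mult_left_mono) auto
  then have "y t \<le> exp (c * t) * ip V g" by (simp flip: mult.assoc exp_add)
  then show ?thesis
    using hilb.ip_commute[OF g(1) V_L2] hilb.ip_commute[OF g(1), of "P t V"] kernel_op_L2[OF t V_L2]
    by (simp add: y_def)
qed

text \<open>After \<open>\<bar>P t f\<bar> \<le> P t \<bar>f\<bar>\<close>, symmetry moves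
  \<open>P t\<close> to \<open>V\<close>, where the Lyapunov bound applies.\<close>

lemma wnorm_kernel_op:
  assumes f: "f \<in> L2" and t: "0 \<le> t"
  shows "wnorm (P t f) \<le> exp (c * t) * wnorm f"
proof -
  let ?a = "\<lambda>x. \<bar>f x\<bar>" and ?p = "\<lambda>x. \<bar>P t f x\<bar>"
  have a: "?a \<in> L2" "?p \<in> L2" "P t ?a \<in> L2"
    using f t by (auto intro!: kernel_op_L2(1) L2_space_abs)
  have "wnorm (P t f) = ip V ?p"
    using a V_L2 by (simp add: wnorm_eq hilb.ip_commute)
  also have "\<dots> \<le> ip V (P t ?a)"
    using a V_L2 V_pos abs_kernel_op_le by (intro L2_inner_mono) (auto intro: less_imp_le)
  also have "\<dots> = ip ?a (P t V)"
    using a V_L2 t by (simp add: hilb.ip_commute[of V] hilb.ip_P)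
  also have "\<dots> \<le> exp (c * t) * ip ?a V" using a t by (intro lyapunov_weak) auto
  finally show ?thesis by (simp add: wnorm_eq)
qed

text \<open>Along the semigroup the weighted norm is not known, only an upper bound \<open>N\<close>
  for it. Replacing the norm by \<open>N\<close> is legitimate since
  \<open>N^2 * \<phi> (w / N^2)\<close> equals \<open>w\<close> times \<open>\<phi> x / x\<close> at
  \<open>x = w / N^2\<close>, and this \<open>x\<close> decreases as \<open>N\<close> grows.\<close>

lemma nash_generator:
  assumes f: "hilb.gen f g" and N: "wnorm f \<le> N" "0 < N" and h: "M < (L2_norm \<mu> f)\<^sup>2 / N\<^sup>2"
  shows "N\<^sup>2 * \<phi> ((L2_norm \<mu> f)\<^sup>2 / N\<^sup>2) \<le> - ip f g"
proof -
  define w where "w = (L2_norm \<mu> f)\<^sup>2"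
  define n where "n = wnorm f"
  have fL: "f \<in> L2" using hilb.genD[OF f] by simp
  have h': "M < w / N\<^sup>2" using h by (simp add: w_def)
  have w_pos: "0 < w"
  proof -
    have "0 < w / N\<^sup>2" using h' M_nonneg by linarith
    then show ?thesis using N(2) by (simp add: zero_less_divide_iff)
  qed
  have n_pos: "0 < n"
    using wnorm_eq_0[OF fL] w_pos wnorm_nonneg[of f] by (cases "n = 0") (auto simp: n_def w_def)
  have n2: "0 < n\<^sup>2" "n\<^sup>2 \<le> N\<^sup>2" using n_pos N by (auto simp: n_def intro: power_mono)
  have le: "w / N\<^sup>2 \<le> w / n\<^sup>2" using n2 w_pos N by (intro divide_left_mono mult_pos_pos) auto
  have "M * n\<^sup>2 < w" using h' le n2 by (simp add: pos_less_divide_eq[symmetric])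
  then have "\<phi> (w / n\<^sup>2) \<le> dirichlet_form \<mu> \<kappa> f / n\<^sup>2"
    using nash dirichlet_form_generator(1)[OF f] L2_space_mult_integrable[OF fL V_L2]
    by (auto simp: weighted_nash_def w_def n_def wnorm_def)
  then have E: "n\<^sup>2 * \<phi> (w / n\<^sup>2) \<le> - ip f g"
    using mult_left_mono[of _ _ "n\<^sup>2"] n2 by (fastforce simp: dirichlet_form_generator(2)[OF f])
  have "N\<^sup>2 * \<phi> (w / N\<^sup>2) = w * (\<phi> (w / N\<^sup>2) / (w / N\<^sup>2))" using w_pos N by simp
  also have "\<dots> \<le> w * (\<phi> (w / n\<^sup>2) / (w / n\<^sup>2))"
    using w_pos h' le by (intro mult_left_mono rate_ratio_le) auto
  also have "\<dots> = n\<^sup>2 * \<phi> (w / n\<^sup>2)" using w_pos n_pos by simp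
  finally show ?thesis using E by (simp add: w_def)
qed

lemma L2_decay_generator:
  assumes f: "hilb.gen f g" and t: "0 < t"
  shows "(L2_norm \<mu> (P t f))\<^sup>2 \<le> (nash_K M \<phi> (2 * t))\<^sup>2 * exp (2 * c * t) * (wnorm f)\<^sup>2"
proof (cases "wnorm f = 0")
  case True
  have fL: "f \<in> L2" using hilb.genD[OF f] by simp
  have "L2_norm \<mu> (P t f) \<le> 0"
    using kernel_op_L2(2)[OF _ fL, of t] t wnorm_eq_0[OF fL True] by simp
  then have "L2_norm \<mu> (P t f) = 0"
    using hilb.nrm_nonneg[of "P t f"] kernel_op_L2(1)[OF _ fL, of t] t
    by (simp add: L2_nrm del: hilb.nrm_nonneg)
  then show ?thesis by simp
next
  case False
  define N0 where "N0 = wnorm f"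
  have N0: "0 < N0" using False wnorm_nonneg[of f] by (simp add: N0_def)
  have fL: "f \<in> L2" "g \<in> L2" using hilb.genD[OF f] by auto
  \<comment> \<open>The squared norm of \<open>P s f\<close>, written so that it is linear in the
    semigroup and \<open>gen_right_derivative\<close> applies.\<close>
  define w where "w s = ip (P (2 * s) f) f" for s
  have w: "w s = (L2_norm \<mu> (P s f))\<^sup>2" if "0 \<le> s" for s
    using hilb.nrm_P_sq[OF that fL(1)] by (simp add: w_def L2_nrm)
  \<comment> \<open>The denominator is the square of the Lyapunov bound
    \<open>exp (c * s) * N0\<close>, not of the weighted norm itself, so that \<open>h\<close> has
    an explicit right derivative; \<open>nash_generator\<close> accepts this bound.\<close>
  define h where "h s = exp (- (2 * c * s)) * w s / N0\<^sup>2" for s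
  have h_eq: "h s = (L2_norm \<mu> (P s f))\<^sup>2 / (exp (c * s) * N0)\<^sup>2" if "0 \<le> s" for s
    using w[OF that] by (simp add: h_def power_mult_distrib exp_minus field_simps flip: exp_double)
  have h_deriv: "\<exists>D. (h has_real_derivative D) (at_right s) \<and> (M < h s \<longrightarrow> D \<le> - 2 * \<phi> (h s))"
    if s: "0 \<le> s" for s
  proof (intro exI conjI impI)
    define w' where "w' = ip (P (2 * s) g) f"
    have "((\<lambda>u. ip (P u f) f) has_real_derivative w')
        (at (2 * s) within (\<lambda>r. 2 * r) ` {s<..})"
      unfolding w'_def using s
      by (intro DERIV_subset[OF hilb.gen_right_derivative[OF f fL(1), of "2 * s"]]) auto
    then have "((\<lambda>u. ip (P u f) f) \<circ> (\<lambda>r. 2 * r) has_real_derivative w' * 2) (at_right s)"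
      by (rule DERIV_image_chain) (auto intro!: derivative_eq_intros)
    then have w_deriv: "(w has_real_derivative w' * 2) (at_right s)" by (simp add: o_def w_def[abs_def])
    show "(h has_real_derivative exp (- (2 * c * s)) * (2 * w' - 2 * c * w s) / N0\<^sup>2) (at_right s)"
    proof -
      have "((\<lambda>r. exp (- (2 * c * r))) has_real_derivative exp (- (2 * c * s)) * - (2 * c)) (at_right s)"
        by (auto intro!: derivative_eq_intros)
      note deriv = DERIV_cdivide[OF DERIV_mult'[OF this w_deriv], of "N0\<^sup>2"]
      have "exp (- (2 * c * s)) * (w' * 2) + exp (- (2 * c * s)) * - (2 * c) * w s
          = exp (- (2 * c * s)) * (2 * w' - 2 * c * w s)" by (simp add: algebra_simps)
      with deriv show ?thesis by (simp only: h_def[abs_def])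
    qed
    assume Mh: "M < h s"
    let ?N = "exp (c * s) * N0"
    have "?N\<^sup>2 * \<phi> (h s) \<le> - ip (P s f) (P s g)"
      unfolding h_eq[OF s]
      by (rule nash_generator[OF hilb.gen_P[OF f s]])
        (use wnorm_kernel_op[OF fL(1) s] N0 Mh h_eq[OF s] in \<open>auto simp: N0_def\<close>)
    also have "ip (P s f) (P s g) = w'"
      unfolding w'_def using s fL hilb.ip_P[of s f "P s g"] hilb.ip_P_P[of s s g f]
        hilb.ip_commute[OF fL(1), of "P s (P s g)"]
      by simp
    finally have "exp (2 * c * s) * N0\<^sup>2 * \<phi> (h s) \<le> - w'"
      by (simp add: power_mult_distrib mult.assoc flip: exp_double)
    then have "exp (- (2 * c * s)) * (exp (2 * c * s) * N0\<^sup>2 * \<phi> (h s)) \<le> exp (- (2 * c * s)) * - w'"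
      by (intro mult_left_mono) auto
    then have le: "N0\<^sup>2 * \<phi> (h s) \<le> - (exp (- (2 * c * s)) * w')"
      by (simp add: exp_minus field_simps)
    \<comment> \<open>This term stems from differentiating the exponential; since
      \<open>0 \<le> c\<close> it has the favourable sign and is dropped.\<close>
    have "0 \<le> exp (- (2 * c * s)) * (2 * c * w s)" using c_nonneg w[OF s] by simp
    moreover have "exp (- (2 * c * s)) * (2 * w' - 2 * c * w s)
        = 2 * (exp (- (2 * c * s)) * w') - exp (- (2 * c * s)) * (2 * c * w s)" by (simp add: algebra_simps)
    ultimately have "exp (- (2 * c * s)) * (2 * w' - 2 * c * w s) \<le> - 2 * (N0\<^sup>2 * \<phi> (h s))"
      using le by linarith
    then show "exp (- (2 * c * s)) * (2 * w' - 2 * c * w s) / N0\<^sup>2 \<le> - 2 * \<phi> (h s)"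
      using N0 by (simp add: pos_divide_le_eq mult_ac)
  qed
  have h_anti: "h r \<le> h s" if sr: "0 \<le> s" "s \<le> r" for s r
  proof -
    have "L2_norm \<mu> (P r f) = L2_norm \<mu> (P (r - s) (P s f))"
      using hilb.null_diff_nrm[OF hilb.P_add[of s "r - s" f]] sr fL by (simp add: L2_nrm)
    also have "\<dots> \<le> L2_norm \<mu> (P s f)" using sr fL by (intro kernel_op_L2) auto
    finally have "w r \<le> w s" using sr by (simp add: w power_mono L2_norm_def)
    then have "exp (- (2 * c * r)) * w r \<le> exp (- (2 * c * s)) * w s"
      using sr c_nonneg w[of r] by (intro mult_mono) (auto intro!: mult_left_mono)
    then show ?thesis using N0 by (simp add: h_def divide_right_mono)
  qed
  have "h t \<le> (nash_K M \<phi> (2 * t))\<^sup>2"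
  proof (rule le_nash_K_sq)
    assume Mt: "M < h t"
    \<comment> \<open>As \<open>h\<close> does not increase, \<open>M < h t\<close> keeps
      \<open>h\<close> in the range of the Nash inequality throughout \<open>{0..t}\<close>. The
      same monotonicity supplies the left condition for \<open>U\<close> composed with
      \<open>h\<close> in the growth argument with slope 2.\<close>
    have Mh: "M < h s" if "0 \<le> s" "s \<le> t" for s using h_anti[OF that] Mt by simp
    have "2 * t \<le> nash_U \<phi> (h t) - nash_U \<phi> (h 0)"
    proof (rule right_lower_derivative_growth)
      fix s e :: real assume s: "0 < s" "s \<le> t" and e: "0 < e"
      have "eventually (\<lambda>r. 0 < r \<and> r < s) (at_left s)"
        using s by (intro eventually_at_leftI) auto
      then show "eventually (\<lambda>r. nash_U \<phi> (h r) \<le> nash_U \<phi> (h s) + e) (at_left s)"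
      proof eventually_elim
        case (elim r)
        then have "nash_U \<phi> (h r) \<le> nash_U \<phi> (h s)"
          using s by (intro nash_U_antimono Mh h_anti) auto
        then show ?case using e by simp
      qed
    next
      fix s e :: real assume s: "0 \<le> s" "s < t" and e: "0 < e"
      have Ms: "M < h s" using s by (intro Mh) auto
      note pos = rate_pos[OF Ms]
      obtain D where D: "(h has_real_derivative D) (at_right s)" "D \<le> - 2 * \<phi> (h s)"
        using h_deriv[OF s(1)] Ms by blast
      have "((\<lambda>r. - h r) has_real_derivative - D) (at_right s)" using D(1) by (rule DERIV_minus)
      moreover have "(2 - e) * \<phi> (h s) < - D"
      proof -
        have "0 < e * \<phi> (h s)" using e pos by simp
        then show ?thesis using D(2) by (simp add: left_diff_distrib)
      qed
      ultimately have "eventually (\<lambda>r. (2 - e) * \<phi> (h s) * (r - s) \<le> - h r - - h s) (at_right s)"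
        by (rule right_derivative_eventually_ge)
      moreover have "eventually (\<lambda>r. s < r \<and> r < t) (at_right s)"
        using s by (intro eventually_at_rightI) auto
      ultimately show "eventually (\<lambda>r. (2 - e) * (r - s) \<le> nash_U \<phi> (h r) - nash_U \<phi> (h s)) (at_right s)"
      proof eventually_elim
        case (elim r)
        have "(2 - e) * (r - s) \<le> (h s - h r) / \<phi> (h s)"
          using elim pos by (simp add: pos_le_divide_eq mult_ac)
        also have "\<dots> \<le> nash_U \<phi> (h r) - nash_U \<phi> (h s)"
          using s elim by (intro nash_U_bounds Mh h_anti) auto
        finally show ?case .
      qed
    qed (use t in simp)
    then show "2 * t \<le> nash_U \<phi> (h t)" using nash_U_nonneg[OF Mh[of 0]] t by simp
  qed (use t in simp)
  then show ?thesis
    using t N0 by (simp add: h_eq pos_divide_le_eq power_mult_distrib N0_def mult_ac flip: exp_double)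
qed

text \<open>Both sides are continuous in the L2 norm, the right one because \<open>wnorm\<close> is
  bounded by the product of the L2 norms with \<open>V\<close>; the domain of the generator is
  dense.\<close>

lemma L2_decay:
  assumes f: "f \<in> L2" and t: "0 < t"
  shows "L2_norm \<mu> (P t f) \<le> nash_K M \<phi> (2 * t) * exp (c * t) * wnorm f"
proof -
  define C where "C = nash_K M \<phi> (2 * t) * exp (c * t)"
  have C: "0 \<le> C" using nash_K_nonneg[of "2 * t"] t by (simp add: C_def)
  have gen_case: "L2_norm \<mu> (P t y) \<le> C * wnorm y" if y: "hilb.gen y g" for y g
  proof (rule power2_le_imp_le)
    show "(L2_norm \<mu> (P t y))\<^sup>2 \<le> (C * wnorm y)\<^sup>2"
      using L2_decay_generator[OF y t] by (simp add: C_def power_mult_distrib mult.assoc flip: exp_double)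
  qed (use C wnorm_nonneg in simp)
  have "L2_norm \<mu> (P t f) \<le> C * wnorm f"
  proof (rule field_le_epsilon)
    fix d :: real assume d: "0 < d"
    \<comment> \<open>Total factor of the approximation error: \<open>C * L2_norm \<mu> V\<close>
      from the weighted norm and 1 from the contraction \<open>P t\<close>.\<close>
    define b where "b = C * L2_norm \<mu> V + 1"
    have b: "0 < b" using C hilb.nrm_nonneg[OF V_L2] by (simp add: b_def L2_nrm add_nonneg_pos)
    obtain y g where y: "hilb.gen y g" "hilb.nrm (y - f) \<le> d / b"
      using hilb.gen_dense[OF f, of "d / b"] b d by auto
    have yL: "y \<in> L2" using hilb.genD[OF y(1)] by simp
    have "L2_norm \<mu> (P t f) \<le> L2_norm \<mu> (P t y) + hilb.nrm (P t f - P t y)"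
      using hilb.nrm_triangle_sub[of "P t f" "P t y"] f yL t by (simp add: L2_nrm)
    also have "hilb.nrm (P t f - P t y) \<le> hilb.nrm (y - f)"
      using hilb.symmetric_op_nrm_diff[OF hilb.P_sym, of t f y] hilb.P_contr[of t "f - y"] f yL t
        hilb.nrm_commute[OF f yL] by (simp del: minus_apply)
    also have "L2_norm \<mu> (P t y) \<le> C * (wnorm f + hilb.nrm (y - f) * L2_norm \<mu> V)"
    proof -
      have "wnorm y \<le> wnorm f + hilb.nrm (y - f) * L2_norm \<mu> V"
        using wnorm_triangle[OF f yL] wnorm_le[of "y - f"] f yL by (simp add: L2_nrm del: minus_apply)
      then have "C * wnorm y \<le> C * (wnorm f + hilb.nrm (y - f) * L2_norm \<mu> V)"
        using C by (rule mult_left_mono)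
      with gen_case[OF y(1)] show ?thesis by (rule order_trans)
    qed
    finally have "L2_norm \<mu> (P t f)
        \<le> C * (wnorm f + hilb.nrm (y - f) * L2_norm \<mu> V) + hilb.nrm (y - f)"
      by (simp add: fun_diff_def)
    also have "\<dots> = C * wnorm f + b * hilb.nrm (y - f)"
      by (simp add: b_def algebra_simps)
    also have "\<dots> \<le> C * wnorm f + b * (d / b)" using y(2) b by (intro add_left_mono mult_left_mono) auto
    finally show "L2_norm \<mu> (P t f) \<le> C * wnorm f + d" using b by simp
  qed
  then show ?thesis by (simp add: C_def)
qed

section \<open>Duality and pointwise bounds\<close>

definition bnd :: "real \<Rightarrow> real" where
  "bnd t = nash_K M \<phi> (2 * t) * exp (c * t)"

lemma bnd_nonneg: "0 < t \<Longrightarrow> 0 \<le> bnd t"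
  using nash_K_nonneg[of "2 * t"] by (simp add: bnd_def)

lemma bnd_sq: "(bnd t)\<^sup>2 = (nash_K M \<phi> (2 * t))\<^sup>2 * exp (2 * c * t)"
  by (simp add: bnd_def power_mult_distrib mult.assoc flip: exp_double)

lemma weak_L2_bound:
  assumes f: "f \<in> L2" and g: "g \<in> L2" and t: "0 < t"
  shows "ip g (P t f) \<le> bnd t * wnorm g * L2_norm \<mu> f"
proof -
  have "ip g (P t f) = ip (P t g) f"
    using f g t symmetric by simp
  also have "\<dots> \<le> L2_norm \<mu> (P t g) * L2_norm \<mu> f"
    using hilb.ip_le_nrm[of "P t g" f] f g t by (simp add: L2_nrm)
  also have "\<dots> \<le> bnd t * wnorm g * L2_norm \<mu> f"
    using L2_decay[OF g t] hilb.nrm_nonneg[OF f] by (intro mult_right_mono) (auto simp: bnd_def L2_nrm)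
  finally show ?thesis .
qed

text \<open>For nonnegative \<open>g\<close> the weighted norm is \<open>ip g V\<close>, so the dual
  bound compares \<open>P t f\<close> with a multiple of \<open>V\<close> against all such
  \<open>g\<close>. Applying this to \<open>f\<close> and \<open>- f\<close> bounds the absolute
  value.\<close>

lemma AE_le_weighted:
  assumes f: "f \<in> L2" and t: "0 < t"
  shows "AE x in \<mu>. \<bar>P t f x\<bar> \<le> bnd t * L2_norm \<mu> f * V x"
proof -
  have one: "AE x in \<mu>. P t f x \<le> ((bnd t * L2_norm \<mu> f) *\<^sub>R V) x" if f: "f \<in> L2" for f
  proof (rule AE_le_of_weak_le)
    fix g assume g: "g \<in> L2" "\<And>x. 0 \<le> g x"
    show "ip g (P t f) \<le> ip g ((bnd t * L2_norm \<mu> f) *\<^sub>R V)"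
      using weak_L2_bound[OF f g(1) t] g V_L2 by (simp add: wnorm_nonneg_fun hilb.ip_scale_right mult_ac)
  qed (use f t V_L2 in auto)
  have "P t (- f) x = - P t f x" for x
    by (simp add: kernel_op_def fun_Compl_def)
  moreover have "L2_norm \<mu> (- f) = L2_norm \<mu> f" using hilb.nrm_minus[OF f] by (simp add: L2_nrm)
  ultimately have "AE x in \<mu>. - P t f x \<le> ((bnd t * L2_norm \<mu> f) *\<^sub>R V) x"
    using one[of "- f"] f by simp
  with one[OF f] show ?thesis by eventually_elim (simp add: scaleR_fun_def abs_le_iff)
qed

lemma AE_double_le_weighted:
  assumes f: "f \<in> L2" and t: "0 < t"
  shows "AE x in \<mu>. \<bar>P (2 * t) f x\<bar> \<le> (bnd t)\<^sup>2 * wnorm f * V x"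
proof -
  let ?p = "P t f"
  have p: "?p \<in> L2" using f t by simp
  have "hilb.nrm (P t ?p - P (2 * t) f) = 0"
    using hilb.P_add[of t t f] f t by simp
  moreover have "P t ?p - P (2 * t) f \<in> L2"
    using f p t by (intro hilb.H_closed hilb.P_in) auto
  ultimately have "AE x in \<mu>. P t ?p x = P (2 * t) f x"
    using L2_norm_eq_0_iff by (fastforce simp: L2_nrm)
  then show ?thesis using AE_le_weighted[OF p t] AE_space
  proof eventually_elim
    case (elim x)
    have "bnd t * L2_norm \<mu> ?p * V x \<le> bnd t * (bnd t * wnorm f) * V x"
      using L2_decay[OF f t] bnd_nonneg[OF t] V_pos[OF elim(3)]
      by (intro mult_right_mono mult_left_mono) (auto simp: bnd_def)
    then show ?case using elim by (simp add: power2_eq_square mult.assoc)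
  qed
qed

end

section \<open>Hilbert-Schmidt property and spectrum\<close>

lemma (in semi_hilbert) nrm_orthonormal_sum:
  assumes F: "orthonormal F" "finite F"
  shows "(nrm (\<Sum>e\<in>F. a e *\<^sub>R e))\<^sup>2 = (\<Sum>e\<in>F. (a e)\<^sup>2)"
proof -
  define s where "s = (\<Sum>e\<in>F. a e *\<^sub>R e)"
  note FH = orthonormalD(1)[OF F(1)]
  have s: "s \<in> H" using FH by (auto simp: s_def)
  have ip_s: "ip s w = (\<Sum>e\<in>F. a e * ip e w)" if "w \<in> H" for w
    unfolding s_def using FH that by (subst ip_sum) (auto simp: ip_scale)
  have coeff: "ip s e = a e" if e: "e \<in> F" for e
  proof -
    have "ip s e = (\<Sum>e'\<in>F. if e' = e then a e' else 0)"
      using ip_s[OF FH[OF e]] orthonormalD(2)[OF F(1) _ e] by (simp add: if_distrib cong: sum.cong if_cong)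
    then show ?thesis using e F(2) by simp
  qed
  have "ip s s = (\<Sum>e\<in>F. a e * ip e s)" by (rule ip_s[OF s])
  also have "\<dots> = (\<Sum>e\<in>F. (a e)\<^sup>2)"
    using coeff FH s by (intro sum.cong) (auto simp: power2_eq_square ip_commute[of _ s])
  finally show ?thesis using nrm_sq[OF s] by (simp add: s_def)
qed

lemma sum_scaleR_apply:
  fixes F :: "('a \<Rightarrow> real) set"
  shows "(\<Sum>e\<in>F. a e *\<^sub>R e) y = (\<Sum>e\<in>F. a e * e y)"
  by (induction F rule: infinite_finite_induct) (auto simp: scaleR_fun_def zero_fun_def plus_fun_def)

lemma sum_sq_le_of_rat_combinations:
  fixes a :: "'b \<Rightarrow> real"
  assumes F: "finite F" and K: "0 \<le> K"
    and rat: "\<And>q. q \<in> (\<Pi>\<^sub>E e\<in>F. \<rat>) \<Longrightarrow> (\<Sum>e\<in>F. q e * a e) \<le> K * sqrt (\<Sum>e\<in>F. (q e)\<^sup>2)"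
  shows "(\<Sum>e\<in>F. (a e)\<^sup>2) \<le> K\<^sup>2"
proof -
  have "\<exists>r\<in>\<rat>. a e < r \<and> r < a e + 1 / Suc n" for e and n :: nat
    by (rule Rats_dense_in_real) simp
  then obtain r where r: "\<And>e n. r e n \<in> \<rat>" "\<And>e n. a e < r e n" "\<And>e n. r e n < a e + 1 / Suc n"
    by metis
  have r_lim: "(\<lambda>n. r e n) \<longlonglongrightarrow> a e" for e
  proof (rule tendsto_sandwich[where f = "\<lambda>_. a e" and h = "\<lambda>n. a e + 1 / Suc n"])
    show "(\<lambda>n. a e + 1 / Suc n) \<longlonglongrightarrow> a e"
      using tendsto_add[OF tendsto_const LIMSEQ_inverse_real_of_nat, of "a e"] by (simp add: inverse_eq_divide)
  qed (use less_imp_le[OF r(2)] less_imp_le[OF r(3)] in auto)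
  let ?S = "\<Sum>e\<in>F. (a e)\<^sup>2"
  have "(\<Sum>e\<in>F. a e * a e) \<le> K * sqrt ?S"
  proof (rule LIMSEQ_le)
    show "(\<lambda>n. \<Sum>e\<in>F. r e n * a e) \<longlonglongrightarrow> (\<Sum>e\<in>F. a e * a e)"
      by (intro tendsto_intros r_lim)
    show "(\<lambda>n. K * sqrt (\<Sum>e\<in>F. (r e n)\<^sup>2)) \<longlonglongrightarrow> K * sqrt ?S"
      by (intro tendsto_intros r_lim)
    have "(\<Sum>e\<in>F. r e n * a e) \<le> K * sqrt (\<Sum>e\<in>F. (r e n)\<^sup>2)" for n
      using rat[of "\<lambda>e\<in>F. r e n"] r(1) by simp
    then show "\<exists>N. \<forall>n\<ge>N. (\<Sum>e\<in>F. r e n * a e) \<le> K * sqrt (\<Sum>e\<in>F. (r e n)\<^sup>2)" by blast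
  qed
  moreover have S: "0 \<le> ?S" by (intro sum_nonneg) auto
  ultimately have "sqrt ?S * sqrt ?S \<le> K * sqrt ?S" by (simp add: power2_eq_square)
  have "sqrt ?S \<le> K"
  proof (cases "?S = 0")
    case False
    then have "0 < sqrt ?S" using S by simp
    with \<open>sqrt ?S * sqrt ?S \<le> K * sqrt ?S\<close> show ?thesis by (rule mult_right_le_imp_le)
  qed (use K in simp)
  then have "(sqrt ?S)\<^sup>2 \<le> K\<^sup>2" by (rule power_mono) (use S in simp)
  then show ?thesis using S by simp
qed

context nash_lyapunov
begin

lemma AE_eq_of_null:
  assumes "hilb.nrm (f - g) = 0" "f \<in> L2" "g \<in> L2"
  shows "AE x in \<mu>. f x = g x"
  using L2_norm_eq_0_iff[OF hilb.H_closed(4)[OF assms(2,3)]] assms(1)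
  by (simp add: L2_nrm fun_diff_def)

lemma hilbert_schmidt_sum_le:
  assumes F: "hilb.orthonormal F" "finite F" and t: "0 < t"
  shows "(\<Sum>e\<in>F. (hilb.nrm (P t e))\<^sup>2) \<le> (bnd t)\<^sup>2 * (\<integral>x. (V x)\<^sup>2 \<partial>\<mu>)"
proof -
  note FL = hilb.orthonormalD(1)[OF F(1)]
  have PL: "P t e \<in> L2" if "e \<in> F" for e using FL[OF that] t by simp
  have "AE x in \<mu>. \<forall>q\<in>(\<Pi>\<^sub>E e\<in>F. \<rat>). (\<Sum>e\<in>F. q e * P t e x) \<le> (bnd t * V x) * sqrt (\<Sum>e\<in>F. (q e)\<^sup>2)"
  proof (rule AE_ball_countable')
    show "countable (\<Pi>\<^sub>E e\<in>F. \<rat> :: real set)" using F(2) countable_rat by (intro countable_PiE) auto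
    fix q :: "('a \<Rightarrow> real) \<Rightarrow> real" assume "q \<in> (\<Pi>\<^sub>E e\<in>F. \<rat>)"
    define s where "s = (\<Sum>e\<in>F. q e *\<^sub>R e)"
    have s: "s \<in> L2" using FL by (auto simp: s_def)
    have nrm_s: "L2_norm \<mu> s = sqrt (\<Sum>e\<in>F. (q e)\<^sup>2)"
      using hilb.nrm_orthonormal_sum[OF F, of q] hilb.nrm_nonneg[OF s]
      by (metis L2_nrm real_sqrt_unique s_def)
    \<comment> \<open>The integral is additive on integrable functions, and \<open>e\<close> is
      integrable under \<open>\<kappa> t x\<close> only for almost every \<open>x\<close>.\<close>
    have "AE x in \<mu>. \<forall>e\<in>F. integrable (\<kappa> t x) e"
      using FL t F(2) by (intro AE_finite_allI AE_kernel_integrable_sq) auto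
    then show "AE x in \<mu>. (\<Sum>e\<in>F. q e * P t e x) \<le> (bnd t * V x) * sqrt (\<Sum>e\<in>F. (q e)\<^sup>2)"
      using AE_le_weighted[OF s t]
    proof eventually_elim
      case (elim x)
      have "P t s x = (\<Sum>e\<in>F. q e * P t e x)"
        using elim(1) by (simp add: kernel_op_def s_def sum_scaleR_apply)
      then show ?case using elim(2) by (simp add: nrm_s mult_ac)
    qed
  qed
  then have le: "AE x in \<mu>. (\<Sum>e\<in>F. (P t e x)\<^sup>2) \<le> (bnd t)\<^sup>2 * (V x)\<^sup>2"
    using AE_space
  proof eventually_elim
    case (elim x)
    have "(\<Sum>e\<in>F. (P t e x)\<^sup>2) \<le> (bnd t * V x)\<^sup>2"
      using elim(1) bnd_nonneg[OF t] V_pos[OF elim(2)]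
      by (intro sum_sq_le_of_rat_combinations F(2)) auto
    then show ?case by (simp add: power_mult_distrib)
  qed
  have "(\<Sum>e\<in>F. (hilb.nrm (P t e))\<^sup>2) = (\<Sum>e\<in>F. \<integral>x. (P t e x)\<^sup>2 \<partial>\<mu>)"
    using PL by (intro sum.cong) (auto simp: L2_nrm L2_norm_def)
  also have "\<dots> = (\<integral>x. (\<Sum>e\<in>F. (P t e x)\<^sup>2) \<partial>\<mu>)"
    using PL by (intro Bochner_Integration.integral_sum[symmetric] L2_spaceD)
  also have "\<dots> \<le> (\<integral>x. (bnd t)\<^sup>2 * (V x)\<^sup>2 \<partial>\<mu>)"
    using PL V_L2 le by (intro integral_mono_AE) (auto intro!: Bochner_Integration.integrable_sum dest: L2_spaceD)
  also have "\<dots> = (bnd t)\<^sup>2 * (\<integral>x. (V x)\<^sup>2 \<partial>\<mu>)" by simp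
  finally show ?thesis .
qed

lemma L2_bounded_semi:
  assumes t: "0 < t" shows "L2_bounded_operator \<mu> (P t)"
  unfolding L2_bounded_operator_def
proof (intro conjI)
  show "\<forall>f\<in>L2. P t f \<in> L2" using t by simp
  show "\<exists>C. \<forall>f\<in>L2. L2_norm \<mu> (P t f) \<le> C * L2_norm \<mu> f"
    using kernel_op_L2(2)[of t] t by (intro exI[of _ 1]) auto
  show "AE_linear_on \<mu> (L2) (P t)"
    unfolding AE_linear_on_def
  proof (intro ballI allI)
    fix f g a b assume fg: "f \<in> L2" "g \<in> L2"
    show "AE x in \<mu>. P t (\<lambda>y. a * f y + b * g y) x = a * P t f x + b * P t g x"
      using AE_kernel_integrable_sq(2)[OF _ fg(1), of t, OF less_imp_le[OF t]]
        AE_kernel_integrable_sq(2)[OF _ fg(2), of t, OF less_imp_le[OF t]]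
      by eventually_elim (simp add: kernel_op_def)
  qed
qed

lemma spectrum_semi:
  assumes t: "0 < t"
  shows "hilbert_schmidt \<mu> (P t)"
    and "\<exists>I lam. has_discrete_spectrum \<mu> (P t) I lam \<and> (\<lambda>n. (lam n)\<^sup>2) summable_on I \<and>
      (\<Sum>\<^sub>\<infinity>n\<in>I. (lam n)\<^sup>2) \<le> (bnd t)\<^sup>2 * (\<integral>x. (V x)\<^sup>2 \<partial>\<mu>)"
proof -
  define S where "S = (bnd t)\<^sup>2 * (\<integral>x. (V x)\<^sup>2 \<partial>\<mu>)"
  have T: "hilb.symmetric_op (P t)" using t by (intro hilb.P_sym) simp
  have hs: "(\<Sum>e\<in>F. (hilb.nrm (P t e))\<^sup>2) \<le> S" if "hilb.orthonormal F" "finite F" for F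
    unfolding S_def by (rule hilbert_schmidt_sum_le[OF that t])
  have inj: "hilb.nrm f = 0" if "f \<in> L2" "hilb.nrm (P t f) = 0" for f
    by (rule hilb.P_injective[OF that(1) t that(2)])
  obtain B lam where B: "hilb.orthonormal B" "\<And>e. e \<in> B \<Longrightarrow> lam e \<noteq> 0"
      "\<And>e. e \<in> B \<Longrightarrow> hilb.nrm (P t e - lam e *\<^sub>R e) = 0"
      "\<And>f. f \<in> L2 \<Longrightarrow> (\<And>e. e \<in> B \<Longrightarrow> ip f e = 0) \<Longrightarrow> hilb.nrm f = 0"
  proof (rule hilb.spectral_theorem[OF T hs inj])
    fix B lam
    assume "hilb.orthonormal B" "\<And>e. e \<in> B \<Longrightarrow> lam e \<noteq> 0"
      "\<And>e. e \<in> B \<Longrightarrow> hilb.nrm (P t e - lam e *\<^sub>R e) = 0"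
      "\<And>f. f \<in> L2 \<Longrightarrow> (\<And>e. e \<in> B \<Longrightarrow> ip f e = 0) \<Longrightarrow> hilb.nrm f = 0"
    then show thesis by (rule that)
  qed
  note BL = hilb.orthonormalD(1)[OF B(1)]
  have nrm_lam: "hilb.nrm (P t e) = \<bar>lam e\<bar>" if e: "e \<in> B" for e
    using hilb.null_diff_nrm[OF B(3)[OF e]] BL[OF e] hilb.orthonormalD(3)[OF B(1) e] t
    by (simp add: hilb.nrm_scale)
  have fin_le: "(\<Sum>e\<in>F. (lam e)\<^sup>2) \<le> S" if F: "finite F" "F \<subseteq> B" for F
  proof -
    have "(\<Sum>e\<in>F. (hilb.nrm (P t e))\<^sup>2) \<le> S"
      unfolding S_def using F by (intro hilbert_schmidt_sum_le t hilb.orthonormal_subset[OF B(1)])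
    moreover have "(\<Sum>e\<in>F. (hilb.nrm (P t e))\<^sup>2) = (\<Sum>e\<in>F. (lam e)\<^sup>2)"
      using nrm_lam F by (intro sum.cong) auto
    ultimately show ?thesis by simp
  qed
  have summ_B: "(\<lambda>e. (lam e)\<^sup>2) summable_on B"
    using fin_le by (intro nonneg_bdd_above_summable_on bdd_aboveI[of _ S]) auto
  \<comment> \<open>A summable family has countably many nonzero members, and no eigenvalue on
    \<open>B\<close> vanishes. This makes the basis countable without a separability
    assumption.\<close>
  have "{e \<in> B. (lam e)\<^sup>2 \<noteq> 0} = B" using B(2) by auto
  then have cB: "countable B" using summable_countable_real[OF summ_B] by simp
  define I where "I = to_nat_on B ` B"
  define E where "E = from_nat_into B"
  have E_inv: "E (to_nat_on B e) = e" if "e \<in> B" for e using cB that by (simp add: E_def)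
  have E_B: "E n \<in> B" if "n \<in> I" for n using that E_inv by (auto simp: I_def)
  have E_inj: "inj_on E I" using E_inv by (auto simp: I_def inj_on_def)
  have E_img: "E ` I = B" using E_inv by (force simp: I_def)
  have basis: "L2_orthonormal_basis \<mu> B (\<lambda>e. e)"
    unfolding L2_orthonormal_basis_def
  proof (intro conjI ballI impI)
    show "AE x in \<mu>. f x = 0" if "f \<in> L2" "\<forall>e\<in>B. ip f e = 0" for f
    proof -
      have "hilb.nrm f = 0" using B(4) that by blast
      then show ?thesis using L2_norm_eq_0_iff[OF that(1)] by (simp add: L2_nrm)
    qed
  qed (use BL hilb.orthonormalD(2)[OF B(1)] in auto)
  show "hilbert_schmidt \<mu> (P t)"
    unfolding hilbert_schmidt_def
  proof (intro conjI exI)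
    have "(\<lambda>e. (lam e)\<^sup>2) summable_on B \<longleftrightarrow> (\<lambda>e. (L2_norm \<mu> (P t e))\<^sup>2) summable_on B"
      using nrm_lam by (intro summable_on_cong) (simp add: L2_nrm)
    then show "(\<lambda>e. (L2_norm \<mu> (P t e))\<^sup>2) summable_on B" using summ_B by simp
  qed (use basis L2_bounded_semi[OF t] in auto)
  have eig: "AE x in \<mu>. P t e x = lam e * e x" if e: "e \<in> B" for e
    using AE_eq_of_null[OF B(3)[OF e] _ hilb.H_closed(3)[OF BL[OF e]]] BL[OF e] t
    by (simp add: scaleR_fun_def)
  have fin_large: "finite {e \<in> B. \<epsilon> \<le> \<bar>lam e\<bar>}" if \<epsilon>: "0 < \<epsilon>" for \<epsilon>
  proof (rule ccontr)
    assume inf: "infinite {e \<in> B. \<epsilon> \<le> \<bar>lam e\<bar>}"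
    obtain n :: nat where n: "S / \<epsilon>\<^sup>2 < real n" using reals_Archimedean2 by blast
    obtain F where F: "finite F" "card F = n" "F \<subseteq> {e \<in> B. \<epsilon> \<le> \<bar>lam e\<bar>}"
      using infinite_arbitrarily_large[OF inf] by blast
    have "real n * \<epsilon>\<^sup>2 = (\<Sum>e\<in>F. \<epsilon>\<^sup>2)" using F by simp
    also have "\<dots> \<le> (\<Sum>e\<in>F. (lam e)\<^sup>2)"
      using F \<epsilon> by (intro sum_mono) (auto simp: abs_le_square_iff[symmetric] subset_iff)
    also have "\<dots> \<le> S" using F by (intro fin_le) auto
    finally show False using n \<epsilon> by (simp add: pos_divide_less_eq)
  qed
  have spec: "r \<in> L2_spectrum \<mu> (P t) \<longleftrightarrow> r \<in> lam ` B" if r: "r \<noteq> 0" for r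
  proof
    assume "r \<in> lam ` B"
    then obtain e where e: "e \<in> B" "r = lam e" by blast
    have z: "L2_norm \<mu> (\<lambda>x. P t e x - r * e x) = 0"
      using B(3)[OF e(1)] by (simp add: e(2) L2_nrm fun_diff_def scaleR_fun_def)
    have "\<not> (\<exists>C. \<forall>f\<in>L2. L2_norm \<mu> f \<le> C * L2_norm \<mu> (\<lambda>x. P t f x - r * f x))"
      using BL[OF e(1)] hilb.orthonormalD(3)[OF B(1) e(1)] z by (force simp: L2_nrm)
    then show "r \<in> L2_spectrum \<mu> (P t)" by (simp add: L2_spectrum_def)
  next
    assume spec: "r \<in> L2_spectrum \<mu> (P t)"
    show "r \<in> lam ` B"
    proof (rule ccontr)
      assume notin: "r \<notin> lam ` B"
      \<comment> \<open>Eigenvalues outside \<open>L\<close> stay at distance at least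
        \<open>\<bar>r\<bar> / 2\<close> from \<open>r\<close>. The finitely many in
        \<open>L\<close> differ from \<open>r\<close>, so the minimum \<open>\<delta>\<close> is a
        positive gap; the inserted element also covers an empty \<open>L\<close>.\<close>
      define L where "L = {e \<in> B. \<bar>r\<bar> / 2 \<le> \<bar>lam e\<bar>}"
      have L: "finite L" unfolding L_def using r by (intro fin_large) simp
      define \<delta> where "\<delta> = Min (insert (\<bar>r\<bar> / 2) ((\<lambda>e. \<bar>lam e - r\<bar>) ` L))"
      have \<delta>: "0 < \<delta>" using L r notin by (auto simp: \<delta>_def L_def)
      have gap: "\<delta> \<le> \<bar>lam e - r\<bar>" if e: "e \<in> B" for e
      proof (cases "e \<in> L")
        case True
        then show ?thesis using L by (auto simp: \<delta>_def intro: Min_le)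
      next
        case False
        then have "\<bar>lam e\<bar> < \<bar>r\<bar> / 2" using e by (simp add: L_def)
        moreover have "\<delta> \<le> \<bar>r\<bar> / 2" unfolding \<delta>_def using L by (intro Min_le) auto
        ultimately show ?thesis by linarith
      qed
      have res1: "\<exists>f\<in>L2. hilb.nrm (P t f - r *\<^sub>R f - g) = 0" if "g \<in> L2" for g
        by (rule hilb.diagonal_resolvent(1)[OF T B(1), where lam = lam and \<delta> = \<delta>])
          (use B \<delta> gap that in \<open>blast+\<close>)
      have res2: "hilb.nrm f \<le> 1 / \<delta> * hilb.nrm (P t f - r *\<^sub>R f)" if "f \<in> L2" for f
        by (rule hilb.diagonal_resolvent(2)[OF T B(1), where lam = lam and \<delta> = \<delta>])
          (use B \<delta> gap that in \<open>blast+\<close>)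
      have "\<exists>f\<in>L2. AE x in \<mu>. P t f x - r * f x = g x" if g: "g \<in> L2" for g
      proof -
        obtain f where f: "f \<in> L2" "hilb.nrm (P t f - r *\<^sub>R f - g) = 0"
          using res1[OF g] by blast
        have "AE x in \<mu>. (P t f - r *\<^sub>R f) x = g x"
          by (rule AE_eq_of_null[OF f(2)]) (use f g t in auto)
        then show ?thesis using f(1) by (auto simp: fun_diff_def scaleR_fun_def)
      qed
      moreover have "\<forall>f\<in>L2. L2_norm \<mu> f \<le> 1 / \<delta> * L2_norm \<mu> (\<lambda>x. P t f x - r * f x)"
        using res2 by (simp add: L2_nrm fun_diff_def scaleR_fun_def)
      ultimately have "r \<notin> L2_spectrum \<mu> (P t)" unfolding L2_spectrum_def by blast
      then show False using spec by simp
    qed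
  qed
  have "has_discrete_spectrum \<mu> (P t) I (\<lambda>n. lam (E n))"
    unfolding has_discrete_spectrum_def
  proof (intro conjI exI allI impI)
    show "L2_orthonormal_basis \<mu> I E"
      unfolding L2_orthonormal_basis_def
    proof (intro conjI ballI impI)
      show "E i \<in> L2" if "i \<in> I" for i using BL E_B that by auto
      show "ip (E i) (E j) = (if i = j then 1 else 0)" if "i \<in> I" "j \<in> I" for i j
        using hilb.orthonormalD(2)[OF B(1) E_B[OF that(1)] E_B[OF that(2)]] inj_on_eq_iff[OF E_inj that] by simp
      show "AE x in \<mu>. f x = 0" if f: "f \<in> L2" and z: "\<forall>i\<in>I. ip f (E i) = 0" for f
      proof -
        have "\<forall>e\<in>B. ip f e = 0" using z unfolding E_img[symmetric] by blast
        then have "hilb.nrm f = 0" using B(4)[OF f] by blast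
        then show ?thesis using L2_norm_eq_0_iff[OF f] by (simp add: L2_nrm)
      qed
    qed
    show "\<forall>n\<in>I. AE x in \<mu>. P t (E n) x = lam (E n) * E n x" using eig E_B by blast
    have "(\<lambda>n. lam (E n)) ` I = lam ` B" by (simp flip: E_img add: image_image)
    then show "L2_spectrum \<mu> (P t) - {0} = (\<lambda>n. lam (E n)) ` I - {0}" using spec by auto
    fix \<epsilon> :: real assume "0 < \<epsilon>"
    then have "finite {e \<in> B. \<epsilon> \<le> \<bar>lam e\<bar>}" by (rule fin_large)
    moreover have "E ` {n \<in> I. \<epsilon> \<le> \<bar>lam (E n)\<bar>} \<subseteq> {e \<in> B. \<epsilon> \<le> \<bar>lam e\<bar>}" using E_B by auto
    ultimately have "finite (E ` {n \<in> I. \<epsilon> \<le> \<bar>lam (E n)\<bar>})" by (rule rev_finite_subset)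
    then show "finite {n \<in> I. \<epsilon> \<le> \<bar>lam (E n)\<bar>}"
      by (rule finite_imageD) (rule inj_on_subset[OF E_inj], auto)
  qed
  moreover have fin_I: "(\<Sum>n\<in>F. (lam (E n))\<^sup>2) \<le> S" if F: "finite F" "F \<subseteq> I" for F
  proof -
    have "(\<Sum>n\<in>F. (lam (E n))\<^sup>2) = (\<Sum>e\<in>E ` F. (lam e)\<^sup>2)"
      using inj_on_subset[OF E_inj F(2)] by (simp add: sum.reindex)
    also have "\<dots> \<le> S" using F E_B by (intro fin_le) auto
    finally show ?thesis .
  qed
  moreover have summ_I: "(\<lambda>n. (lam (E n))\<^sup>2) summable_on I"
    using fin_I by (intro nonneg_bdd_above_summable_on bdd_aboveI[of _ S]) auto
  moreover have "(\<Sum>\<^sub>\<infinity>n\<in>I. (lam (E n))\<^sup>2) \<le> S"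
    using fin_I by (intro infsum_le_finite_sums summ_I) auto
  ultimately show "\<exists>I lam. has_discrete_spectrum \<mu> (P t) I lam \<and> (\<lambda>n. (lam n)\<^sup>2) summable_on I \<and>
      (\<Sum>\<^sub>\<infinity>n\<in>I. (lam n)\<^sup>2) \<le> (bnd t)\<^sup>2 * (\<integral>x. (V x)\<^sup>2 \<partial>\<mu>)"
    unfolding S_def by blast
qed

end

section \<open>Densities\<close>

context nash_lyapunov
begin

section \<open>The kernels on functions of finite weighted norm\<close>

lemma V_nonzero: "x \<in> space \<mu> \<Longrightarrow> V x \<noteq> 0"
  using V_pos by force

lemma AE_semi_V_le:
  assumes t: "0 \<le> t" shows "AE x in \<mu>. P t V x \<le> exp (c * t) * V x"
proof -
  have "AE x in \<mu>. P t V x \<le> (exp (c * t) *\<^sub>R V) x"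
  proof (rule AE_le_of_weak_le)
    fix g assume g: "g \<in> L2" "\<And>x. 0 \<le> g x"
    show "ip g (P t V) \<le> ip g (exp (c * t) *\<^sub>R V)"
      using lyapunov_weak[OF g t] g V_L2 by (simp add: hilb.ip_scale_right)
  qed (use t V_L2 in auto)
  then show ?thesis by (simp add: scaleR_fun_def)
qed

text \<open>Here \<open>h\<close> need not be in L2. Symmetry in extended reals gives that the
  integral of \<open>V * P t \<bar>h\<bar>\<close> equals that of
  \<open>\<bar>h\<bar> * P t V\<close>, which the Lyapunov bound makes finite; as \<open>V\<close>
  is positive, \<open>P t \<bar>h\<bar>\<close> is finite almost everywhere.\<close>

lemma AE_kernel_integrable_weighted:
  assumes t: "0 \<le> t" and h [measurable]: "h \<in> borel_measurable \<mu>"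
    and int: "integrable \<mu> (\<lambda>x. h x * V x)"
  shows "AE x in \<mu>. integrable (\<kappa> t x) h"
proof -
  have "(\<integral>\<^sup>+x. ennreal \<bar>V x\<bar> * (\<integral>\<^sup>+y. ennreal \<bar>h y\<bar> \<partial>\<kappa> t x) \<partial>\<mu>)
      = (\<integral>\<^sup>+x. ennreal \<bar>h x\<bar> * (\<integral>\<^sup>+y. ennreal \<bar>V y\<bar> \<partial>\<kappa> t x) \<partial>\<mu>)"
    using t by (intro nn_symmetric) auto
  also have "\<dots> \<le> (\<integral>\<^sup>+x. ennreal (exp (c * t) * \<bar>h x * V x\<bar>) \<partial>\<mu>)"
  proof (rule nn_integral_mono_AE)
    show "AE x in \<mu>. ennreal \<bar>h x\<bar> * (\<integral>\<^sup>+y. ennreal \<bar>V y\<bar> \<partial>\<kappa> t x) \<le> ennreal (exp (c * t) * \<bar>h x * V x\<bar>)"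
      using AE_semi_V_le[OF t] AE_kernel_integrable_sq(2)[OF t V_L2] AE_space
    proof eventually_elim
      case (elim x)
      have "(\<integral>\<^sup>+y. ennreal \<bar>V y\<bar> \<partial>\<kappa> t x) = (\<integral>\<^sup>+y. ennreal (V y) \<partial>\<kappa> t x)"
        using kernel_prob(3)[OF t elim(3)] by (intro nn_integral_cong) (simp add: abs_of_pos[OF V_pos])
      also have "\<dots> = ennreal (P t V x)"
        unfolding kernel_op_def using elim(2) kernel_prob(3)[OF t elim(3)]
        by (intro nn_integral_eq_integral) (auto intro!: AE_I2 less_imp_le[OF V_pos])
      also have "\<dots> \<le> ennreal (exp (c * t) * V x)" using elim(1) by (rule ennreal_leI)
      finally have "ennreal \<bar>h x\<bar> * (\<integral>\<^sup>+y. ennreal \<bar>V y\<bar> \<partial>\<kappa> t x) \<le> ennreal \<bar>h x\<bar> * ennreal (exp (c * t) * V x)"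
        by (rule mult_left_mono) simp
      also have "\<dots> = ennreal (exp (c * t) * \<bar>h x * V x\<bar>)"
        using V_pos[OF elim(3)] by (simp add: abs_mult mult_ac flip: ennreal_mult')
      finally show ?case .
    qed
  qed
  also have "\<dots> = ennreal (\<integral>x. exp (c * t) * \<bar>h x * V x\<bar> \<partial>\<mu>)"
    using int by (intro nn_integral_eq_integral) auto
  also have "\<dots> < \<infinity>" by simp
  finally have "AE x in \<mu>. ennreal \<bar>V x\<bar> * (\<integral>\<^sup>+y. ennreal \<bar>h y\<bar> \<partial>\<kappa> t x) \<noteq> \<infinity>"
    using t by (intro nn_integral_PInf_AE borel_measurable_times_ennreal kernel_nn_measurable) auto
  then show ?thesis using AE_space
  proof eventually_elim
    case (elim x)
    have "(\<integral>\<^sup>+y. ennreal \<bar>h y\<bar> \<partial>\<kappa> t x) < \<infinity>"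
      using elim(1) V_pos[OF elim(2)] by (auto simp: ennreal_mult_eq_top_iff less_top)
    then show ?case
      using h unfolding integrable_iff_bounded by (simp add: kernel_borel[OF t elim(2)])
  qed
qed

text \<open>Truncating \<open>h\<close> where \<open>\<bar>h\<bar>\<close> exceeds a multiple of
  \<open>V\<close> gives functions dominated by that multiple, hence in L2, with no larger weighted
  norm. Their L2 bounds pass to \<open>h\<close> by dominated convergence under the single measure
  \<open>\<kappa> (2 * t) x\<close>.\<close>

lemma AE_semi_le_wnorm:
  assumes t: "0 < t" and h [measurable]: "h \<in> borel_measurable \<mu>"
    and int: "integrable \<mu> (\<lambda>x. h x * V x)"
  shows "AE x in \<mu>. \<bar>P (2 * t) h x\<bar> \<le> (bnd t)\<^sup>2 * wnorm h * V x"
proof -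
  have t2: "0 \<le> 2 * t" using t by simp
  define hn where "hn n x = (if \<bar>h x\<bar> \<le> real n * V x then h x else 0)" for n x
  have [measurable]: "hn n \<in> borel_measurable \<mu>" for n unfolding hn_def[abs_def] by measurable
  have hn_L2: "hn n \<in> L2" for n
    by (rule L2_space_bound[OF L2_space_scale[OF V_L2, of "real n"]])
      (use less_imp_le[OF V_pos] in \<open>auto simp: hn_def scaleR_fun_def intro!: AE_I2\<close>)
  have hn_le: "\<bar>hn n x\<bar> \<le> \<bar>h x\<bar>" for n x by (simp add: hn_def)
  have hn_wnorm: "wnorm (hn n) \<le> wnorm h" for n
    unfolding wnorm_def L1_norm_def
  proof (rule integral_mono)
    show "integrable \<mu> (\<lambda>x. \<bar>hn n x * V x\<bar>)" "integrable \<mu> (\<lambda>x. \<bar>h x * V x\<bar>)"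
      by (intro integrable_abs L2_space_mult_integrable hn_L2 V_L2 int)+
    show "\<bar>hn n x * V x\<bar> \<le> \<bar>h x * V x\<bar>" for x
      using hn_le by (simp add: abs_mult mult_right_mono)
  qed
  have "AE x in \<mu>. \<forall>n. \<bar>P (2 * t) (hn n) x\<bar> \<le> (bnd t)\<^sup>2 * wnorm (hn n) * V x"
    unfolding AE_all_countable using AE_double_le_weighted[OF hn_L2 t] by blast
  then show ?thesis using AE_kernel_integrable_weighted[OF t2 h int] AE_space
  proof eventually_elim
    case (elim x)
    have "(\<lambda>n. P (2 * t) (hn n) x) \<longlonglongrightarrow> P (2 * t) h x"
      unfolding kernel_op_def
    proof (rule integral_dominated_convergence)
      show "h \<in> borel_measurable (\<kappa> (2 * t) x)" "hn n \<in> borel_measurable (\<kappa> (2 * t) x)" for n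
        by (simp_all add: kernel_borel[OF t2 elim(3)])
      show "integrable (\<kappa> (2 * t) x) (\<lambda>y. \<bar>h y\<bar>)" using elim(2) by simp
      show "AE y in \<kappa> (2 * t) x. (\<lambda>n. hn n y) \<longlonglongrightarrow> h y"
      proof (rule AE_I2)
        fix y assume "y \<in> space (\<kappa> (2 * t) x)"
        then have Vy: "0 < V y" using kernel_prob(3)[OF t2 elim(3)] V_pos by simp
        have "eventually (\<lambda>n. hn n y = h y) sequentially"
          using eventually_ge_at_top[of "nat \<lceil>\<bar>h y\<bar> / V y\<rceil>"]
        proof eventually_elim
          case (elim n)
          then have "\<bar>h y\<bar> / V y \<le> real n" by linarith
          then show ?case using Vy by (simp add: hn_def pos_divide_le_eq)
        qed
        then show "(\<lambda>n. hn n y) \<longlonglongrightarrow> h y" by (rule tendsto_eventually)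
      qed
    qed (use hn_le in auto)
    then have "(\<lambda>n. \<bar>P (2 * t) (hn n) x\<bar>) \<longlonglongrightarrow> \<bar>P (2 * t) h x\<bar>" by (rule tendsto_rabs)
    moreover have "\<bar>P (2 * t) (hn n) x\<bar> \<le> (bnd t)\<^sup>2 * wnorm h * V x" for n
    proof -
      have "(bnd t)\<^sup>2 * wnorm (hn n) * V x \<le> (bnd t)\<^sup>2 * wnorm h * V x"
        using hn_wnorm V_pos[OF elim(3)] by (intro mult_right_mono mult_left_mono) auto
      then show ?thesis using elim(1) by (meson order_trans)
    qed
    ultimately show ?case by (intro LIMSEQ_le_const2) auto
  qed
qed

text \<open>The operator \<open>f \<mapsto> V\<^sup>-\<^sup>1 P\<^sub>2\<^sub>t (V\<^sup>-\<^sup>1 f)\<close> has the density \<open>p\<^sub>2\<^sub>t(x,y) / (V(x) V(y))\<close>.\<close>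

lemma weighted_kernel:
  assumes nice: "nice_measure_space \<mu>" and t: "0 < t"
  obtains k where "(\<lambda>(x, y). k x y) \<in> borel_measurable (\<mu> \<Otimes>\<^sub>M \<mu>)" "\<And>x y. \<bar>k x y\<bar> \<le> (bnd t)\<^sup>2"
    "\<And>h. h \<in> L2 \<Longrightarrow> AE x in \<mu>. P (2 * t) h x = V x * (\<integral>y. h y * V y * k x y \<partial>\<mu>)"
proof -
  interpret pair_sigma_finite \<mu> \<mu> by unfold_locales
  have t2: "0 \<le> 2 * t" using t by simp
  define C where "C = (bnd t)\<^sup>2"
  define T where "T f x = P (2 * t) (\<lambda>y. f y / V y) x / V x" for f x
  have cancel: "integrable \<mu> (\<lambda>x. f x / V x * V x) \<longleftrightarrow> integrable \<mu> f" for f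
    by (rule Bochner_Integration.integrable_cong) (simp_all add: V_nonzero)
  have wnorm_div: "wnorm (\<lambda>y. f y / V y) = L1_norm \<mu> f" for f
    unfolding wnorm_def L1_norm_def
    by (rule Bochner_Integration.integral_cong) (simp_all add: V_nonzero)
  have L1D: "(\<lambda>y. f y / V y) \<in> borel_measurable \<mu>" "integrable \<mu> (\<lambda>x. f x / V x * V x)"
    if "f \<in> L1_space \<mu>" for f
  proof -
    have int: "integrable \<mu> f" using that by (simp add: L1_space_def)
    then have [measurable]: "f \<in> borel_measurable \<mu>" by (rule borel_measurable_integrable)
    show "(\<lambda>y. f y / V y) \<in> borel_measurable \<mu>" by measurable
    show "integrable \<mu> (\<lambda>x. f x / V x * V x)" using int by (simp only: cancel)
  qed
  have L1_int: "AE x in \<mu>. integrable (\<kappa> (2 * t) x) (\<lambda>y. f y / V y)" if "f \<in> L1_space \<mu>" for f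
    by (rule AE_kernel_integrable_weighted[OF t2 L1D[OF that]])
  have C_bound: "C \<in> L1_Linf_bounds \<mu> T"
    unfolding L1_Linf_bounds_def
  proof (intro CollectI conjI ballI)
    show "0 \<le> C" by (simp add: C_def)
    fix f assume f: "f \<in> L1_space \<mu>"
    have "AE x in \<mu>. \<bar>P (2 * t) (\<lambda>y. f y / V y) x\<bar> \<le> C * L1_norm \<mu> f * V x"
      using AE_semi_le_wnorm[OF t L1D[OF f]] by (simp only: wnorm_div C_def)
    then show "AE x in \<mu>. \<bar>T f x\<bar> \<le> C * L1_norm \<mu> f"
      using AE_space
      by eventually_elim (auto simp: T_def abs_of_pos[OF V_pos] pos_divide_le_eq[OF V_pos])
  qed
  have "L1_Linf_bounded_operator \<mu> T"
    unfolding L1_Linf_bounded_operator_def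
  proof (intro conjI ballI)
    show "T f \<in> borel_measurable \<mu>" if "f \<in> L1_space \<mu>" for f
      unfolding T_def[abs_def] by (intro borel_measurable_divide kernel_op_measurable t2 L1D[OF that] V_meas)
    show "AE_linear_on \<mu> (L1_space \<mu>) T"
      unfolding AE_linear_on_def
    proof (intro ballI allI)
      fix f g a b assume fg: "f \<in> L1_space \<mu>" "g \<in> L1_space \<mu>"
      show "AE x in \<mu>. T (\<lambda>y. a * f y + b * g y) x = a * T f x + b * T g x"
        using L1_int[OF fg(1)] L1_int[OF fg(2)]
      proof eventually_elim
        case (elim x)
        have "(\<integral>y. (a * f y + b * g y) / V y \<partial>\<kappa> (2 * t) x)
            = (\<integral>y. a * (f y / V y) + b * (g y / V y) \<partial>\<kappa> (2 * t) x)" by (simp add: add_divide_distrib)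
        also have "\<dots> = a * (\<integral>y. f y / V y \<partial>\<kappa> (2 * t) x) + b * (\<integral>y. g y / V y \<partial>\<kappa> (2 * t) x)"
          using elim by (simp del: times_divide_eq_right)
        finally show ?case by (simp add: T_def kernel_op_def add_divide_distrib)
      qed
    qed
    show "L1_Linf_bounds \<mu> T \<noteq> {}" using C_bound by blast
  qed
  then obtain k where k: "(\<lambda>(x, y). k x y) \<in> borel_measurable (\<mu> \<Otimes>\<^sub>M \<mu>)"
      "AE (x, y) in \<mu> \<Otimes>\<^sub>M \<mu>. \<bar>k x y\<bar> \<le> L1_Linf_opnorm \<mu> T"
      "\<And>f. f \<in> L1_space \<mu> \<Longrightarrow> AE x in \<mu>. T f x = (\<integral>y. f y * k x y \<partial>\<mu>)"
    using nice unfolding nice_measure_space_def by blast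
  have [measurable]: "(\<lambda>z. k (fst z) (snd z)) \<in> borel_measurable (\<mu> \<Otimes>\<^sub>M \<mu>)"
    using k(1) by (simp add: split_beta')
  have "L1_Linf_opnorm \<mu> T \<le> C"
    unfolding L1_Linf_opnorm_def
    by (rule cInf_lower[OF C_bound]) (rule bdd_belowI[of _ 0], simp add: L1_Linf_bounds_def)
  then have "AE z in \<mu> \<Otimes>\<^sub>M \<mu>. \<bar>k (fst z) (snd z)\<bar> \<le> C"
    using k(2) by (auto simp: split_beta' elim!: eventually_mono)
  then have k_le: "AE x in \<mu>. AE y in \<mu>. \<bar>k x y\<bar> \<le> C" using AE_pair by fastforce
  \<comment> \<open>Clamping makes the bound valid at every point and, for almost every
    \<open>x\<close>, alters \<open>k x\<close> on a null set only. Measurability is kept.\<close>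
  define k' where "k' x y = max (- C) (min C (k x y))" for x y
  show thesis
  proof (rule that[of k'])
    show "(\<lambda>(x, y). k' x y) \<in> borel_measurable (\<mu> \<Otimes>\<^sub>M \<mu>)"
      unfolding k'_def split_beta' by measurable
    show "\<bar>k' x y\<bar> \<le> (bnd t)\<^sup>2" for x y
      by (auto simp: k'_def C_def abs_le_iff max_def min_def)
    fix h assume h: "h \<in> L2"
    have [measurable]: "h \<in> borel_measurable \<mu>" using h by (rule L2_spaceD)
    \<comment> \<open>The representation is used for \<open>h * V\<close>, whose image under
      \<open>T\<close> is \<open>P (2 * t) h / V\<close>: the two weights cancel.\<close>
    have "(\<lambda>y. h y * V y) \<in> L1_space \<mu>" using L2_space_mult_integrable[OF h V_L2] by (simp add: L1_space_def)
    from k(3)[OF this] show "AE x in \<mu>. P (2 * t) h x = V x * (\<integral>y. h y * V y * k' x y \<partial>\<mu>)"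
      using k_le AE_space
    proof eventually_elim
      case (elim x)
      have "P (2 * t) (\<lambda>y. h y * V y / V y) x = P (2 * t) h x"
        unfolding kernel_op_def using kernel_prob(3)[OF t2 elim(3)] V_pos
        by (intro Bochner_Integration.integral_cong) (auto simp: order_less_imp_not_eq2)
      then have "P (2 * t) h x = V x * (\<integral>y. h y * V y * k x y \<partial>\<mu>)"
        using elim(1) V_pos[OF elim(3)] by (simp add: T_def field_simps)
      also have "(\<integral>y. h y * V y * k x y \<partial>\<mu>) = (\<integral>y. h y * V y * k' x y \<partial>\<mu>)"
      proof (rule integral_cong_AE)
        have [measurable]: "(\<lambda>y. k x y) \<in> borel_measurable \<mu>"
          using measurable_compose[OF measurable_Pair1'[OF elim(3)] k(1)] by simp
        show "(\<lambda>y. h y * V y * k x y) \<in> borel_measurable \<mu>" "(\<lambda>y. h y * V y * k' x y) \<in> borel_measurable \<mu>"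
          unfolding k'_def by measurable
        show "AE y in \<mu>. h y * V y * k x y = h y * V y * k' x y"
          using elim(2) by eventually_elim (auto simp: k'_def)
      qed
      finally show ?case .
    qed
  qed
qed

section \<open>Symmetry and positivity of the kernel\<close>

lemma weighted_integrable:
  assumes h: "h \<in> L2" and k: "(\<lambda>(x, y). k x y) \<in> borel_measurable (\<mu> \<Otimes>\<^sub>M \<mu>)"
    and bound: "\<And>x y. \<bar>k x y\<bar> \<le> C" and x: "x \<in> space \<mu>"
  shows "integrable \<mu> (\<lambda>y. h y * V y * k x y)"
proof (rule Bochner_Integration.integrable_bound)
  show "integrable \<mu> (\<lambda>y. C * (h y * V y))" using L2_space_mult_integrable[OF h V_L2] by simp
  have [measurable]: "(\<lambda>y. k x y) \<in> borel_measurable \<mu>" "h \<in> borel_measurable \<mu>"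
    using measurable_compose[OF measurable_Pair1'[OF x] k] L2_spaceD(1)[OF h] by simp_all
  show "(\<lambda>y. h y * V y * k x y) \<in> borel_measurable \<mu>" by measurable
  show "AE y in \<mu>. norm (h y * V y * k x y) \<le> norm (C * (h y * V y))"
    using bound[of x] by (auto simp: abs_mult mult.commute[of C] intro!: AE_I2 mult_left_mono order_trans[OF bound abs_ge_self])
qed

text \<open>Transposing the kernel gives the adjoint, which is the same operator.\<close>

lemma weighted_kernel_transpose:
  assumes t: "0 \<le> t" and k: "(\<lambda>(x, y). k x y) \<in> borel_measurable (\<mu> \<Otimes>\<^sub>M \<mu>)"
    and bound: "\<And>x y. \<bar>k x y\<bar> \<le> C"
    and rep: "\<And>h. h \<in> L2 \<Longrightarrow> AE x in \<mu>. P t h x = V x * (\<integral>y. h y * V y * k x y \<partial>\<mu>)"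
    and h: "h \<in> L2"
  shows "AE x in \<mu>. P t h x = V x * (\<integral>y. h y * V y * k y x \<partial>\<mu>)"
proof -
  interpret pair_sigma_finite \<mu> \<mu> by unfold_locales
  have C: "0 \<le> C" using bound[of undefined undefined] by (meson abs_ge_zero order_trans)
  have k_meas [measurable]: "(\<lambda>z. k (fst z) (snd z)) \<in> borel_measurable (\<mu> \<Otimes>\<^sub>M \<mu>)"
    using k by (simp add: split_beta')
  have kT: "(\<lambda>(x, y). k y x) \<in> borel_measurable (\<mu> \<Otimes>\<^sub>M \<mu>)"
    using measurable_pair_swap[OF k] by simp
  then have [measurable]: "(\<lambda>z. k (snd z) (fst z)) \<in> borel_measurable (\<mu> \<Otimes>\<^sub>M \<mu>)"
    by (simp add: split_beta')
  have hm [measurable]: "h \<in> borel_measurable \<mu>" using h by (rule L2_spaceD)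
  have hV: "integrable \<mu> (\<lambda>y. h y * V y)" by (rule L2_space_mult_integrable[OF h V_L2])
  define u where "u x = V x * (\<integral>y. h y * V y * k y x \<partial>\<mu>)" for x
  have u_meas [measurable]: "u \<in> borel_measurable \<mu>" unfolding u_def[abs_def] by measurable
  have u: "u \<in> L2"
  proof (rule L2_space_bound)
    show "(C * wnorm h) *\<^sub>R V \<in> L2" by (rule L2_space_scale[OF V_L2])
    show "AE x in \<mu>. \<bar>u x\<bar> \<le> \<bar>((C * wnorm h) *\<^sub>R V) x\<bar>"
    proof (rule AE_I2)
      fix x assume x: "x \<in> space \<mu>"
      have "\<bar>\<integral>y. h y * V y * k y x \<partial>\<mu>\<bar> \<le> (\<integral>y. \<bar>h y * V y * k y x\<bar> \<partial>\<mu>)" by (rule integral_abs_bound)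
      also have "\<dots> \<le> (\<integral>y. C * \<bar>h y * V y\<bar> \<partial>\<mu>)"
      proof (rule integral_mono)
        show "integrable \<mu> (\<lambda>y. \<bar>h y * V y * k y x\<bar>)"
          by (rule integrable_abs[OF weighted_integrable[OF h kT bound x]])
        show "integrable \<mu> (\<lambda>y. C * \<bar>h y * V y\<bar>)" using integrable_abs[OF hV] by simp
        show "\<bar>h y * V y * k y x\<bar> \<le> C * \<bar>h y * V y\<bar>" for y
          using bound[of y x] by (simp add: abs_mult mult.commute[of C] mult_left_mono)
      qed
      also have "\<dots> = C * wnorm h" by (simp add: wnorm_def L1_norm_def)
      finally show "\<bar>u x\<bar> \<le> \<bar>((C * wnorm h) *\<^sub>R V) x\<bar>"
        using V_pos[OF x] C wnorm_nonneg[of h]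
        by (simp add: u_def scaleR_fun_def abs_mult mult.commute)
    qed
  qed auto
  have "hilb.nrm (P t h - u) = 0"
  proof (rule hilb.null_diffI)
    fix g assume g: "g \<in> L2"
    have [measurable]: "g \<in> borel_measurable \<mu>" using g by (rule L2_spaceD)
    have gV: "integrable \<mu> (\<lambda>y. g y * V y)" by (rule L2_space_mult_integrable[OF g V_L2])
    define F where "F x y = g x * V x * (h y * V y) * k y x" for x y
    \<comment> \<open>Since \<open>k\<close> is bounded, a product of the two integrable functions
      \<open>g * V\<close> and \<open>h * V\<close> majorises the double integrand and justifies
      Fubini's theorem.\<close>
    have "integrable (\<mu> \<Otimes>\<^sub>M \<mu>) (\<lambda>(x, y). C * ((g x * V x) * (h y * V y)))"
    proof (rule Fubini_integrable)
      show "integrable \<mu> (\<lambda>x. \<integral>y. norm (case (x, y) of (x, y) \<Rightarrow> C * ((g x * V x) * (h y * V y))) \<partial>\<mu>)"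
        using integrable_abs[OF gV] by (simp add: abs_mult)
      show "AE x in \<mu>. integrable \<mu> (\<lambda>y. case (x, y) of (x, y) \<Rightarrow> C * ((g x * V x) * (h y * V y)))"
        using hV by simp
    qed (unfold split_beta', measurable)
    then have F_int: "integrable (\<mu> \<Otimes>\<^sub>M \<mu>) (\<lambda>(x, y). F x y)"
    proof (rule Bochner_Integration.integrable_bound)
      show "(\<lambda>(x, y). F x y) \<in> borel_measurable (\<mu> \<Otimes>\<^sub>M \<mu>)" unfolding F_def split_beta' by measurable
      have "\<bar>F x y\<bar> \<le> \<bar>C * ((g x * V x) * (h y * V y))\<bar>" for x y
        using bound[of y x] C
        by (simp add: F_def abs_mult mult.commute[of C] mult_left_mono)
      then show "AE z in \<mu> \<Otimes>\<^sub>M \<mu>. norm (case z of (x, y) \<Rightarrow> F x y)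
          \<le> norm (case z of (x, y) \<Rightarrow> C * ((g x * V x) * (h y * V y)))"
        by (auto simp: split_beta')
    qed
    have F1: "(\<integral>y. F x y \<partial>\<mu>) = g x * V x * (\<integral>y. h y * V y * k y x \<partial>\<mu>)" for x
    proof -
      have "F x y = g x * V x * (h y * V y * k y x)" for y by (simp add: F_def mult_ac)
      then show ?thesis by (simp only: integral_mult_right_zero)
    qed
    have F2: "(\<integral>x. F x y \<partial>\<mu>) = h y * V y * (\<integral>x. g x * V x * k y x \<partial>\<mu>)" for y
    proof -
      have "F x y = h y * V y * (g x * V x * k y x)" for x by (simp add: F_def mult_ac)
      then show ?thesis by (simp only: integral_mult_right_zero)
    qed
    have "ip u g = (\<integral>x. (\<integral>y. F x y \<partial>\<mu>) \<partial>\<mu>)"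
      unfolding L2_inner_def u_def F1 by (simp add: mult_ac)
    also have "\<dots> = (\<integral>y. (\<integral>x. F x y \<partial>\<mu>) \<partial>\<mu>)" by (rule Fubini_integral[OF F_int, symmetric])
    also have "\<dots> = (\<integral>y. h y * (V y * (\<integral>x. g x * V x * k y x \<partial>\<mu>)) \<partial>\<mu>)"
      unfolding F2 by (simp add: mult.assoc)
    also have "\<dots> = ip h (P t g)"
      unfolding L2_inner_def
    proof (rule integral_cong_AE)
      show "AE y in \<mu>. h y * (V y * (\<integral>x. g x * V x * k y x \<partial>\<mu>)) = h y * P t g y"
        using rep[OF g] by eventually_elim simp
      have "P t g \<in> borel_measurable \<mu>" using t g kernel_op_L2(1) by (blast dest: L2_spaceD)
      then show "(\<lambda>y. h y * P t g y) \<in> borel_measurable \<mu>" by measurable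
      show "(\<lambda>y. h y * (V y * (\<integral>x. g x * V x * k y x \<partial>\<mu>))) \<in> borel_measurable \<mu>" by measurable
    qed
    also have "\<dots> = ip (P t h) g" by (rule symmetric[OF t h g])
    finally show "ip (P t h) g = ip u g" by simp
  qed (use t h u in auto)
  then have "AE x in \<mu>. P t h x = u x" by (rule AE_eq_of_null) (use t h u in auto)
  then show ?thesis by (simp add: u_def)
qed

text \<open>For a single set \<open>B\<close>, \<open>\<kappa>\<^sub>t(x, B) = \<integral>\<^sub>B V(x) V(y) k(x,y) \<mu>(dy)\<close> holds outside a null set of \<open>x\<close> that
  depends on \<open>B\<close>. For a product measurable set \<open>X\<close> in place of \<open>B\<close>, a Dynkin argument gives the
  identity on the sections of \<open>X\<close>, and the set \<open>X = {k < 0}\<close> is then a test for all \<open>x\<close> at once.\<close>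

lemma weighted_kernel_nonneg:
  assumes t: "0 \<le> t" and k: "(\<lambda>(x, y). k x y) \<in> borel_measurable (\<mu> \<Otimes>\<^sub>M \<mu>)"
    and bound: "\<And>x y. \<bar>k x y\<bar> \<le> C"
    and rep: "\<And>h. h \<in> L2 \<Longrightarrow> AE x in \<mu>. P t h x = V x * (\<integral>y. h y * V y * k x y \<partial>\<mu>)"
  shows "AE x in \<mu>. AE y in \<mu>. 0 \<le> k x y"
proof -
  obtain A :: "nat \<Rightarrow> 'a set" where A: "range A \<subseteq> sets \<mu>" "(\<Union>i. A i) = space \<mu>"
      "\<And>i. emeasure \<mu> (A i) \<noteq> \<infinity>" "incseq A"
    by (rule sigma_finite_incseq) blast
  have A_sets: "A n \<in> sets \<mu>" for n using A by auto
  define q where "q x y = V x * V y * k x y" for x y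
  \<comment> \<open>Sections are cut to the sets \<open>A n\<close> of finite measure, whose
    indicators lie in L2, so that \<open>rep\<close> applies and \<open>q x\<close> is integrable on
    them.\<close>
  define W where "W n X x = {y \<in> A n. (x, y) \<in> X}" for n :: nat and X :: "('a \<times> 'a) set" and x
  have W_sets: "W n X x \<in> sets \<mu>" if "X \<in> sets (\<mu> \<Otimes>\<^sub>M \<mu>)" for n X x
  proof -
    have "W n X x = A n \<inter> Pair x -` X" by (auto simp: W_def)
    then show ?thesis using A_sets sets_Pair1[OF that] by auto
  qed
  have q_int: "set_integrable \<mu> (A n) (q x)" if x: "x \<in> space \<mu>" for n x
  proof -
    have "integrable \<mu> (\<lambda>y. V x * (indicator (A n) y * V y * k x y))"
      using A by (intro integrable_mult_right weighted_integrable[OF L2_indicator k bound x]) (auto simp: A_sets)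
    then show ?thesis by (simp add: set_integrable_def q_def mult_ac)
  qed
  have q_int': "set_integrable \<mu> (W n X x) (q x)" if "x \<in> space \<mu>" "X \<in> sets (\<mu> \<Otimes>\<^sub>M \<mu>)" for n X x
    using q_int[OF that(1), of n] W_sets[OF that(2)] by (rule set_integrable_subset) (auto simp: W_def)
  have base: "AE x in \<mu>. measure (\<kappa> t x) B = (LINT y:B|\<mu>. q x y)"
    if B: "B \<in> sets \<mu>" "B \<subseteq> A n" for B n
  proof -
    have "emeasure \<mu> B \<noteq> \<infinity>" using emeasure_mono[OF B(2) A_sets] A(3)[of n] by (auto simp: top_unique)
    then have "indicator B \<in> L2" using B by (intro L2_indicator)
    from rep[OF this] show ?thesis using AE_space
    proof eventually_elim
      case (elim x)
      have "P t (indicator B) x = measure (\<kappa> t x) B"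
        using B kernel_prob[OF t elim(2)] sets.sets_into_space[OF B(1)] by (simp add: kernel_op_def Int_absorb2)
      moreover have "V x * (\<integral>y. indicator B y * V y * k x y \<partial>\<mu>) = (LINT y:B|\<mu>. q x y)"
        unfolding set_lebesgue_integral_def q_def
        by (subst integral_mult_right_zero[symmetric]) (simp add: mult_ac)
      ultimately show ?case using elim(1) by simp
    qed
  qed
  have dens: "AE x in \<mu>. measure (\<kappa> t x) (W n X x) = (LINT y:W n X x|\<mu>. q x y)"
    if X: "X \<in> sets (\<mu> \<Otimes>\<^sub>M \<mu>)" for n X
    using Int_stable_pair_measure_generator[of \<mu> \<mu>] pair_measure_closed X unfolding sets_pair_measure
  proof (induction rule: sigma_sets_induct_disjoint)
    \<comment> \<open>The section of a rectangle is either \<open>A n \<inter> b\<close> or empty. A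
      single exceptional null set therefore serves for all \<open>x\<close>.\<close>
    case (basic X)
    then obtain a b where X: "X = a \<times> b" "a \<in> sets \<mu>" "b \<in> sets \<mu>" by auto
    have "AE x in \<mu>. measure (\<kappa> t x) (A n \<inter> b) = (LINT y:A n \<inter> b|\<mu>. q x y)"
      using X A_sets by (intro base[of _ n]) auto
    then show ?case
    proof eventually_elim
      case (elim x)
      have "W n X x = (if x \<in> a then A n \<inter> b else {})" using X by (auto simp: W_def)
      then show ?case using elim by (simp add: set_lebesgue_integral_def)
    qed
  next
    case empty
    then show ?case by (simp add: W_def set_lebesgue_integral_def)
  next
    case (compl X)
    have X: "X \<in> sets (\<mu> \<Otimes>\<^sub>M \<mu>)" using compl(1) by (simp add: sets_pair_measure)
    have "AE x in \<mu>. measure (\<kappa> t x) (A n) = (LINT y:A n|\<mu>. q x y)"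
      using A_sets by (intro base[of _ n]) auto
    then show ?case using compl(2) AE_space
    proof eventually_elim
      case (elim x)
      interpret K: prob_space "\<kappa> t x" by (rule kernel_prob(1)[OF t elim(3)])
      have An: "A n \<subseteq> space \<mu>" using sets.sets_into_space[OF A_sets] .
      have eq: "W n (space \<mu> \<times> space \<mu> - X) x = A n - W n X x" using An elim(3) by (auto simp: W_def)
      have sub: "W n X x \<subseteq> A n" by (auto simp: W_def)
      have "measure (\<kappa> t x) (A n - W n X x) = measure (\<kappa> t x) (A n) - measure (\<kappa> t x) (W n X x)"
        using A_sets W_sets[OF X] kernel_prob(2)[OF t elim(3)] sub by (intro K.finite_measure_Diff) auto
      moreover have "(LINT y:A n|\<mu>. q x y) = (LINT y:(A n - W n X x) \<union> W n X x|\<mu>. q x y)"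
        using sub by (simp add: Un_absorb2)
      moreover have "\<dots> = (LINT y:A n - W n X x|\<mu>. q x y) + (LINT y:W n X x|\<mu>. q x y)"
        using W_sets[OF X] A_sets q_int'[OF elim(3) X] sub
        by (intro set_integral_Un set_integrable_subset[OF q_int[OF elim(3), of n]]) auto
      ultimately show ?case using elim(1,2) by (simp add: eq)
    qed
  next
    case (union X)
    have X: "X i \<in> sets (\<mu> \<Otimes>\<^sub>M \<mu>)" for i using union(2) by (auto simp: sets_pair_measure)
    have UX: "(\<Union>i. X i) \<in> sets (\<mu> \<Otimes>\<^sub>M \<mu>)" using X by auto
    have "AE x in \<mu>. \<forall>i. measure (\<kappa> t x) (W n (X i) x) = (LINT y:W n (X i) x|\<mu>. q x y)"
      unfolding AE_all_countable using union(3) by blast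
    then show ?case using AE_space
    proof eventually_elim
      case (elim x)
      interpret K: prob_space "\<kappa> t x" by (rule kernel_prob(1)[OF t elim(2)])
      have eq: "W n (\<Union>i. X i) x = (\<Union>i. W n (X i) x)" by (auto simp: W_def)
      have disj: "W n (X i) x \<inter> W n (X j) x = {}" if "i \<noteq> j" for i j
        using union(1) that by (auto simp: disjoint_family_on_def W_def)
      have "(\<lambda>i. measure (\<kappa> t x) (W n (X i) x)) sums measure (\<kappa> t x) (\<Union>i. W n (X i) x)"
        using W_sets[OF X] kernel_prob(2)[OF t elim(2)] disj
        by (intro K.finite_measure_UNION) (auto simp: disjoint_family_on_def)
      then have "measure (\<kappa> t x) (\<Union>i. W n (X i) x) = (\<Sum>i. measure (\<kappa> t x) (W n (X i) x))"
        by (rule sums_unique)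
      also have "\<dots> = (\<Sum>i. (LINT y:W n (X i) x|\<mu>. q x y))" using elim(1) by simp
      also have "\<dots> = (LINT y:(\<Union>i. W n (X i) x)|\<mu>. q x y)"
        using W_sets[OF X] disj q_int'[OF elim(2) UX, of n]
        by (intro lebesgue_integral_countable_add[symmetric]) (auto simp: eq)
      finally show ?case by (simp add: eq)
    qed
  qed
  define X where "X = {z \<in> space (\<mu> \<Otimes>\<^sub>M \<mu>). k (fst z) (snd z) < 0}"
  have [measurable]: "(\<lambda>z. k (fst z) (snd z)) \<in> borel_measurable (\<mu> \<Otimes>\<^sub>M \<mu>)"
    using k by (simp add: split_beta')
  have X: "X \<in> sets (\<mu> \<Otimes>\<^sub>M \<mu>)" unfolding X_def by measurable
  have "AE x in \<mu>. \<forall>n. measure (\<kappa> t x) (W n X x) = (LINT y:W n X x|\<mu>. q x y)"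
    unfolding AE_all_countable using dens[OF X] by blast
  then show ?thesis using AE_space
  proof eventually_elim
    case (elim x)
    have neg: "q x y < 0" if "y \<in> W n X x" for n y
      using that V_pos by (auto simp: W_def X_def q_def space_pair_measure mult_pos_neg)
    have "AE y in \<mu>. y \<notin> W n X x" for n
    proof -
      have int: "integrable \<mu> (\<lambda>y. - (indicator (W n X x) y * q x y))"
        using q_int'[OF elim(2) X, of n] by (simp add: set_integrable_def)
      have nonneg: "AE y in \<mu>. 0 \<le> - (indicator (W n X x) y * q x y)"
        using neg by (auto simp: indicator_def intro: less_imp_le)
      \<comment> \<open>The integral equals a measure, yet its integrand is negative on the section.
        It must vanish, and the section is a null set.\<close>
      have "0 \<le> (LINT y:W n X x|\<mu>. q x y)" using elim(1) by (metis measure_nonneg)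
      then have "(\<integral>y. - (indicator (W n X x) y * q x y) \<partial>\<mu>) \<le> 0"
        by (simp add: set_lebesgue_integral_def)
      moreover have "0 \<le> (\<integral>y. - (indicator (W n X x) y * q x y) \<partial>\<mu>)"
        using nonneg by (rule integral_nonneg_AE)
      ultimately have "AE y in \<mu>. - (indicator (W n X x) y * q x y) = 0"
        using integral_nonneg_eq_0_iff_AE[OF int nonneg] by simp
      then show ?thesis
      proof eventually_elim
        case (elim y)
        show ?case
        proof
          assume "y \<in> W n X x"
          then show False using elim neg[of y n] by simp
        qed
      qed
    qed
    then have "AE y in \<mu>. \<forall>n. y \<notin> W n X x" unfolding AE_all_countable by blast
    then show ?case using AE_space
    proof eventually_elim
      case (elim y)
      then obtain n where "y \<in> A n" using A(2) by blast
      then show ?case using elim \<open>x \<in> space \<mu>\<close> by (force simp: W_def X_def space_pair_measure)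
    qed
  qed
qed

text \<open>\<open>has_kernel_density\<close> asks for symmetry and nonnegativity at every point of
  the space. Averaging \<open>k\<close> with its transpose represents the same operator by a kernel
  symmetric everywhere; cutting it off at 0 keeps symmetry and, for almost every \<open>x\<close>,
  changes the section on a null set only.\<close>

lemma density_exists:
  assumes nice: "nice_measure_space \<mu>" and t: "0 < t"
  shows "\<exists>p. has_kernel_density \<mu> (P (2 * t)) p \<and>
    (AE (x, y) in \<mu> \<Otimes>\<^sub>M \<mu>. p x y \<le> (bnd t)\<^sup>2 * V x * V y)"
proof -
  have t2: "0 \<le> 2 * t" using t by simp
  obtain k where k: "(\<lambda>(x, y). k x y) \<in> borel_measurable (\<mu> \<Otimes>\<^sub>M \<mu>)" "\<And>x y. \<bar>k x y\<bar> \<le> (bnd t)\<^sup>2"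
    "\<And>h. h \<in> L2 \<Longrightarrow> AE x in \<mu>. P (2 * t) h x = V x * (\<integral>y. h y * V y * k x y \<partial>\<mu>)"
    using weighted_kernel[OF nice t] by blast
  have [measurable]: "(\<lambda>z. k (fst z) (snd z)) \<in> borel_measurable (\<mu> \<Otimes>\<^sub>M \<mu>)"
    using k(1) by (simp add: split_beta')
  have kT: "(\<lambda>(x, y). k y x) \<in> borel_measurable (\<mu> \<Otimes>\<^sub>M \<mu>)"
    using measurable_pair_swap[OF k(1)] by simp
  then have [measurable]: "(\<lambda>z. k (snd z) (fst z)) \<in> borel_measurable (\<mu> \<Otimes>\<^sub>M \<mu>)"
    by (simp add: split_beta')
  define s where "s x y = (k x y + k y x) / 2" for x y
  have s_meas: "(\<lambda>(x, y). s x y) \<in> borel_measurable (\<mu> \<Otimes>\<^sub>M \<mu>)"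
    unfolding s_def split_beta' by measurable
  have s_bound: "\<bar>s x y\<bar> \<le> (bnd t)\<^sup>2" for x y
    using k(2)[of x y] k(2)[of y x] by (simp add: s_def abs_le_iff)
  have s_rep: "AE x in \<mu>. P (2 * t) h x = V x * (\<integral>y. h y * V y * s x y \<partial>\<mu>)"
    if h: "h \<in> L2" for h
  proof -
    have "AE x in \<mu>. P (2 * t) h x = V x * (\<integral>y. h y * V y * k y x \<partial>\<mu>)"
      by (rule weighted_kernel_transpose[OF t2 k(1,2) k(3)]) (use h in auto)
    then show ?thesis using k(3)[OF h] AE_space
    proof eventually_elim
      case (elim x)
      have "(\<integral>y. h y * V y * s x y \<partial>\<mu>) = (\<integral>y. h y * V y * k x y / 2 + h y * V y * k y x / 2 \<partial>\<mu>)"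
        by (simp add: s_def distrib_left add_divide_distrib)
      also have "\<dots> = (\<integral>y. h y * V y * k x y \<partial>\<mu>) / 2 + (\<integral>y. h y * V y * k y x \<partial>\<mu>) / 2"
        using weighted_integrable[OF h k(1,2) elim(3)] weighted_integrable[OF h kT k(2) elim(3)] by simp
      finally have "V x * (\<integral>y. h y * V y * s x y \<partial>\<mu>)
          = (V x * (\<integral>y. h y * V y * k x y \<partial>\<mu>) + V x * (\<integral>y. h y * V y * k y x \<partial>\<mu>)) / 2"
        by (simp only: distrib_left add_divide_distrib times_divide_eq_right)
      then have "V x * (\<integral>y. h y * V y * s x y \<partial>\<mu>) = (P (2 * t) h x + P (2 * t) h x) / 2"
        by (simp only: elim(1)[symmetric] elim(2)[symmetric])
      then show ?case by simp
    qed
  qed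
  have s_nonneg: "AE x in \<mu>. AE y in \<mu>. 0 \<le> s x y"
    by (rule weighted_kernel_nonneg[OF t2 s_meas s_bound s_rep])
  define p where "p x y = V x * V y * max 0 (s x y)" for x y
  have m_meas: "(\<lambda>(x, y). max 0 (s x y)) \<in> borel_measurable (\<mu> \<Otimes>\<^sub>M \<mu>)"
    unfolding s_def split_beta' by measurable
  have m_bound: "\<bar>max 0 (s x y)\<bar> \<le> (bnd t)\<^sup>2" for x y
    using s_bound[of x y] by (simp add: abs_le_iff)
  have "has_kernel_density \<mu> (P (2 * t)) p"
    unfolding has_kernel_density_def
  proof (intro conjI ballI)
    show "(\<lambda>(x, y). p x y) \<in> borel_measurable (\<mu> \<Otimes>\<^sub>M \<mu>)"
      unfolding p_def s_def split_beta' by measurable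
    show "0 \<le> p x y" if "x \<in> space \<mu>" "y \<in> space \<mu>" for x y
      using V_pos[OF that(1)] V_pos[OF that(2)] by (simp add: p_def)
    show "p x y = p y x" for x y by (simp add: p_def s_def mult.commute add.commute)
    fix f assume f: "f \<in> L2"
    have [measurable]: "f \<in> borel_measurable \<mu>" using f by (rule L2_spaceD)
    show "AE x in \<mu>. integrable \<mu> (\<lambda>y. f y * p x y) \<and> P (2 * t) f x = (\<integral>y. f y * p x y \<partial>\<mu>)"
      using s_rep[OF f] s_nonneg AE_space
    proof eventually_elim
      case (elim x)
      have p_eq: "(\<lambda>y. f y * p x y) = (\<lambda>y. V x * (f y * V y * max 0 (s x y)))"
        by (simp add: p_def fun_eq_iff mult_ac)
      have "(\<integral>y. f y * V y * s x y \<partial>\<mu>) = (\<integral>y. f y * V y * max 0 (s x y) \<partial>\<mu>)"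
        using elim(2) weighted_integrable[OF f s_meas s_bound elim(3)] weighted_integrable[OF f m_meas m_bound elim(3)]
        by (intro integral_cong_AE) (auto dest: borel_measurable_integrable elim!: eventually_mono)
      then show ?case
        unfolding p_eq using elim(1) weighted_integrable[OF f m_meas m_bound elim(3)] by simp
    qed
  qed
  moreover have "p x y \<le> (bnd t)\<^sup>2 * V x * V y" if "x \<in> space \<mu>" "y \<in> space \<mu>" for x y
  proof -
    have "V x * V y * max 0 (s x y) \<le> V x * V y * (bnd t)\<^sup>2"
      using V_pos[OF that(1)] V_pos[OF that(2)] m_bound[of x y] by (intro mult_left_mono) auto
    then show ?thesis by (simp add: p_def mult_ac)
  qed
  then have "AE (x, y) in \<mu> \<Otimes>\<^sub>M \<mu>. p x y \<le> (bnd t)\<^sup>2 * V x * V y"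
    by (intro AE_I2) (auto simp: space_pair_measure)
  ultimately show ?thesis by blast
qed

end

theorem corollary2p8:
  fixes \<mu> :: "'a measure" and \<kappa> :: "real \<Rightarrow> 'a \<Rightarrow> 'a measure"
    and V :: "'a \<Rightarrow> real" and c M :: real and \<phi> :: "real \<Rightarrow> real"
  assumes "nice_measure_space \<mu>"
    and "symmetric_markov_semigroup \<mu> \<kappa>"
    and "V \<in> L2_space \<mu>" and "lyapunov_function \<mu> \<kappa> V c" and "0 \<le> c"
    and "0 \<le> M" and "weighted_nash \<mu> \<kappa> V M \<phi>"
    and "\<exists>a>M. set_integrable lborel {a<..} (\<lambda>x. 1 / \<phi> x)"
  shows "(\<exists>p. (\<forall>t>0. has_kernel_density \<mu> (kernel_op (\<kappa> t)) (p t)) \<and>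
              (\<forall>t>0. AE (x, y) in \<mu> \<Otimes>\<^sub>M \<mu>.
                 p (2 * t) x y \<le> (nash_K M \<phi> (2 * t))\<^sup>2 * exp (2 * c * t) * V x * V y)) \<and>
         (\<forall>t>0. hilbert_schmidt \<mu> (kernel_op (\<kappa> t)) \<and>
              (\<exists>I lam. has_discrete_spectrum \<mu> (kernel_op (\<kappa> t)) I lam \<and>
                 (\<lambda>n. (lam n)\<^sup>2) summable_on I \<and>
                 (\<Sum>\<^sub>\<infinity>n\<in>I. (lam n)\<^sup>2) \<le>
                   (nash_K M \<phi> (2 * t))\<^sup>2 * exp (2 * c * t) * (\<integral>x. (V x)\<^sup>2 \<partial>\<mu>)))"
proof -
  interpret symmetric_markov_semigroup \<mu> \<kappa> by (rule assms(2))
  interpret nash_rate M \<phi>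
    using assms(6,7,8) by unfold_locales (auto simp: weighted_nash_def)
  interpret nash_lyapunov \<mu> \<kappa> M \<phi> V c
    using assms(3,4,5,7) by unfold_locales
  define Q where "Q t p \<longleftrightarrow> has_kernel_density \<mu> (kernel_op (\<kappa> (2 * t))) p \<and>
      (AE (x, y) in \<mu> \<Otimes>\<^sub>M \<mu>. p x y \<le> (bnd t)\<^sup>2 * V x * V y)" for t p
  have "\<forall>t\<in>{0<..}. \<exists>p. Q t p" using density_exists[OF assms(1)] by (simp add: Q_def)
  then obtain q where q: "\<forall>t\<in>{0<..}. Q t (q t)" by (rule bchoice[THEN exE])
  show ?thesis
  \<comment> \<open>The densities were built for doubled times: \<open>q (t / 2)\<close> belongs to
    time \<open>t\<close>, and at time \<open>2 * t\<close> this is \<open>q t\<close>, which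
    carries the bound.\<close>
  proof (intro conjI allI impI exI[of _ "\<lambda>t. q (t / 2)"])
    fix t :: real assume t: "0 < t"
    show "has_kernel_density \<mu> (kernel_op (\<kappa> t)) (q (t / 2))"
      using bspec[OF q, of "t / 2"] t by (simp add: Q_def)
    show "AE (x, y) in \<mu> \<Otimes>\<^sub>M \<mu>.
        q (2 * t / 2) x y \<le> (nash_K M \<phi> (2 * t))\<^sup>2 * exp (2 * c * t) * V x * V y"
      using bspec[OF q, of t] t by (simp add: Q_def bnd_sq)
    show "hilbert_schmidt \<mu> (kernel_op (\<kappa> t))" by (rule spectrum_semi(1)[OF t])
    show "\<exists>I lam. has_discrete_spectrum \<mu> (kernel_op (\<kappa> t)) I lam \<and> (\<lambda>n. (lam n)\<^sup>2) summable_on I \<and>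
        (\<Sum>\<^sub>\<infinity>n\<in>I. (lam n)\<^sup>2) \<le> (nash_K M \<phi> (2 * t))\<^sup>2 * exp (2 * c * t) * (\<integral>x. (V x)\<^sup>2 \<partial>\<mu>)"
      using spectrum_semi(2)[OF t] by (simp only: bnd_sq)
  qed
qed

end
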